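(* Let $f\in\mathcal R$, and let $\mathcal P_t(f)$ denote the set of all periods of exact ternary cycles of $f$. If $m,n\in\mathbb N_3$ satisfy $m>n$ and $n\in\mathcal P_t(f)$, then there exists a neighborhood $N$ of $f$ in $\mathcal R$ such that $m\in\mathcal P_t(g)$ for every $g\in N$. Equivalently, there exists $m\in\mathbb N_3$ for which $\mathcal P_t(f)=\mathcal M_t(m)$, and for all $g\in\mathcal R$ sufficiently close to $f$, $\mathcal M_t(m)\subseteq\mathcal P_t(g)$.
   Context: $\mathbb N_3$ is the set of positive multiples of $3$ strictly greater than $3$; for $m\in\mathbb N_3$, $\mathcal M_t(m)=\{n\in\mathbb N_3:n>m\}\cup\{m\}$ (usual order). Triod: $\tau=\{z\in\mathbb C: z^3\in[0,1]\}$, with branching point $a=0$; the branches are the three components of $\tau\setminus\{a\}$. For $S\subset\tau$, $[S]$ is the smallest closed connected subset of $\tau$ containing $S$. Maps and cycles: $\mathcal U$ is the set of continuous maps $f:\tau\to\tau$ whose unique fixed point is $a$. A cycle of $f$ is a periodic orbit $P\subset\tau\setminus\{a\}$; its period is its cardinality. A cycle $P$ of $f$ and a cycle $Q$ of $g$ are equivalent if there is a homeomorphism $h:[P]\to[Q]$ preserving each branch, with $h(P)=Q$ and $h\circ f=g\circ h$ on $P$; an equivalence class is a pattern, and a cycle exhibits its class. A pattern $A$ forces a pattern $B$ if every $f\in\mathcal U$ having a cycle of pattern $A$ also has a cycle of pattern $B$. A pattern is primitive if the points of a cycle exhibiting it lie on pairwise different branches. A pattern is regular if it forces no primitive pattern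 of period $2$; a cycle is regular if its pattern is. $\mathcal R$ is the set of $f\in\mathcal U$ all of whose cycles are regular, with the topology of the metric $D(f,g)=\sup_{x\in\tau}d_\tau(f(x),g(x))$, where $d_\tau(x,y)=\big||x|-|y|\big|$ if $x,y$ are on the same branch and $|x|+|y|$ otherwise. Rotation numbers: every regular cycle $P$ (of $f$) has a point on each branch, and the branches can be numbered $b_0,b_1,b_2$ (indices mod $3$; the canonical ordering) so that, $p_i$ being the point of $P\cap b_i$ closest to $a$, $f(p_i)\in b_{i+1}$ for $i=0,1,2$. The canonical ordering is always used. For $x\in P\cap b_i$ with $f(x)\in b_{i+k}$, $k\in\{0,1,2\}$, put $d(x)=k/3$. For $P$ of period $n$ the rotation number is $\rho(P)=\frac1n\sum_{x\in P}d(x)$. $P$ is ternary if $\rho(P)=\frac13$. Exactness: the $P$-linear map $f_P$ of a cycle $P$ of $f$ is the continuous map $\tau\to\tau$ fixing $a$, equal to $f$ on $P$, affine on each component of $[P]\setminus(P\cup\{a\})$ and constant on each component of $\tau\setminus[P]$. $P$ is an exact cycle if $f_P|_{[P]}:[P]\to[P]$ is topologically exact: for every nonempty open $U\subset[P]$ there is $n$ with $f_P^n(U)=[P]$.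
   Formalization: In the second sentence, P_t(f) is assumed nonempty (it is empty for a rotation of the triod), and for g close to f only the elements of M_t(m) other than m are claimed to lie in P_t(g), since the least period m can be destroyed by arbitrarily small perturbations. *)

theory Defs
  imports "HOL-Analysis.Analysis" "HOL-Combinatorics.Orbits"
begin

definition N3 :: "nat set" where
  "N3 = {n. 3 dvd n \<and> 3 < n}"

definition M_t :: "nat \<Rightarrow> nat set" where
  "M_t m = {n \<in> N3. n > m} \<union> {m}"

section \<open>The triod\<close>

definition triod :: "complex set" where
  "triod = {z. z ^ 3 \<in> complex_of_real ` {0..1}}"

definition branches :: "complex set set" where
  "branches = components (triod - {0})"

definition same_branch :: "complex \<Rightarrow> complex \<Rightarrow> bool" where
  "same_branch x y \<longleftrightarrow> (\<exists>b\<in>branches. x \<in> b \<and> y \<in> b)"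

definition tdist :: "complex \<Rightarrow> complex \<Rightarrow> real" where
  "tdist x y = (if same_branch x y then \<bar>cmod x - cmod y\<bar> else cmod x + cmod y)"

definition thull :: "complex set \<Rightarrow> complex set" where
  "thull S = \<Inter>{C. S \<subseteq> C \<and> C \<subseteq> triod \<and> closed C \<and> connected C}"

section \<open>Maps, cycles and patterns\<close>

text \<open>Self-maps of the triod are represented by extensional functions (value \<open>undefined\<close> off the
  triod), so that equality of functions is equality of maps.\<close>

definition triod_maps :: "(complex \<Rightarrow> complex) set" where
  "triod_maps = {f \<in> triod \<rightarrow>\<^sub>E triod. continuous_on triod f \<and> {x \<in> triod. f x = x} = {0}}"

definition cycle :: "(complex \<Rightarrow> complex) \<Rightarrow> complex set \<Rightarrow> bool" where
  "cycle f P \<longleftrightarrow> cyclic_on f P \<and> P \<subseteq> triod - {0}"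

definition marked_cycles :: "((complex \<Rightarrow> complex) \<times> complex set) set" where
  "marked_cycles = {(f, P). f \<in> triod_maps \<and> cycle f P}"

definition cycle_equiv ::
  "(((complex \<Rightarrow> complex) \<times> complex set) \<times> ((complex \<Rightarrow> complex) \<times> complex set)) set" where
  "cycle_equiv = {((f, P), (g, Q)). (f, P) \<in> marked_cycles \<and> (g, Q) \<in> marked_cycles \<and>
     (\<exists>h k. homeomorphism (thull P) (thull Q) h k \<and>
            (\<forall>b\<in>branches. h ` (thull P \<inter> b) = thull Q \<inter> b) \<and>
            h ` P = Q \<and> (\<forall>x\<in>P. h (f x) = g (h x)))}"

type_synonym pattern = "((complex \<Rightarrow> complex) \<times> complex set) set"

definition patterns :: "pattern set" where
  "patterns = marked_cycles // cycle_equiv"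

definition pattern_of :: "(complex \<Rightarrow> complex) \<Rightarrow> complex set \<Rightarrow> pattern" where
  "pattern_of f P = cycle_equiv `` {(f, P)}"

definition has_cycle_of_pattern :: "(complex \<Rightarrow> complex) \<Rightarrow> pattern \<Rightarrow> bool" where
  "has_cycle_of_pattern f A \<longleftrightarrow> (\<exists>P. (f, P) \<in> A)"

definition forces :: "pattern \<Rightarrow> pattern \<Rightarrow> bool" where
  "forces A B \<longleftrightarrow>
     (\<forall>f\<in>triod_maps. has_cycle_of_pattern f A \<longrightarrow> has_cycle_of_pattern f B)"

definition primitive :: "pattern \<Rightarrow> bool" where
  "primitive A \<longleftrightarrow> (\<forall>(f, P)\<in>A. \<forall>x\<in>P. \<forall>y\<in>P. same_branch x y \<longrightarrow> x = y)"

definition has_period :: "pattern \<Rightarrow> nat \<Rightarrow> bool" where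
  "has_period A n \<longleftrightarrow> (\<forall>(f, P)\<in>A. card P = n)"

definition regular_pattern :: "pattern \<Rightarrow> bool" where
  "regular_pattern A \<longleftrightarrow> \<not> (\<exists>B\<in>patterns. primitive B \<and> has_period B 2 \<and> forces A B)"

definition regular_cycle :: "(complex \<Rightarrow> complex) \<Rightarrow> complex set \<Rightarrow> bool" where
  "regular_cycle f P \<longleftrightarrow> cycle f P \<and> regular_pattern (pattern_of f P)"

definition regular_maps :: "(complex \<Rightarrow> complex) set" where
  "regular_maps = {f \<in> triod_maps. \<forall>P. cycle f P \<longrightarrow> regular_cycle f P}"

text \<open>The value 0 off \<open>regular_maps\<close> only serves to meet the locale \<open>Metric_space\<close>, which demands
  nonnegativity for all arguments.\<close>

definition map_dist :: "(complex \<Rightarrow> complex) \<Rightarrow> (complex \<Rightarrow> complex) \<Rightarrow> real" where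
  "map_dist f g = (if f \<in> regular_maps \<and> g \<in> regular_maps
                   then SUP x\<in>triod. tdist (f x) (g x) else 0)"

definition regular_maps_topology :: "(complex \<Rightarrow> complex) topology" where
  "regular_maps_topology = Metric_space.mtopology regular_maps map_dist"

section \<open>Rotation numbers\<close>

definition canonical_ordering ::
  "(complex \<Rightarrow> complex) \<Rightarrow> complex set \<Rightarrow> (nat \<Rightarrow> complex set) \<Rightarrow> bool" where
  "canonical_ordering f P b \<longleftrightarrow> bij_betw b {..<3} branches \<and>
     (\<forall>i<3. \<exists>p \<in> P \<inter> b i. (\<forall>q \<in> P \<inter> b i. cmod p \<le> cmod q) \<and> f p \<in> b ((i + 1) mod 3))"

definition displacement :: "(nat \<Rightarrow> complex set) \<Rightarrow> (complex \<Rightarrow> complex) \<Rightarrow> complex \<Rightarrow> real" where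
  "displacement b f x =
     real (THE k. k < 3 \<and> (\<exists>i<3. x \<in> b i \<and> f x \<in> b ((i + k) mod 3))) / 3"

text \<open>A canonical ordering is unique up to a cyclic shift of the indices, and such a shift does not
  change the displacements, so the choice is harmless.\<close>

definition rotation_number :: "(complex \<Rightarrow> complex) \<Rightarrow> complex set \<Rightarrow> real" where
  "rotation_number f P =
     (let b = (SOME b. canonical_ordering f P b)
      in (\<Sum>x\<in>P. displacement b f x) / real (card P))"

definition ternary_cycle :: "(complex \<Rightarrow> complex) \<Rightarrow> complex set \<Rightarrow> bool" where
  "ternary_cycle f P \<longleftrightarrow> regular_cycle f P \<and> rotation_number f P = 1 / 3"

section \<open>Exactness\<close>

text \<open>Affine maps between arcs of the triod scale the arc-length metric by a constant factor. Being
  affine as a map into the plane would be wrong here: the image of an arc may turn at the branching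
  point.\<close>

definition affine_on :: "complex set \<Rightarrow> (complex \<Rightarrow> complex) \<Rightarrow> bool" where
  "affine_on C F \<longleftrightarrow> (\<exists>L\<ge>0. \<forall>x\<in>C. \<forall>y\<in>C. tdist (F x) (F y) = L * tdist x y)"

definition is_linear_map ::
  "(complex \<Rightarrow> complex) \<Rightarrow> complex set \<Rightarrow> (complex \<Rightarrow> complex) \<Rightarrow> bool" where
  "is_linear_map f P F \<longleftrightarrow>
     F \<in> triod \<rightarrow>\<^sub>E triod \<and> continuous_on triod F \<and> F 0 = 0 \<and> (\<forall>x\<in>P. F x = f x) \<and>
     (\<forall>C \<in> components (thull P - (P \<union> {0})). affine_on C F) \<and>
     (\<forall>C \<in> components (triod - thull P). F constant_on C)"

definition linear_map :: "(complex \<Rightarrow> complex) \<Rightarrow> complex set \<Rightarrow> complex \<Rightarrow> complex" where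
  "linear_map f P = (THE F. is_linear_map f P F)"

definition topologically_exact_on :: "complex set \<Rightarrow> (complex \<Rightarrow> complex) \<Rightarrow> bool" where
  "topologically_exact_on X F \<longleftrightarrow>
     (\<forall>U. openin (top_of_set X) U \<and> U \<noteq> {} \<longrightarrow> (\<exists>n. (F ^^ n) ` U = X))"

definition exact_cycle :: "(complex \<Rightarrow> complex) \<Rightarrow> complex set \<Rightarrow> bool" where
  "exact_cycle f P \<longleftrightarrow> cycle f P \<and> topologically_exact_on (thull P) (linear_map f P)"

definition P_t :: "(complex \<Rightarrow> complex) \<Rightarrow> nat set" where
  "P_t f = {card P | P. exact_cycle f P \<and> ternary_cycle f P}"

section \<open>The metrics\<close>

lemma same_branch_sym: "same_branch x y \<longleftrightarrow> same_branch y x"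
  by (auto simp: same_branch_def)

lemma same_branch_trans: "same_branch x y \<Longrightarrow> same_branch y z \<Longrightarrow> same_branch x z"
  unfolding same_branch_def branches_def
  by (metis components_nonoverlap disjoint_iff)

lemma same_branch_refl: "x \<in> triod \<Longrightarrow> x \<noteq> 0 \<Longrightarrow> same_branch x x"
  unfolding same_branch_def branches_def
  by (metis Diff_iff UnionE Union_components empty_iff insert_iff)

lemma triod_norm_le: "z \<in> triod \<Longrightarrow> cmod z \<le> 1"
proof -
  assume "z \<in> triod"
  then obtain r where "0 \<le> r" "r \<le> 1" "z ^ 3 = complex_of_real r"
    by (auto simp: triod_def)
  then have "cmod z ^ 3 \<le> 1"
    by (metis abs_of_nonneg norm_of_real norm_power)
  then show ?thesis
    by (metis linorder_not_le one_less_power zero_less_numeral)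
qed

lemma same_branch_norm_eq:
  assumes "same_branch x y" "cmod x = cmod y"
  shows "x = y"
proof -
  obtain b where b: "b \<in> components (triod - {0})" "x \<in> b" "y \<in> b"
    using assms(1) by (auto simp: same_branch_def branches_def)
  have sub: "b \<subseteq> triod - {0}"
    using b(1) in_components_subset by blast
  define s where "s z = z / complex_of_real (cmod z)" for z
  have "continuous_on b s"
    unfolding s_def using sub by (intro continuous_intros) auto
  then have conn: "connected (s ` b)"
    using b(1) connected_continuous_image in_components_connected by blast
  have "s z ^ 3 = 1" if z: "z \<in> b" for z
  proof -
    obtain r where r: "0 \<le> r" "z ^ 3 = complex_of_real r"
      using z sub by (auto simp: triod_def)
    have "z \<noteq> 0" using z sub by auto
    have "cmod z ^ 3 = r"
      using r by (metis abs_of_nonneg norm_of_real norm_power)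
    then have "z ^ 3 = complex_of_real (cmod z) ^ 3"
      using r by (metis of_real_power)
    then show ?thesis
      using \<open>z \<noteq> 0\<close> by (simp add: s_def power_divide)
  qed
  then have "s ` b \<subseteq> {w. w ^ 3 = 1}" by auto
  moreover have "finite {w::complex. w ^ 3 = 1}"
    using finite_roots_unity[of 3] by simp
  ultimately have "finite (s ` b)"
    using finite_subset by blast
  then obtain c where "s ` b \<subseteq> {c}"
    using conn connected_finite_iff_sing by (metis empty_subsetI subset_refl)
  then have "s x = s y" using b by auto
  moreover have "x \<noteq> 0" "y \<noteq> 0" using b sub by auto
  ultimately show ?thesis
    using assms(2) by (simp add: s_def)
qed

lemma Metric_space_tdist: "Metric_space triod tdist"
proof
  show "0 \<le> tdist x y" for x y by (simp add: tdist_def)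
  show "tdist x y = tdist y x" for x y
    using same_branch_sym[of x y] by (auto simp: tdist_def)
  show "tdist x y = 0 \<longleftrightarrow> x = y" if "x \<in> triod" "y \<in> triod" for x y
  proof
    assume eq: "tdist x y = 0"
    show "x = y"
    proof (cases "same_branch x y")
      case True
      then show ?thesis using eq same_branch_norm_eq by (simp add: tdist_def)
    next
      case False
      then have "cmod x + cmod y = 0" using eq by (simp add: tdist_def)
      then show ?thesis
        by (smt (verit) norm_ge_zero norm_eq_zero)
    qed
  next
    assume "x = y"
    then show "tdist x y = 0"
      using same_branch_refl[OF that(1)] by (cases "x = 0") (auto simp: tdist_def)
  qed
  show "tdist x z \<le> tdist x y + tdist y z" for x y z
  proof -
    have "same_branch x y \<Longrightarrow> same_branch y z \<Longrightarrow> same_branch x z"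
      "same_branch x y \<Longrightarrow> same_branch x z \<Longrightarrow> same_branch y z"
      "same_branch x z \<Longrightarrow> same_branch y z \<Longrightarrow> same_branch x y"
      using same_branch_trans same_branch_sym by blast+
    then show ?thesis
      using norm_ge_zero[of x] norm_ge_zero[of y] norm_ge_zero[of z]
      by (auto simp: tdist_def simp del: norm_ge_zero)
  qed
qed

lemma Metric_space_map_dist: "Metric_space regular_maps map_dist"
proof -
  interpret T: Metric_space triod tdist by (rule Metric_space_tdist)
  have map: "f x \<in> triod" if "f \<in> regular_maps" "x \<in> triod" for f x
    using that by (auto simp: regular_maps_def triod_maps_def)
  have ne: "0 \<in> triod"
    by (auto simp: triod_def intro: image_eqI[of _ _ 0])
  have bdd: "bdd_above ((\<lambda>x. tdist (f x) (g x)) ` triod)"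
    if "f \<in> regular_maps" "g \<in> regular_maps" for f g
  proof (rule bdd_aboveI2)
    fix x assume "x \<in> triod"
    then have "cmod (f x) \<le> 1" "cmod (g x) \<le> 1"
      using map that triod_norm_le by blast+
    then show "tdist (f x) (g x) \<le> 2"
      using norm_ge_zero[of "f x"] norm_ge_zero[of "g x"]
      by (auto simp: tdist_def simp del: norm_ge_zero)
  qed
  have up: "tdist (f x) (g x) \<le> map_dist f g"
    if "f \<in> regular_maps" "g \<in> regular_maps" "x \<in> triod" for f g x
    using cSUP_upper[OF that(3) bdd[OF that(1,2)]] that by (simp add: map_dist_def)
  show ?thesis
  proof
    show "0 \<le> map_dist f g" for f g
    proof (cases "f \<in> regular_maps \<and> g \<in> regular_maps")
      case True
      then show ?thesis
        using up[of f g 0] ne T.nonneg[of "f 0" "g 0"] by linarith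
    next
      case False
      then show ?thesis by (auto simp: map_dist_def)
    qed
    show "map_dist f g = map_dist g f" for f g
      by (simp add: map_dist_def T.commute)
    show "map_dist f g = 0 \<longleftrightarrow> f = g" if fg: "f \<in> regular_maps" "g \<in> regular_maps" for f g
    proof
      assume eq: "map_dist f g = 0"
      have "f x = g x" if "x \<in> triod" for x
        using up[OF fg that] eq map fg that
        by (metis T.nonneg T.zero order_antisym)
      moreover have "f \<in> extensional triod" "g \<in> extensional triod"
        using fg by (auto simp: regular_maps_def triod_maps_def PiE_def)
      ultimately show "f = g" by (rule extensionalityI[rotated -1])
    next
      assume "f = g"
      then have "(SUP x\<in>triod. tdist (f x) (g x)) = (SUP x\<in>triod. (0::real))"
        using map fg by (intro SUP_cong) auto
      moreover have "\<dots> = 0"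
        using ne by (intro cSUP_const) auto
      ultimately have "(SUP x\<in>triod. tdist (f x) (g x)) = 0" by simp
      then show "map_dist f g = 0"
        by (simp add: map_dist_def)
    qed
    show "map_dist f h \<le> map_dist f g + map_dist g h"
      if "f \<in> regular_maps" "g \<in> regular_maps" "h \<in> regular_maps" for f g h
    proof -
      have "tdist (f x) (h x) \<le> map_dist f g + map_dist g h" if x: "x \<in> triod" for x
      proof -
        have "tdist (f x) (h x) \<le> tdist (f x) (g x) + tdist (g x) (h x)"
          using T.triangle map that \<open>f \<in> _\<close> \<open>g \<in> _\<close> \<open>h \<in> _\<close> by blast
        then show ?thesis
          using up[OF \<open>f \<in> _\<close> \<open>g \<in> _\<close> x] up[OF \<open>g \<in> _\<close> \<open>h \<in> _\<close> x] by linarith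
      qed
      then have "(SUP x\<in>triod. tdist (f x) (h x)) \<le> map_dist f g + map_dist g h"
        using ne by (intro cSUP_least) auto
      then show ?thesis
        using that by (simp add: map_dist_def)
    qed
  qed
qed

lemma topspace_regular_maps_topology: "topspace regular_maps_topology = regular_maps"
  by (simp add: regular_maps_topology_def Metric_space.topspace_mtopology Metric_space_map_dist)

section \<open>Equivalence of cycles\<close>

lemma subset_thull: "P \<subseteq> thull P"
  by (auto simp: thull_def)

lemma marked_cycles_closed: "(f, P) \<in> marked_cycles \<Longrightarrow> x \<in> P \<Longrightarrow> f x \<in> P"
  using cyclic_on_funpow_in[of f P x 1] by (auto simp: marked_cycles_def cycle_def)

lemma equiv_cycle_equiv: "equiv marked_cycles cycle_equiv"
proof (rule equivI)
  show "cycle_equiv \<subseteq> marked_cycles \<times> marked_cycles"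
    by (auto simp: cycle_equiv_def)
  have "((f, P), (f, P)) \<in> cycle_equiv" if "(f, P) \<in> marked_cycles" for f P
    unfolding cycle_equiv_def using that
    by (auto intro!: exI[of _ "\<lambda>x. x"] homeomorphismI)
  then show "refl_on marked_cycles cycle_equiv"
    by (auto simp: refl_on_def cycle_equiv_def)
  show "sym cycle_equiv"
  proof (rule symI, clarify)
    fix f P g Q assume "((f, P), (g, Q)) \<in> cycle_equiv"
    then obtain h k where fP: "(f, P) \<in> marked_cycles" and gQ: "(g, Q) \<in> marked_cycles"
      and hom: "homeomorphism (thull P) (thull Q) h k"
      and br: "\<forall>b\<in>branches. h ` (thull P \<inter> b) = thull Q \<inter> b"
      and hP: "h ` P = Q" and conj: "\<forall>x\<in>P. h (f x) = g (h x)"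
      by (auto simp: cycle_equiv_def)
    have kh: "k (h x) = x" if "x \<in> thull P" for x
      using hom that by (simp add: homeomorphism_def)
    have inv: "k ` (h ` S) = S" if "S \<subseteq> thull P" for S
      using kh that by (force simp: image_image)
    have "k ` Q = P" using inv[OF subset_thull] hP by auto
    moreover have "\<forall>b\<in>branches. k ` (thull Q \<inter> b) = thull P \<inter> b"
      using br inv by (metis inf_le1)
    moreover have "k (g y) = f (k y)" if "y \<in> Q" for y
    proof -
      obtain x where x: "x \<in> P" "y = h x" using \<open>y \<in> Q\<close> hP by auto
      then have "k (g y) = k (h (f x))" using conj by simp
      also have "\<dots> = f x"
        using kh marked_cycles_closed[OF fP x(1)] subset_thull by blast
      also have "\<dots> = f (k y)" using kh[of x] x subset_thull[of P] by (simp add: subset_iff)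
      finally show ?thesis .
    qed
    ultimately show "((g, Q), (f, P)) \<in> cycle_equiv"
      unfolding cycle_equiv_def using fP gQ homeomorphism_symD[OF hom] by blast
  qed
  show "trans cycle_equiv"
  proof (rule transI, clarify)
    fix f P g Q u R
    assume "((f, P), (g, Q)) \<in> cycle_equiv" "((g, Q), (u, R)) \<in> cycle_equiv"
    then obtain h k h' k' where mc: "(f, P) \<in> marked_cycles" "(u, R) \<in> marked_cycles"
      and hom: "homeomorphism (thull P) (thull Q) h k" "homeomorphism (thull Q) (thull R) h' k'"
      and br: "\<forall>b\<in>branches. h ` (thull P \<inter> b) = thull Q \<inter> b"
        "\<forall>b\<in>branches. h' ` (thull Q \<inter> b) = thull R \<inter> b"
      and im: "h ` P = Q" "h' ` Q = R"
      and conj: "\<forall>x\<in>P. h (f x) = g (h x)" "\<forall>x\<in>Q. h' (g x) = u (h' x)"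
      by (auto simp: cycle_equiv_def)
    have "homeomorphism (thull P) (thull R) (h' \<circ> h) (k \<circ> k')"
      using homeomorphism_compose[OF hom] .
    moreover have "\<forall>b\<in>branches. (h' \<circ> h) ` (thull P \<inter> b) = thull R \<inter> b"
      using br by (metis image_comp)
    moreover have "(h' \<circ> h) ` P = R" using im by (metis image_comp)
    moreover have "\<forall>x\<in>P. (h' \<circ> h) (f x) = u ((h' \<circ> h) x)" using conj im by auto
    ultimately show "((f, P), (u, R)) \<in> cycle_equiv"
      unfolding cycle_equiv_def using mc by blast
  qed
qed

end

theory Submission
  imports Defs
begin

text \<open>A map \<open>f\<close> is regular only if no iterate \<open>f\<close> or \<open>f \<circ> f\<close> moves a point of a branch outwards along that
  branch: otherwise the intermediate value theorem yields a second fixed point or a primitive cycle of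
  period 2. Hence the points of a cycle nearest to the branching point rotate the three branches.

  In a ternary cycle the deviations from rotation by one branch cancel, and exactness makes some of them
  nonzero. Follow the cycle from the nearest point of a branch until the deviations have cancelled
  nontrivially for the first time, and then rotate near the branching point, for \<open>m\<close> steps altogether. By
  minimality this itinerary is aperiodic. Composing the branch coordinates of \<open>f\<close> along it gives an interval
  map with a point \<open>z\<close> that is strictly increased; this persists under perturbation and produces a fixed
  point, that is, a cycle of period \<open>m\<close> with the given itinerary. A level function on the cycle shows that
  backward steps never outnumber forward steps in its canonical ordering, so the new cycle has the old
  orientation and is ternary. Since its itinerary separates its points, connected sets containing two
  points of the cycle or the branching point spread over the whole hull; as the linear map is affine on
  finitely many basic arcs, every open set eventually contains such a set, which is exactness.\<close>

section \<open>Coordinates on the triod\<close>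

text \<open>Branches are numbered by the type \<open>3\<close>, whose arithmetic is that of residues
  mod 3. The numbering \<open>u\<close> stays a parameter, because each cycle has its own canonical
  ordering. The main obstacle is orientation: \<open>rotation_number\<close> uses an ordering
  determined by the nearest points of the new cycle, and these are not under control. Only the
  itinerary is known, so its total drift must decide between the two orientations. Here the rotating
  tail matters: c \<le> n < m leaves at least one forward step, which makes the drift strictly
  positive. The inequality n < m is also the source of strictness for the interval map. Pulling the
  nearest point back along the itinerary gives a point \<open>z\<close> that is not moved towards 0.
  If \<open>z\<close> were the nearest point itself, the old cycle would follow the new itinerary,
  which would then have the period n < m. A strict inequality at one point is an open condition,
  whereas a periodic point need not survive a perturbation. Branch coordinates are absorbed at 0, so
  a positive fixed point of the composition automatically follows the itinerary.\<close>

definition frame :: "(3 \<Rightarrow> complex) \<Rightarrow> bool" where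
  "frame u \<longleftrightarrow> inj u \<and> (\<forall>j. u j ^ 3 = 1)"

definition pt :: "(3 \<Rightarrow> complex) \<Rightarrow> 3 \<Rightarrow> real \<Rightarrow> complex" where
  "pt u j r = of_real r * u j"

definition ray :: "(3 \<Rightarrow> complex) \<Rightarrow> 3 \<Rightarrow> complex set" where
  "ray u j = pt u j ` {0<..1}"

text \<open>On the triod, \<open>coord u j\<close> is the retraction onto the \<open>j\<close>-th branch that collapses the two
  other branches to the branching point: distinct cube roots of unity enclose an obtuse angle.\<close>

definition coord :: "(3 \<Rightarrow> complex) \<Rightarrow> 3 \<Rightarrow> complex \<Rightarrow> real" where
  "coord u j w = max 0 (Re (w * cnj (u j)))"

text \<open>Determined only for nonzero points of the triod; elsewhere the value is unspecified,
  which is why later statements exclude 0.\<close>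

definition idx :: "(3 \<Rightarrow> complex) \<Rightarrow> complex \<Rightarrow> 3" where
  "idx u x = (THE j. x \<in> ray u j)"

lemma UNIV_3': "(UNIV :: 3 set) = {0, 1, 2}"
proof -
  have "(3::3) = 0" by simp
  then show ?thesis using UNIV_3 by auto
qed

lemma cases_3:
  fixes i :: 3
  obtains "i = 0" | "i = 1" | "i = 2"
  using UNIV_3' UNIV_I[of i] by auto

lemma cube_root_norm:
  fixes a :: complex
  assumes "a ^ 3 = 1"
  shows "cmod a = 1"
proof -
  have "cmod a ^ 3 = 1 ^ 3" using assms by (metis norm_one norm_power power_one)
  then show ?thesis by (rule power_eq_imp_eq_base) auto
qed

text \<open>The number w = a * cnj b is a cube root of unity other than 1, so w^2 + w + 1 = 0. On
  the unit circle the real part of this equation becomes Re w * (2 * Re w + 1) = 0 and the imaginary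
  part is Im w * (2 * Re w + 1) = 0, where Re w and Im w do not both vanish.\<close>

lemma cube_root_inner:
  fixes a b :: complex
  assumes "a ^ 3 = 1" "b ^ 3 = 1" "a \<noteq> b"
  shows "Re (a * cnj b) = - 1 / 2"
proof -
  have na: "cmod a = 1" "cmod b = 1"
    using assms cube_root_norm by auto
  define w where "w = a * cnj b"
  have w3: "w ^ 3 = 1"
    by (simp add: w_def power_mult_distrib assms flip: complex_cnj_power)
  have bb: "b * cnj b = 1" using na by (simp add: complex_norm_square[symmetric])
  have "w \<noteq> 1"
  proof
    assume "w = 1"
    then have "a * (b * cnj b) = b" by (metis w_def mult.left_commute mult.commute mult.right_neutral)
    then show False using bb assms(3) by simp
  qed
  have "(w - 1) * (w\<^sup>2 + w + 1) = 0" using w3 by (simp add: power2_eq_square power3_eq_cube algebra_simps)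
  then have q: "w\<^sup>2 + w + 1 = 0" using \<open>w \<noteq> 1\<close> by simp
  have "cmod w = 1" by (simp add: w_def norm_mult na)
  then have n: "(Re w)\<^sup>2 + (Im w)\<^sup>2 = 1" by (simp add: cmod_def)
  have "Re (w\<^sup>2 + w + 1) = 0" using q by simp
  then have "(Re w)\<^sup>2 - (Im w)\<^sup>2 + Re w + 1 = 0" by (simp add: power2_eq_square)
  then have e: "2 * (Re w)\<^sup>2 + Re w = 0" using n by simp
  have "Im (w\<^sup>2 + w + 1) = 0" using q by simp
  then have im: "Im w * (2 * Re w + 1) = 0" by (simp add: power2_eq_square algebra_simps)
  have "Re w * (2 * Re w + 1) = 0" using e by (simp add: power2_eq_square algebra_simps)
  moreover have "Re w \<noteq> 0 \<or> Im w \<noteq> 0" using n by auto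
  ultimately have "2 * Re w + 1 = 0" using im by auto
  then show ?thesis by (simp add: w_def)
qed

context
  fixes u :: "3 \<Rightarrow> complex"
  assumes frame: "frame u"
begin

lemma frame_cube: "u j ^ 3 = 1"
  using frame by (simp add: frame_def)

lemma frame_norm [simp]: "cmod (u j) = 1"
  by (rule cube_root_norm) (rule frame_cube)

lemma frame_nonzero [simp]: "u j \<noteq> 0"
  using frame_norm[of j] by fastforce

lemma frame_self: "u j * cnj (u j) = 1"
  by (simp add: complex_norm_square[symmetric])

lemma coord_pt: 
  assumes "0 \<le> r" 
  shows "coord u j (pt u i r) = (if i = j then r else 0)"
proof (cases "i = j")
  case True
  then show ?thesis using assms by (simp add: coord_def pt_def mult.assoc frame_self)
next
  case False
  then have "u i \<noteq> u j" using frame by (auto simp: frame_def inj_def)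
  then have "Re (u i * cnj (u j)) = - 1 / 2" by (intro cube_root_inner frame_cube)
  then show ?thesis using False assms by (simp add: coord_def pt_def mult.assoc)
qed

lemma pt_0 [simp]: "pt u j 0 = 0" by (simp add: pt_def)

lemma norm_pt [simp]: "0 \<le> r \<Longrightarrow> cmod (pt u j r) = r" by (simp add: pt_def norm_mult)

lemma pt_eq_0_iff [simp]: "pt u j r = 0 \<longleftrightarrow> r = 0" by (simp add: pt_def)

lemma pt_in_triod [intro]: "0 \<le> r \<Longrightarrow> r \<le> 1 \<Longrightarrow> pt u j r \<in> triod"
  by (auto simp: triod_def pt_def power_mult_distrib frame_cube power_le_one intro!: image_eqI[of _ _ "r^3"])

lemma range_frame: "range u = {z. z ^ 3 = 1}"
proof (rule card_subset_eq)
  show "finite {z::complex. z ^ 3 = 1}" using finite_roots_unity[of 3] by simp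
  show "range u \<subseteq> {z. z ^ 3 = 1}" using frame_cube by auto
  have "card (range u) = 3" using frame by (simp add: frame_def card_image)
  moreover have "card {z::complex. z ^ 3 = 1} = 3" using card_roots_unity_eq[of 3] by simp
  ultimately show "card (range u) = card {z::complex. z ^ 3 = 1}" by (rule trans[OF _ sym])
qed

lemma triod_cases:
  assumes "x \<in> triod"
  obtains j r where "0 \<le> r" "r \<le> 1" "x = pt u j r"
proof -
  obtain s where s: "0 \<le> s" "s \<le> 1" "x ^ 3 = complex_of_real s"
    using assms by (auto simp: triod_def)
  show thesis
  proof (cases "x = 0")
    case True
    then show thesis using that[of 0 0] by simp
  next
    case False
    have "cmod x ^ 3 = s"
      using s by (metis abs_of_nonneg norm_of_real norm_power)
    then have "(x / cmod x) ^ 3 = 1"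
      using s(3) False by (simp add: power_divide) (metis of_real_power)
    then have "x / cmod x \<in> range u" using range_frame by simp
    then obtain j where "u j = x / cmod x" by (metis rangeE)
    then have "x = pt u j (cmod x)" using False by (simp add: pt_def)
    then show thesis using that triod_norm_le[OF assms] norm_ge_zero by metis
  qed
qed

lemma zero_in_triod: "0 \<in> triod" using pt_in_triod[of 0] by simp

lemma pt_eq_iff: "0 \<le> r \<Longrightarrow> 0 \<le> s \<Longrightarrow> pt u i r = pt u j s \<longleftrightarrow> r = s \<and> (r = 0 \<or> i = j)"
  by (metis coord_pt norm_pt pt_0)

lemma continuous_on_coord [continuous_intros]:
  "continuous_on S g \<Longrightarrow> continuous_on S (\<lambda>x. coord u j (g x))"
  unfolding coord_def by (intro continuous_intros)

lemma continuous_on_pt [continuous_intros]: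
  "continuous_on S g \<Longrightarrow> continuous_on S (\<lambda>x. pt u j (g x))"
  unfolding pt_def by (intro continuous_intros)

lemma ray_disjoint: "x \<in> ray u i \<Longrightarrow> x \<in> ray u j \<Longrightarrow> i = j"
  by (auto simp: ray_def pt_eq_iff)

lemma idx_ray: "x \<in> ray u j \<Longrightarrow> idx u x = j"
  unfolding idx_def by (rule the_equality) (auto dest: ray_disjoint)

lemma idx_pt [simp]: "0 < r \<Longrightarrow> r \<le> 1 \<Longrightarrow> idx u (pt u j r) = j"
  by (rule idx_ray) (auto simp: ray_def)

lemma ray_subset: "ray u j \<subseteq> triod - {0}"
  by (auto simp: ray_def)

lemma in_ray_idx: "x \<in> triod \<Longrightarrow> x \<noteq> 0 \<Longrightarrow> x \<in> ray u (idx u x)"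
  by (erule triod_cases) (auto simp: ray_def)

lemma pt_idx: "x \<in> triod \<Longrightarrow> x \<noteq> 0 \<Longrightarrow> pt u (idx u x) (cmod x) = x"
  by (erule triod_cases) auto

lemma mem_ray_iff: "x \<in> triod \<Longrightarrow> x \<noteq> 0 \<Longrightarrow> x \<in> ray u j \<longleftrightarrow> idx u x = j"
  using in_ray_idx idx_ray by blast

lemma coord_idx: "x \<in> triod \<Longrightarrow> x \<noteq> 0 \<Longrightarrow> coord u j x = (if idx u x = j then cmod x else 0)"
  using coord_pt[of "cmod x" j "idx u x"] pt_idx by simp

lemma coord_pos: 
  assumes "x \<in> triod" "0 < coord u j x" 
  shows "x = pt u j (coord u j x)" "x \<noteq> 0" "idx u x = j" "cmod x = coord u j x"
proof -
  obtain i r where r: "0 \<le> r" "r \<le> 1" "x = pt u i r" using triod_cases[OF assms(1)] .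
  then have "i = j" "0 < r" using assms(2) by (auto simp: coord_pt split: if_splits)
  then show "x = pt u j (coord u j x)" "x \<noteq> 0" "idx u x = j" "cmod x = coord u j x"
    using r by (auto simp: coord_pt)
qed

lemma coord_bounds: "x \<in> triod \<Longrightarrow> 0 \<le> coord u j x \<and> coord u j x \<le> 1"
  by (erule triod_cases) (auto simp: coord_pt)

lemma coord_0 [simp]: "coord u j 0 = 0" by (simp add: coord_def)

text \<open>The direction z / |z| is continuous away from 0 and takes only three values on the
  triod, so it is constant on a connected set.\<close>

lemma connected_in_ray:
  assumes C: "connected C" "C \<subseteq> triod - {0}" and x: "x \<in> C"
  shows "C \<subseteq> ray u (idx u x)"
proof
  define s where "s z = z / complex_of_real (cmod z)" for z
  have nz: "z \<in> triod" "z \<noteq> 0" if "z \<in> C" for z using C(2) that by auto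
  have "continuous_on C s"
    unfolding s_def by (rule continuous_on_divide) (auto intro!: continuous_intros dest: nz(2))
  then have conn: "connected (s ` C)"
    using C(1) connected_continuous_image by blast
  have sz: "s z = u (idx u z)" if z: "z \<in> C" for z
  proof -
    have "of_real (cmod z) * u (idx u z) = z" using pt_idx[OF nz[OF z]] by (simp add: pt_def)
    then have "s z = of_real (cmod z) * u (idx u z) / of_real (cmod z)" unfolding s_def by metis
    also have "\<dots> = u (idx u z)" using nz(2)[OF z] by simp
    finally show ?thesis .
  qed
  have "s ` C \<subseteq> range u" using sz by blast
  then have "finite (s ` C)" by (rule finite_subset) simp
  then obtain c where c: "s ` C \<subseteq> {c}"
    using conn connected_finite_iff_sing by (metis empty_subsetI subset_refl)
  fix z assume z: "z \<in> C"
  have "s z = s x" using c x z by blast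
  then have "u (idx u z) = u (idx u x)" using sz[OF z] sz[OF x] by metis
  then have "idx u z = idx u x" using frame unfolding frame_def by (blast dest: injD)
  then show "z \<in> ray u (idx u x)" using in_ray_idx[OF nz[OF z]] by metis
qed

lemma connected_ray: "connected (ray u j)"
  unfolding ray_def by (intro connected_continuous_image continuous_intros connected_Ioc)

lemma branches_eq: "branches = range (ray u)"
proof (intro equalityI subsetI)
  fix b assume "b \<in> branches"
  then have b: "b \<in> components (triod - {0})" by (simp add: branches_def)
  obtain x where x: "x \<in> b" using in_components_nonempty[OF b] by auto
  have sub: "b \<subseteq> ray u (idx u x)" 
    using connected_in_ray[OF in_components_connected[OF b] in_components_subset[OF b] x] .
  have "ray u (idx u x) \<subseteq> b" 
    by (rule components_maximal[OF b connected_ray ray_subset]) (use sub x in auto)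
  then show "b \<in> range (ray u)" using sub by auto
next
  fix b assume "b \<in> range (ray u)"
  then obtain j where j: "b = ray u j" by auto
  have ne: "pt u j 1 \<in> ray u j" by (auto simp: ray_def)
  obtain c where c: "c \<in> components (triod - {0})" "ray u j \<subseteq> c"
    using exists_component_superset[OF ray_subset _ connected_ray, of j] ne ray_subset[of j] by blast
  have "c \<subseteq> ray u (idx u (pt u j 1))"
    by (rule connected_in_ray[OF in_components_connected[OF c(1)] in_components_subset[OF c(1)]]) (use c(2) ne in auto)
  then show "b \<in> branches" using c j by (simp add: branches_def order_antisym)
qed

lemma same_branch_idx:
  assumes "x \<in> triod" "y \<in> triod"
  shows "same_branch x y \<longleftrightarrow> x \<noteq> 0 \<and> y \<noteq> 0 \<and> idx u x = idx u y"
proof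
  assume "same_branch x y"
  then obtain j where j: "x \<in> ray u j" "y \<in> ray u j" by (auto simp: same_branch_def branches_eq)
  then have "x \<noteq> 0" "y \<noteq> 0" using ray_subset[of j] by blast+
  then show "x \<noteq> 0 \<and> y \<noteq> 0 \<and> idx u x = idx u y" using idx_ray[OF j(1)] idx_ray[OF j(2)] by metis
next
  assume *: "x \<noteq> 0 \<and> y \<noteq> 0 \<and> idx u x = idx u y"
  then have "x \<in> ray u (idx u x)" "y \<in> ray u (idx u x)" 
    using in_ray_idx[OF assms(1)] in_ray_idx[OF assms(2)] by metis+
  then show "same_branch x y" unfolding same_branch_def branches_eq by blast
qed

text \<open>This replaces the case distinction in \<open>tdist\<close> by an expression that is
  visibly continuous, and it makes every branch coordinate 1-Lipschitz.\<close>

lemma tdist_coord: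
  assumes "x \<in> triod" "y \<in> triod"
  shows "tdist x y = (\<Sum>j\<in>UNIV. \<bar>coord u j x - coord u j y\<bar>)"
proof -
  have *: "(\<Sum>j\<in>UNIV. \<bar>(if i = j then r else 0) - (if k = j then s else 0)\<bar>) =
     (if i = k then \<bar>r - s\<bar> else \<bar>r\<bar> + \<bar>s\<bar>)" for i k :: 3 and r s :: real
    unfolding UNIV_3' by (cases i rule: cases_3; cases k rule: cases_3) auto
  obtain i r where r: "0 \<le> r" "r \<le> 1" "x = pt u i r" using triod_cases[OF assms(1)] .
  obtain k s where s: "0 \<le> s" "s \<le> 1" "y = pt u k s" using triod_cases[OF assms(2)] .
  have "same_branch x y \<longleftrightarrow> r \<noteq> 0 \<and> s \<noteq> 0 \<and> i = k"
    using same_branch_idx[OF assms] r s by (cases "r = 0"; cases "s = 0") auto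
  then show ?thesis using r s by (simp add: coord_pt * tdist_def)
qed

lemma coord_le_tdist: 
  assumes "x \<in> triod" "y \<in> triod"
  shows "\<bar>coord u j x - coord u j y\<bar> \<le> tdist x y"
  unfolding tdist_coord[OF assms] by (rule member_le_sum) auto

lemma connected_contains_0:
  assumes "connected S" "S \<subseteq> triod" "x \<in> S" "y \<in> S" "x \<noteq> 0" "y \<noteq> 0" "idx u x \<noteq> idx u y"
  shows "0 \<in> S"
proof (rule ccontr)
  assume "0 \<notin> S"
  then have "S \<subseteq> ray u (idx u x)" using connected_in_ray[OF assms(1)] assms by blast
  then show False using assms idx_ray by (metis subsetD)
qed

lemma connected_contains_between:
  assumes "connected S" "S \<subseteq> triod" "pt u j r \<in> S" "pt u j t \<in> S" "0 \<le> r" "r \<le> s" "s \<le> t"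
  shows "pt u j s \<in> S"
proof -
  have "connected (coord u j ` S)" by (intro connected_continuous_image continuous_intros assms)
  moreover have "r \<in> coord u j ` S" "t \<in> coord u j ` S" 
    using assms coord_pt[of r j j] coord_pt[of t j j] by (auto simp: image_iff intro: bexI[rotated])
  ultimately have "s \<in> coord u j ` S" using assms(6,7) by (metis connected_contains_Icc atLeastAtMost_iff subsetD)
  then obtain x where x: "x \<in> S" "s = coord u j x" by auto
  show ?thesis
  proof (cases "s = 0")
    case True
    then show ?thesis using assms by simp
  next
    case False
    then have "x = pt u j s" using coord_pos[of x j] x assms by auto
    then show ?thesis using x by simp
  qed
qed

end

section \<open>Regular maps\<close>

lemma triod_mapsD:
  assumes "f \<in> triod_maps"
  shows "x \<in> triod \<Longrightarrow> f x \<in> triod" "continuous_on triod f" "f 0 = 0"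
    "x \<in> triod \<Longrightarrow> f x = x \<Longrightarrow> x = 0"
  using assms by (auto simp: triod_maps_def)

lemma frame_exists: "\<exists>u. frame u"
proof -
  have "card {z::complex. z ^ 3 = 1} = 3" using card_roots_unity_eq[of 3] by simp
  moreover have "finite {z::complex. z ^ 3 = 1}" using finite_roots_unity[of 3] by simp
  moreover have "card (UNIV :: 3 set) = 3" by simp
  ultimately obtain u :: "3 \<Rightarrow> complex" where "bij_betw u UNIV {z. z ^ 3 = 1}"
    using finite_same_card_bij[of "UNIV :: 3 set" "{z::complex. z ^ 3 = 1}"] by auto
  then have "inj u" "range u = {z. z ^ 3 = 1}" by (auto simp: bij_betw_def)
  then have "frame u" unfolding frame_def by blast
  then show ?thesis by blast
qed

text \<open>The difference h x - x is nonnegative at r and nonpositive at 1. That the fixed point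
  lies above r matters: for r > 0 it is not the branching point.\<close>

lemma fixed_point_above:
  fixes h :: "real \<Rightarrow> real"
  assumes "continuous_on {0..1} h" "\<And>r. 0 \<le> r \<Longrightarrow> r \<le> 1 \<Longrightarrow> h r \<le> 1" 
    "0 \<le> r" "r \<le> 1" "r \<le> h r"
  obtains q where "r \<le> q" "q \<le> 1" "h q = q"
proof -
  have "\<exists>x\<ge>r. x \<le> 1 \<and> h x - x = 0"
  proof (rule IVT2')
    show "continuous_on {r..1} (\<lambda>x. h x - x)"
      by (intro continuous_intros continuous_on_subset[OF assms(1)]) (use assms in auto)
  qed (use assms in auto)
  then show thesis using that by force
qed

text \<open>The action of \<open>f\<close> from branch i to branch j, with images off branch j
  collapsed to 0. A positive value thus certifies that the image lies on branch j.\<close>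

definition lift :: "(3 \<Rightarrow> complex) \<Rightarrow> (complex \<Rightarrow> complex) \<Rightarrow> 3 \<Rightarrow> 3 \<Rightarrow> real \<Rightarrow> real" where
  "lift u f i j r = coord u j (f (pt u i r))"

context
  fixes u :: "3 \<Rightarrow> complex" and f :: "complex \<Rightarrow> complex"
  assumes frame: "frame u" and f: "f \<in> triod_maps"
begin

lemma lift_continuous: "continuous_on {0..1} (lift u f i j)"
  unfolding lift_def
  by (intro continuous_intros continuous_on_coord[OF frame] continuous_on_pt[OF frame]
      continuous_on_compose2[OF triod_mapsD(2)[OF f]]) (auto simp: pt_in_triod[OF frame])

lemma lift_0: "lift u f i j 0 = 0"
  by (simp add: lift_def pt_0[OF frame] triod_mapsD(3)[OF f] coord_0[OF frame])

lemma lift_bounds: "0 \<le> r \<Longrightarrow> r \<le> 1 \<Longrightarrow> 0 \<le> lift u f i j r \<and> lift u f i j r \<le> 1"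
  unfolding lift_def by (intro coord_bounds[OF frame] triod_mapsD(1)[OF f] pt_in_triod[OF frame])

lemma lift_pos:
  assumes "0 \<le> r" "r \<le> 1" "0 < lift u f i j r"
  shows "f (pt u i r) = pt u j (lift u f i j r)" "0 < r"
proof -
  show "f (pt u i r) = pt u j (lift u f i j r)"
    using coord_pos(1)[OF frame triod_mapsD(1)[OF f pt_in_triod[OF frame]]] assms
    unfolding lift_def by blast
  show "0 < r" using assms lift_0 by (cases "r = 0") auto
qed

lemma lift_idx:
  assumes "x \<in> triod" "x \<noteq> 0" "f x \<noteq> 0"
  shows "lift u f (idx u x) (idx u (f x)) (cmod x) = cmod (f x)"
  using assms by (simp add: lift_def pt_idx[OF frame] coord_idx[OF frame] triod_mapsD(1)[OF f])

end

text \<open>The pattern of {x, f x} forces itself, and it is primitive of period 2.\<close>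

lemma two_cycle_not_regular:
  assumes frame: "frame u" and f: "f \<in> triod_maps"
    and x: "x \<in> triod" "x \<noteq> 0" "f (f x) = x" "idx u (f x) \<noteq> idx u x"
  shows "f \<notin> regular_maps"
proof
  assume reg: "f \<in> regular_maps"
  define P where "P = {x, f x}"
  have fx: "f x \<in> triod" using triod_mapsD(1)[OF f] x by blast
  have fx0: "f x \<noteq> 0" using x triod_mapsD(3)[OF f] by metis
  have ne: "f x \<noteq> x" using x by metis
  have pow: "(f ^^ n) x \<in> {x, f x}" for n by (induction n) (use x(3) in auto)
  have orb: "orbit f x = {x, f x}"
  proof
    show "orbit f x \<subseteq> {x, f x}" using pow by (auto simp: orbit_altdef)
    show "{x, f x} \<subseteq> orbit f x" using orbit.base[of f x] orbit.step[of "f x" f x] x(3) by auto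
  qed
  have cyc: "cycle f P"
    unfolding cycle_def cyclic_on_def
  proof (intro conjI bexI[of _ x])
    show "P = orbit f x" unfolding orb P_def ..
  qed (use x fx fx0 in \<open>auto simp: P_def\<close>)
  have "regular_pattern (pattern_of f P)" using reg cyc by (auto simp: regular_maps_def regular_cycle_def)
  moreover have mc: "(f, P) \<in> marked_cycles" using f cyc by (simp add: marked_cycles_def)
  have "pattern_of f P \<in> patterns" unfolding pattern_of_def patterns_def by (rule quotientI[OF mc])
  moreover have "forces (pattern_of f P) (pattern_of f P)" by (simp add: forces_def)
  moreover have "primitive (pattern_of f P) \<and> has_period (pattern_of f P) 2"
  proof -
    have "(\<forall>v\<in>Q. \<forall>w\<in>Q. same_branch v w \<longrightarrow> v = w) \<and> card Q = 2" if gQ: "(g, Q) \<in> pattern_of f P" for g Q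
    proof -
      obtain h k where h: "homeomorphism (thull P) (thull Q) h k"
        and br: "\<And>b. b\<in>branches \<Longrightarrow> h ` (thull P \<inter> b) = thull Q \<inter> b" and hP: "h ` P = Q"
      proof -
        have "((f, P), (g, Q)) \<in> cycle_equiv" using gQ by (simp add: pattern_of_def)
        then show thesis using that unfolding cycle_equiv_def by blast
      qed
      have inj: "inj_on h (thull P)" by (rule inj_on_inverseI[of _ k]) (rule homeomorphism_apply1[OF h])
      \<comment> \<open>Primitivity concerns every representative of the pattern, so it is
        transported back along \<open>h\<close>: being injective on the hull and mapping its part in
        each branch onto the part of the other hull in that branch, \<open>h\<close> also reflects
        membership in branches.\<close>
      have pullb: "z \<in> b" if "b \<in> branches" "z \<in> P" "h z \<in> b" for z b
      proof -
        have z: "z \<in> thull P" using subset_thull that by blast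
        have "h z \<in> thull Q" using homeomorphism_image1[OF h] z by blast
        then have "h z \<in> h ` (thull P \<inter> b)" using br[OF that(1)] that(3) by blast
        then obtain y where y: "y \<in> thull P" "y \<in> b" "h z = h y" by blast
        then have "z = y" using inj_onD[OF inj] z by blast
        then show ?thesis using y by simp
      qed
      have "v = w" if vw: "v \<in> Q" "w \<in> Q" "same_branch v w" for v w
      proof -
        obtain b where b: "b \<in> branches" "v \<in> b" "w \<in> b" using vw unfolding same_branch_def by blast
        obtain v' w' where v': "v' \<in> P" "w' \<in> P" "v = h v'" "w = h w'" using vw hP by blast
        then have "v' \<in> b" "w' \<in> b" using pullb b by simp_all
        then have "same_branch v' w'" unfolding same_branch_def using b by blast
        moreover have "v' \<in> triod" "w' \<in> triod" using v' x fx by (auto simp: P_def)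
        ultimately have "idx u v' = idx u w'" using same_branch_idx[OF frame] by blast
        then have "v' = w'" using v'(1,2) x(4) unfolding P_def by (metis insertE singletonD)
        then show ?thesis using v' by simp
      qed
      moreover have "card Q = card P"
        using hP inj subset_thull by (metis card_image inj_on_subset)
      ultimately show ?thesis using ne by (simp add: P_def)
    qed
    then show ?thesis unfolding primitive_def has_period_def by blast
  qed
  ultimately show False unfolding regular_pattern_def by blast
qed

section \<open>Consequences of regularity for branch coordinates\<close>

context
  fixes u :: "3 \<Rightarrow> complex" and f :: "complex \<Rightarrow> complex"
  assumes frame: "frame u" and reg: "f \<in> regular_maps"
begin

lemma reg_triod_map: "f \<in> triod_maps" using reg by (simp add: regular_maps_def)

text \<open>Otherwise \<open>fixed_point_above\<close> yields a fixed point of \<open>f\<close> on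
  branch i, besides the branching point.\<close>

lemma lift_less_self:
  assumes "0 < r" "r \<le> 1"
  shows "lift u f i i r < r"
proof (rule ccontr)
  assume "\<not> ?thesis"
  then have le: "r \<le> lift u f i i r" by simp
  obtain q where q: "r \<le> q" "q \<le> 1" "lift u f i i q = q"
    by (rule fixed_point_above[OF lift_continuous[OF frame reg_triod_map, of i i], where r = r])
      (use le assms lift_bounds[OF frame reg_triod_map] in auto)
  then have "f (pt u i q) = pt u i q" using lift_pos(1)[OF frame reg_triod_map, of q i i] assms by auto
  then have "pt u i q = 0" 
    by (rule triod_mapsD(4)[OF reg_triod_map, rotated]) (use q assms in \<open>intro pt_in_triod[OF frame]; simp\<close>)
  then show False using pt_eq_0_iff[OF frame] q assms by simp
qed

text \<open>For i = j the bound for one step is used twice. For different branches a violation gives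
  a positive fixed point of the composed lifts, which is a point of period 2 alternating between two
  branches.\<close>

lemma lift_lift_less_self:
  assumes "0 < r" "r \<le> 1"
  shows "lift u f j i (lift u f i j r) < r"
proof (cases "i = j")
  case True
  have b: "0 \<le> lift u f i i r" "lift u f i i r \<le> 1"
    using lift_bounds[OF frame reg_triod_map] assms by simp_all
  show ?thesis
  proof (cases "lift u f i i r = 0")
    case True
    then show ?thesis using \<open>i = j\<close> lift_0[OF frame reg_triod_map] assms by simp
  next
    case False
    then have "lift u f i i (lift u f i i r) < lift u f i i r" using b by (intro lift_less_self) auto
    also have "\<dots> < r" using assms by (intro lift_less_self)
    finally show ?thesis using True by simp
  qed
next
  case ne: False
  show ?thesis
  proof (rule ccontr)
    assume "\<not> ?thesis"
    then have le: "r \<le> lift u f j i (lift u f i j r)" by simp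
    define H where "H r = lift u f j i (lift u f i j r)" for r
    have im: "lift u f i j ` {0..1} \<subseteq> {0..1}"
      using lift_bounds[OF frame reg_triod_map] by auto
    have "continuous_on {0..1} H"
      unfolding H_def
      using continuous_on_compose2[OF lift_continuous[OF frame reg_triod_map] lift_continuous[OF frame reg_triod_map] im] .
    moreover have "H r \<le> 1" if "0 \<le> r" "r \<le> 1" for r
      unfolding H_def using that im lift_bounds[OF frame reg_triod_map] by (meson image_subset_iff atLeastAtMost_iff)
    moreover have "r \<le> H r" using le by (simp add: H_def)
    ultimately obtain q where "r \<le> q" "q \<le> 1" "H q = q"
      using fixed_point_above[of H r] assms by (metis less_imp_le)
    then have q: "r \<le> q" "q \<le> 1" "lift u f j i (lift u f i j q) = q" by (simp_all add: H_def)
    define s where "s = lift u f i j q"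
    have qp: "0 < q" using q assms by simp
    have s: "0 \<le> s" "s \<le> 1" using lift_bounds[OF frame reg_triod_map, of q i j] q qp by (simp_all add: s_def)
    have ss: "lift u f j i s = q" using q by (simp add: s_def)
    have sp: "0 < s" using lift_pos(2)[OF frame reg_triod_map s, of j i] ss qp by simp
    have 1: "f (pt u i q) = pt u j s" using lift_pos(1)[OF frame reg_triod_map, of q i j] qp q sp by (simp add: s_def)
    have 2: "f (pt u j s) = pt u i q" using lift_pos(1)[OF frame reg_triod_map s, of j i] qp ss by simp
    have x: "pt u i q \<in> triod" "pt u i q \<noteq> 0"
      using qp q by (auto simp: pt_eq_0_iff[OF frame] intro!: pt_in_triod[OF frame])
    have "f (f (pt u i q)) = pt u i q" unfolding 1 2 ..
    moreover have "idx u (f (pt u i q)) \<noteq> idx u (pt u i q)"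
      unfolding 1 using idx_pt[OF frame sp s(2), of j] idx_pt[OF frame qp q(2), of i] ne by metis
    ultimately have "f \<notin> regular_maps"
      using two_cycle_not_regular[OF frame reg_triod_map x] by metis
    then show False using reg by simp
  qed
qed

lemma lift_hits:
  assumes "0 \<le> a" "a \<le> 1" "0 < y" "y \<le> lift u f i j a"
  obtains z where "0 < z" "z \<le> a" "lift u f i j z = y"
proof -
  have "\<exists>x\<ge>0. x \<le> a \<and> lift u f i j x = y"
  proof (rule IVT')
    show "continuous_on {0..a} (lift u f i j)"
      by (rule continuous_on_subset[OF lift_continuous[OF frame reg_triod_map]]) (use assms in auto)
  qed (use assms lift_0[OF frame reg_triod_map, of i j] in auto)
  then obtain z where z: "0 \<le> z" "z \<le> a" "lift u f i j z = y" by auto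
  have "z \<noteq> 0"
  proof
    assume "z = 0"
    then have "y = 0" using z(3) lift_0[OF frame reg_triod_map, of i j] by simp
    then show False using assms by simp
  qed
  then show thesis using that[of z] z by simp
qed

text \<open>A point \<open>z\<close> between \<open>0\<close> and \<open>x\<close> is mapped to \<open>y\<close>, so that \<open>f y\<close> is its second image.\<close>

lemma return_closer:
  assumes x: "x \<in> triod" "x \<noteq> 0" and y: "y \<in> triod" "y \<noteq> 0"
    and fx: "f x \<noteq> 0" "idx u (f x) = idx u y" "cmod y \<le> cmod (f x)"
    and fy: "f y \<noteq> 0" "idx u (f y) = idx u x"
  shows "cmod (f y) < cmod x"
proof -
  have "lift u f (idx u x) (idx u y) (cmod x) = cmod (f x)"
    using lift_idx[OF frame reg_triod_map x fx(1)] fx by simp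
  then have le: "cmod y \<le> lift u f (idx u x) (idx u y) (cmod x)" using fx(3) by simp
  have xb: "0 \<le> cmod x" "cmod x \<le> 1" "0 < cmod y" using triod_norm_le x y by auto
  obtain z where z: "0 < z" "z \<le> cmod x" "lift u f (idx u x) (idx u y) z = cmod y"
    by (rule lift_hits[OF xb le])
  have "lift u f (idx u y) (idx u x) (cmod y) = cmod (f y)"
    using lift_idx[OF frame reg_triod_map y fy(1)] fy by simp
  then have "cmod (f y) < z" using lift_lift_less_self[of z "idx u y" "idx u x"] z xb by auto
  then show ?thesis using z by simp
qed

lemma same_branch_closer:
  assumes "x \<in> triod" "x \<noteq> 0" "f x \<noteq> 0" "idx u (f x) = idx u x"
  shows "cmod (f x) < cmod x"
  using lift_less_self[of "cmod x" "idx u x"] lift_idx[OF frame reg_triod_map assms(1-3)] 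
    assms triod_norm_le[of x] by simp

end

section \<open>Cyclic orbits\<close>

lemma funpow_eq_mod:
  assumes "(f ^^ m) x = x"
  shows "(f ^^ t) x = (f ^^ (t mod m)) x"
proof -
  have "(f ^^ (m * k)) x = x" for k
    by (induction k) (simp_all add: funpow_add assms)
  moreover have "(f ^^ t) x = (f ^^ (t mod m)) ((f ^^ (m * (t div m))) x)"
    by (metis add.commute comp_apply funpow_add mult_div_mod_eq)
  ultimately show ?thesis by simp
qed

lemma cyclic_onI_funpow:
  assumes "0 < m" "(f ^^ m) x = x" "\<And>a. 0 < a \<Longrightarrow> a < m \<Longrightarrow> (f ^^ a) x \<noteq> x"
  shows "cyclic_on f ((\<lambda>t. (f ^^ t) x) ` {..<m})" "inj_on (\<lambda>t. (f ^^ t) x) {..<m}"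
proof -
  have orb: "orbit f x = (\<lambda>t. (f ^^ t) x) ` {..<m}"
  proof
    show "orbit f x \<subseteq> (\<lambda>t. (f ^^ t) x) ` {..<m}"
    proof
      fix y assume "y \<in> orbit f x"
      then obtain t where "y = (f ^^ t) x" by (auto simp: orbit_altdef)
      then have "y = (f ^^ (t mod m)) x" using funpow_eq_mod[OF assms(2), of t] by simp
      then show "y \<in> (\<lambda>t. (f ^^ t) x) ` {..<m}" using assms(1) by simp
    qed
    show "(\<lambda>t. (f ^^ t) x) ` {..<m} \<subseteq> orbit f x"
    proof safe
      fix t
      have "(f ^^ t) x = (f ^^ (t + m)) x" by (simp add: funpow_add assms(2))
      then show "(f ^^ t) x \<in> orbit f x" using assms(1) unfolding orbit_altdef by fastforce
    qed
  qed
  show "cyclic_on f ((\<lambda>t. (f ^^ t) x) ` {..<m})"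
    unfolding cyclic_on_def
  proof (rule bexI[of _ x])
    have "(f ^^ 0) x \<in> (\<lambda>t. (f ^^ t) x) ` {..<m}" using assms(1) by blast
    then show "x \<in> (\<lambda>t. (f ^^ t) x) ` {..<m}" by simp
  qed (simp add: orb)
  \<comment> \<open>If the points at times s < t agreed, advancing both by m - t steps would bring x
    back already at time m - t + s < m.\<close>
  have neq: "(f ^^ s) x \<noteq> (f ^^ t) x" if "s < t" "t < m" for s t
  proof
    assume eq: "(f ^^ s) x = (f ^^ t) x"
    have "(f ^^ (m - t + s)) x = (f ^^ (m - t)) ((f ^^ s) x)" by (simp add: funpow_add)
    also have "\<dots> = (f ^^ (m - t + t)) x" unfolding eq by (simp add: funpow_add)
    also have "\<dots> = x" using that assms(2) by simp
    finally have "(f ^^ (m - t + s)) x = x" .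
    moreover have "0 < m - t + s" "m - t + s < m" using that by linarith+
    ultimately show False by (rule notE[OF assms(3), rotated 2])
  qed
  show "inj_on (\<lambda>t. (f ^^ t) x) {..<m}"
    by (rule linorder_inj_onI') (simp add: neq)
qed

lemma cyclic_on_period:
  assumes "cyclic_on f S" "x \<in> S"
  shows "0 < card S" "(f ^^ card S) x = x" "bij_betw (\<lambda>t. (f ^^ t) x) {..<card S} S"
    "\<And>a. 0 < a \<Longrightarrow> a < card S \<Longrightarrow> (f ^^ a) x \<noteq> x"
proof -
  have orb: "orbit f x = S" using orbit_cyclic_eq3 assms by metis
  define m where "m = funpow_dist1 f x x"
  have m: "0 < m" "(f ^^ m) x = x" "\<And>a. 0 < a \<Longrightarrow> a < m \<Longrightarrow> (f ^^ a) x \<noteq> x"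
    using funpow_dist1_prop[of x f x] orb assms(2) funpow_dist1_least[of _ f x x] by (auto simp: m_def simp del: funpow.simps)
  have S: "S = (\<lambda>t. (f ^^ t) x) ` {..<m}"
    using orbit_conv_funpow_dist1[of x f] orb assms(2) by (simp add: m_def atLeast0LessThan del: funpow.simps)
  have inj: "inj_on (\<lambda>t. (f ^^ t) x) {..<m}" by (rule cyclic_onI_funpow(2)[OF m])
  have "card S = m" unfolding S using card_image[OF inj] by simp
  then show "0 < card S" "(f ^^ card S) x = x" "\<And>a. 0 < a \<Longrightarrow> a < card S \<Longrightarrow> (f ^^ a) x \<noteq> x" 
    using m by simp_all
  show "bij_betw (\<lambda>t. (f ^^ t) x) {..<card S} S"
    unfolding bij_betw_def using inj \<open>card S = m\<close> S by simp
qed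

section \<open>Oriented cycles\<close>

lemma neq_add_1_3: "(i::3) \<noteq> i + 1"
  by simp

definition turn :: "(3 \<Rightarrow> complex) \<Rightarrow> (complex \<Rightarrow> complex) \<Rightarrow> complex \<Rightarrow> 3" where
  "turn u f x = idx u (f x) - idx u x"

text \<open>The representative of least absolute value of a residue mod 3. Applied to a turn it
  measures signed drift around the branching point; applied to a turn minus 1 it measures the
  deviation from rotation by one branch.\<close>

definition exc :: "3 \<Rightarrow> int" where
  "exc j = (if j = 0 then 0 else if j = 1 then 1 else - 1)"

locale regular_orbit =
  fixes u :: "3 \<Rightarrow> complex" and f :: "complex \<Rightarrow> complex" and P :: "complex set"
  assumes frame: "frame u" and reg: "f \<in> regular_maps" and cyc: "cycle f P"
begin

lemma cyclic: "cyclic_on f P" using cyc by (simp add: cycle_def)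

lemma finite_P: "finite P" using finite_cyclic_on[OF cyclic] .

lemma memD: 
  assumes "x \<in> P" 
  shows "x \<in> triod" "x \<noteq> 0" "f x \<in> P" "f x \<noteq> 0"
proof -
  have P: "P \<subseteq> triod - {0}" using cyc by (simp add: cycle_def)
  show "f x \<in> P" using cyclic_on_inI[OF cyclic assms] .
  then show "x \<in> triod" "x \<noteq> 0" "f x \<noteq> 0" using P assms by auto
qed

lemma funpow_mem: "x \<in> P \<Longrightarrow> (f ^^ t) x \<in> P"
  using cyclic_on_funpow_in[OF cyclic] .

lemma eqI: "x \<in> P \<Longrightarrow> y \<in> P \<Longrightarrow> idx u x = idx u y \<Longrightarrow> cmod x = cmod y \<Longrightarrow> x = y"
  using pt_idx[OF frame, of x] pt_idx[OF frame, of y] memD[of x] memD[of y] by metis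

lemma nearest_exists:
  assumes "x \<in> P"
  shows "\<exists>p\<in>P. idx u p = idx u x \<and> (\<forall>q\<in>P. idx u q = idx u x \<longrightarrow> cmod p \<le> cmod q)"
proof -
  have "finite {q \<in> P. idx u q = idx u x}" "{q \<in> P. idx u q = idx u x} \<noteq> {}"
    using finite_P assms by auto
  from ex_min_if_finite[OF finite_imageI[OF this(1), of cmod]] this(2)
  obtain r where "r \<in> cmod ` {q \<in> P. idx u q = idx u x}" "\<not> (\<exists>y\<in>cmod ` {q \<in> P. idx u q = idx u x}. y < r)"
    by blast
  then show ?thesis by force
qed

text \<open>Start at a nearest point p, pass to the nearest point q on the branch of f p, and then
  to the nearest point r on the branch of f q. A nearest point cannot be mapped into its own branch,
  and two nearest points cannot exchange their branches, since either way an image would lie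
  strictly nearer. So p, q and r occupy all three branches and f r has only the branch of p left.
  That the cycle meets every branch is part of the outcome.\<close>

lemma orientation_exists:
  "\<exists>s :: 3 \<Rightarrow> 3. bij s \<and> (\<forall>j. \<exists>p\<in>P. idx u p = s j \<and> (\<forall>q\<in>P. idx u q = s j \<longrightarrow> cmod p \<le> cmod q) \<and> idx u (f p) = s (j + 1))"
proof -
  obtain x where x: "x \<in> P" using cyclic by (auto simp: cyclic_on_def)
  obtain p where p: "p \<in> P" "idx u p = idx u x" "\<forall>q\<in>P. idx u q = idx u p \<longrightarrow> cmod p \<le> cmod q"
    using nearest_exists[OF x] by auto
  obtain q where q: "q \<in> P" "idx u q = idx u (f p)" "\<forall>v\<in>P. idx u v = idx u q \<longrightarrow> cmod q \<le> cmod v"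
    using nearest_exists[OF memD(3)[OF p(1)]] by auto
  obtain r where r: "r \<in> P" "idx u r = idx u (f q)" "\<forall>v\<in>P. idx u v = idx u r \<longrightarrow> cmod r \<le> cmod v"
    using nearest_exists[OF memD(3)[OF q(1)]] by auto
  have no_fix: "idx u (f z) \<noteq> idx u z" if "z \<in> P" "\<forall>v\<in>P. idx u v = idx u z \<longrightarrow> cmod z \<le> cmod v" for z
    using same_branch_closer[OF frame reg memD(1,2,4)[OF that(1)]] that(2) memD(3)[OF that(1)] by fastforce
  have no_swap: "idx u (f w) \<noteq> idx u z" 
    if z: "z \<in> P" "\<forall>v\<in>P. idx u v = idx u z \<longrightarrow> cmod z \<le> cmod v" 
      and w: "w \<in> P" "\<forall>v\<in>P. idx u v = idx u w \<longrightarrow> cmod w \<le> cmod v" "idx u (f z) = idx u w" for z w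
  proof
    assume eq: "idx u (f w) = idx u z"
    have "cmod (f w) < cmod z"
      by (rule return_closer[OF frame reg memD(1,2)[OF z(1)] memD(1,2)[OF w(1)] memD(4)[OF z(1)] w(3) _ memD(4)[OF w(1)] eq])
        (use w memD(3)[OF z(1)] in auto)
    then show False using z(2) memD(3)[OF w(1)] eq by force
  qed
  have 1: "idx u p \<noteq> idx u q" using no_fix[OF p(1,3)] q(2) by metis
  have 2: "idx u q \<noteq> idx u r" using no_fix[OF q(1,3)] r(2) by metis
  have 3: "idx u r \<noteq> idx u p" using no_swap[OF p(1,3) q(1,3) q(2)[symmetric]] r(2) by metis
  have 4: "idx u (f r) \<noteq> idx u r" by (rule no_fix[OF r(1,3)])
  have 5: "idx u (f r) \<noteq> idx u q" by (rule no_swap[OF q(1,3) r(1,3) r(2)[symmetric]])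
  have card3: "card {idx u p, idx u q, idx u r} = CARD(3)" using 1 2 3 by simp
  then have all: "{idx u p, idx u q, idx u r} = UNIV" by (intro card_subset_eq) auto
  have 6: "idx u (f r) = idx u p" using all 4 5 by blast
  define s :: "3 \<Rightarrow> 3" where "s j = (if j = 0 then idx u p else if j = 1 then idx u q else idx u r)" for j
  have s: "s 0 = idx u p" "s 1 = idx u q" "s 2 = idx u r" by (simp_all add: s_def)
  have "range s = UNIV" unfolding UNIV_3' using s all by (auto simp: UNIV_3')
  then have bij: "bij s" by (simp add: bij_def finite_UNIV_surj_inj)
  have ex: "\<exists>p\<in>P. idx u p = s j \<and> (\<forall>q\<in>P. idx u q = s j \<longrightarrow> cmod p \<le> cmod q) \<and> idx u (f p) = s (j + 1)" for j
  proof (cases j rule: cases_3)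
    case 1
    then have e: "s j = idx u p" "s (j + 1) = idx u q" using s by simp_all
    show ?thesis unfolding e using p q(2) by (intro bexI[of _ p]) simp_all
  next
    case 2
    then have e: "s j = idx u q" "s (j + 1) = idx u r" using s by simp_all
    show ?thesis unfolding e using q r(2) by (intro bexI[of _ q]) simp_all
  next
    case 3
    then have j1: "j + 1 = 0" by simp
    have e: "s j = idx u r" "s (j + 1) = idx u p" unfolding j1 using 3 s by simp_all
    show ?thesis unfolding e using r 6 by (intro bexI[of _ r]) simp_all
  qed
  show ?thesis by (intro exI[of _ s] conjI allI bij ex)
qed

end

text \<open>The frame is numbered so that the nearest points \<open>p j\<close> rotate in increasing
  order. By \<open>oriented_cycle_exists\<close> every cycle of a regular map admits such a
  frame.\<close>

locale oriented_cycle = regular_orbit +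
  fixes p :: "3 \<Rightarrow> complex"
  assumes p_mem: "p j \<in> P" and p_idx: "idx u (p j) = j"
    and p_nearest: "q \<in> P \<Longrightarrow> idx u q = j \<Longrightarrow> cmod (p j) \<le> cmod q"
    and p_image: "idx u (f (p j)) = j + 1"
begin

abbreviation rot :: "complex \<Rightarrow> 3" where "rot \<equiv> turn u f"

abbreviation drift :: "complex \<Rightarrow> int" where "drift x \<equiv> exc (rot x)"

section \<open>Levels of the points of an oriented cycle\<close>

lemma rot_p: "rot (p j) = 1" by (simp add: turn_def p_idx p_image)

text \<open>A point enters at stage s + 1 if it lies between the branching point and the image of a
  forward turning point of stage s. The first stage containing a point, its level
  \<open>lev\<close>, bounds from below how much forward drift is needed to reach it from a nearest
  point.\<close>

primrec W :: "nat \<Rightarrow> complex set" where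
  "W 0 = range p"
| "W (Suc s) = {x \<in> P. \<exists>y\<in>W s. rot y = 1 \<and> idx u x = idx u (f y) \<and> cmod x \<le> cmod (f y)}"

lemma W_subset: "W s \<subseteq> P" by (cases s) (auto simp: p_mem)

text \<open>Nearest points turn forward, so \<open>p j\<close> is dominated by the image of
  \<open>p (j - 1)\<close>. The further inclusions follow because the recursion is monotone.\<close>

lemma W_Suc: "W s \<subseteq> W (Suc s)"
proof (induction s)
  case 0
  have "p j \<in> W (Suc 0)" for j
  proof -
    have "idx u (p j) = idx u (f (p (j - 1)))" by (simp add: p_image p_idx)
    then show ?thesis using p_mem p_nearest[OF memD(3)[OF p_mem], of "j - 1" j] rot_p p_idx by auto
  qed
  then show ?case by auto
next
  case (Suc s)
  then show ?case by auto
qed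

lemma W_down: "y \<in> W s \<Longrightarrow> x \<in> P \<Longrightarrow> idx u x = idx u y \<Longrightarrow> cmod x \<le> cmod y \<Longrightarrow> x \<in> W s"
proof (cases s)
  case 0
  assume a: "y \<in> W s" "x \<in> P" "idx u x = idx u y" "cmod x \<le> cmod y"
  then obtain j where j: "y = p j" using 0 by auto
  then have "cmod (p j) \<le> cmod x" using p_nearest[OF a(2)] a p_idx by simp
  then have "x = y" using eqI[OF a(2) p_mem[of j]] a j by simp
  then show ?thesis using a by simp
next
  case (Suc t)
  assume "y \<in> W s" "x \<in> P" "idx u x = idx u y" "cmod x \<le> cmod y"
  then show ?thesis using Suc by force
qed

text \<open>Backward rotation loses ground: if \<open>y\<close> rotates forward to \<open>x\<close> or beyond and \<open>x\<close> rotates backward,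
  then \<open>f x\<close> lies on the branch of \<open>y\<close>, inside \<open>y\<close>.\<close>

lemma W_image:
  assumes "x \<in> W s"
  shows "rot x = 1 \<Longrightarrow> f x \<in> W (Suc s)" "rot x = 0 \<Longrightarrow> f x \<in> W s" 
    "rot x = 2 \<Longrightarrow> \<exists>t. s = Suc t \<and> f x \<in> W t"
proof -
  have x: "x \<in> P" using assms W_subset by auto
  show "f x \<in> W (Suc s)" if "rot x = 1" using that assms memD(3)[OF x] by auto
  show "f x \<in> W s" if "rot x = 0"
  proof -
    have eq: "idx u (f x) = idx u x" using that by (simp add: turn_def)
    then have "cmod (f x) < cmod x" using same_branch_closer[OF frame reg memD(1,2,4)[OF x]] by simp
    then show ?thesis using W_down[OF assms memD(3)[OF x] eq] by simp
  qed
  show "\<exists>t. s = Suc t \<and> f x \<in> W t" if r: "rot x = 2"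
  proof (cases s)
    case 0
    then obtain j where "x = p j" using assms by auto
    then show ?thesis using rot_p[of j] r by simp
  next
    case (Suc t)
    then obtain y where y: "y \<in> W t" "rot y = 1" "idx u x = idx u (f y)" "cmod x \<le> cmod (f y)" 
      using assms by auto
    have yP: "y \<in> P" using y W_subset by auto
    have "idx u (f x) - idx u y = rot x + rot y" unfolding turn_def using y(3) by simp
    also have "\<dots> = 0" using y(2) r by simp
    finally have eq: "idx u (f x) = idx u y" by simp
    have "cmod (f x) < cmod y"
      by (rule return_closer[OF frame reg memD(1,2)[OF yP] memD(1,2)[OF x] memD(4)[OF yP] y(3)[symmetric] y(4) memD(4)[OF x] eq])
    then have "f x \<in> W t" using W_down[OF y(1) memD(3)[OF x] eq] by simp
    then show ?thesis using Suc by simp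
  qed
qed

text \<open>The union of the stages is closed under \<open>f\<close> and contains
  \<open>p 0\<close>, whose orbit is the whole cycle.\<close>

lemma W_exhausts: 
  assumes "x \<in> P"
  shows "\<exists>s. x \<in> W s"
proof -
  have step: "\<exists>s. f y \<in> W s" if "\<exists>s. y \<in> W s" for y
    using that W_image by (cases "rot y" rule: cases_3) (metis)+
  have "\<exists>s. (f ^^ t) (p 0) \<in> W s" for t
  proof (induction t)
    case 0
    have "p 0 \<in> W 0" by simp
    then show ?case by (metis funpow_0)
  next
    case (Suc t)
    then show ?case using step by simp
  qed
  moreover have "x \<in> (\<lambda>t. (f ^^ t) (p 0)) ` {..<card P}"
    using cyclic_on_period(3)[OF cyclic p_mem[of 0]] assms by (simp add: bij_betw_def)
  ultimately show ?thesis by auto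
qed

definition lev :: "complex \<Rightarrow> nat" where
  "lev x = (LEAST s. x \<in> W s)"

lemma lev_mem: "x \<in> P \<Longrightarrow> x \<in> W (lev x)"
  unfolding lev_def using W_exhausts by (metis LeastI)

lemma lev_le: "x \<in> W s \<Longrightarrow> lev x \<le> s"
  unfolding lev_def by (rule Least_le)

lemma lev_p: "lev (p j) = 0"
  using lev_le[of "p j" 0] by simp

lemma lev_image:
  assumes "x \<in> P"
  shows "int (lev (f x)) \<le> int (lev x) + drift x"
proof (cases "rot x" rule: cases_3)
  case 1
  then show ?thesis using W_image(2)[OF lev_mem[OF assms]] lev_le by (simp add: exc_def)
next
  case 2
  then have "lev (f x) \<le> Suc (lev x)" using W_image(1)[OF lev_mem[OF assms]] lev_le by blast
  then show ?thesis using 2 by (simp add: exc_def)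
next
  case 3
  then obtain t where "lev x = Suc t" "f x \<in> W t" using W_image(3)[OF lev_mem[OF assms]] by blast
  then show ?thesis using 3 lev_le[of "f x" t] by (simp add: exc_def)
qed

text \<open>The orbit starts at level 0, each step raises the level by at most its drift, and levels
  are natural numbers. The bound for arbitrary prefixes serves the part of the old cycle that is
  copied into the itinerary; the bound for a full round fixes the orientation of the new
  cycle.\<close>

lemma drift_prefix_nonneg: "0 \<le> (\<Sum>t<T. drift ((f ^^ t) (p j)))"
proof -
  have "int (lev ((f ^^ T) (p j))) \<le> (\<Sum>t<T. drift ((f ^^ t) (p j)))"
  proof (induction T)
    case 0
    then show ?case by (simp add: lev_p)
  next
    case (Suc T)
    then show ?case using lev_image[OF funpow_mem[OF p_mem], of T j] by simp
  qed
  then show ?thesis by linarith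
qed

lemma sum_over_orbit:
  assumes "x \<in> P"
  shows "(\<Sum>t<card P. h ((f ^^ t) x)) = sum h P"
  using sum.reindex_bij_betw[OF cyclic_on_period(3)[OF cyclic assms]] .

lemma drift_nonneg: "0 \<le> sum drift P"
  using drift_prefix_nonneg[of 0 "card P"] sum_over_orbit[OF p_mem[of 0], of drift] by simp

end

section \<open>Lines through two branches\<close>

text \<open>At most one summand is nonzero: positive parameters run along branch j, negative ones
  along branch k. For different branches this is an isometric coordinate on their union.\<close>

definition line :: "(3 \<Rightarrow> complex) \<Rightarrow> 3 \<Rightarrow> 3 \<Rightarrow> real \<Rightarrow> complex" where
  "line u j k s = pt u j (max 0 s) + pt u k (max 0 (- s))"

text \<open>Between neighbouring breakpoints the path may turn at the branching point, hence
  affinity is expressed through \<open>line\<close> and not in the plane. Constancy beyond the last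
  breakpoint matches the part of the triod outside the hull.\<close>

definition interpolates ::
  "(3 \<Rightarrow> complex) \<Rightarrow> (real \<Rightarrow> complex) \<Rightarrow> real set \<Rightarrow> (real \<Rightarrow> complex) \<Rightarrow> bool" where
  "interpolates u w D \<gamma> \<longleftrightarrow> continuous_on UNIV \<gamma> \<and> (\<forall>d\<in>D. \<gamma> d = w d) \<and> (\<forall>r\<ge>0. \<gamma> r \<in> triod) \<and>
    (\<forall>a\<in>D. \<forall>b\<in>D. a < b \<longrightarrow> D \<inter> {a<..<b} = {} \<longrightarrow>
      (\<exists>j k \<alpha> \<beta>. j \<noteq> k \<and> (\<forall>r\<in>{a..b}. \<bar>\<alpha> + \<beta> * r\<bar> \<le> 1 \<and> \<gamma> r = line u j k (\<alpha> + \<beta> * r)))) \<and>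
    (\<forall>r\<ge>Max D. \<gamma> r = \<gamma> (Max D))"

context
  fixes u :: "3 \<Rightarrow> complex"
  assumes frame: "frame u"
begin

lemma line_simps:
  "0 \<le> s \<Longrightarrow> line u j k s = pt u j s" "s \<le> 0 \<Longrightarrow> line u j k s = pt u k (- s)"
  by (simp_all add: line_def pt_0[OF frame])

lemma line_swap: "line u k j (- s) = line u j k s"
  by (simp add: line_def add.commute)

lemma continuous_on_line [continuous_intros]:
  "continuous_on S g \<Longrightarrow> continuous_on S (\<lambda>x. line u j k (g x))"
  unfolding line_def by (intro continuous_intros continuous_on_pt[OF frame])

lemma line_in_triod: "\<bar>s\<bar> \<le> 1 \<Longrightarrow> line u j k s \<in> triod"
  by (cases "0 \<le> s") (simp_all add: line_simps pt_in_triod[OF frame])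

lemma tdist_pt:
  assumes "0 \<le> r" "r \<le> 1" "0 \<le> s" "s \<le> 1"
  shows "tdist (pt u i r) (pt u j s) = (if i = j then \<bar>r - s\<bar> else r + s)"
proof -
  have "same_branch (pt u i r) (pt u j s) \<longleftrightarrow> r \<noteq> 0 \<and> s \<noteq> 0 \<and> i = j"
    using same_branch_idx[OF frame pt_in_triod[OF frame assms(1,2), of i] pt_in_triod[OF frame assms(3,4), of j]]
      idx_pt[OF frame, of r i] idx_pt[OF frame, of s j] assms pt_eq_0_iff[OF frame] 
    by (metis order_le_less)
  then show ?thesis using assms by (auto simp: tdist_def norm_pt[OF frame])
qed

lemma tdist_line:
  assumes "\<bar>s\<bar> \<le> 1" "\<bar>t\<bar> \<le> 1" "j \<noteq> k"
  shows "tdist (line u j k s) (line u j k t) = \<bar>s - t\<bar>"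
  using assms by (cases "0 \<le> s"; cases "0 \<le> t") (simp_all add: line_simps tdist_pt)

lemma tdist_line_off:
  assumes "\<bar>s\<bar> \<le> 1" "0 \<le> r" "r \<le> 1" "l \<noteq> j" "l \<noteq> k"
  shows "tdist (line u j k s) (pt u l r) = \<bar>s\<bar> + r"
  using assms by (cases "0 \<le> s") (simp_all add: line_simps tdist_pt)

lemma line_through:
  assumes "x \<in> triod" "y \<in> triod"
  obtains j k s t where "j \<noteq> k" "\<bar>s\<bar> \<le> 1" "\<bar>t\<bar> \<le> 1" "x = line u j k s" "y = line u j k t"
proof -
  obtain i r where r: "0 \<le> r" "r \<le> 1" "x = pt u i r" using triod_cases[OF frame assms(1)] .
  obtain k s where s: "0 \<le> s" "s \<le> 1" "y = pt u k s" using triod_cases[OF frame assms(2)] .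
  show thesis
  proof (cases "i = k")
    case True
    then show thesis using that[of i "i + 1" r s] r s neq_add_1_3[of i] by (simp add: line_simps)
  next
    case False
    then show thesis using that[of i k r "- s"] r s by (simp add: line_simps)
  qed
qed

text \<open>A point on the third branch at distance r from 0 would have distances to the two ends
  adding up to |s| + |t| + 2r, which exceeds |s - t| unless r = 0. On the line itself the two
  distances determine the parameter.\<close>

lemma between_unique:
  assumes "j \<noteq> k" "\<bar>s\<bar> \<le> 1" "\<bar>t\<bar> \<le> 1" "\<bar>q\<bar> \<le> 1" and w: "w \<in> triod"
    and 1: "tdist (line u j k s) w = \<bar>s - q\<bar>" and 2: "tdist (line u j k t) w = \<bar>t - q\<bar>" 
    and 3: "\<bar>s - q\<bar> + \<bar>t - q\<bar> = \<bar>s - t\<bar>"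
  shows "w = line u j k q"
proof -
  have on_line: "w = line u j k q" if "w = line u j k q'" "\<bar>q'\<bar> \<le> 1" for q'
  proof -
    have "\<bar>s - q'\<bar> = \<bar>s - q\<bar>" "\<bar>t - q'\<bar> = \<bar>t - q\<bar>"
      using 1 2 tdist_line assms(1-3) that by simp_all
    then have "q' = q" using 3 by argo
    then show ?thesis using that by simp
  qed
  obtain l r where r: "0 \<le> r" "r \<le> 1" "w = pt u l r" using triod_cases[OF frame w] .
  consider "l = j" | "l = k" | "l \<noteq> j" "l \<noteq> k" by blast
  then show ?thesis
  proof cases
    case 1
    then show ?thesis using on_line[of r] r by (simp add: line_simps)
  next
    case 2
    then show ?thesis using on_line[of "- r"] r by (simp add: line_simps)
  next
    case c: 3
    have "\<bar>s\<bar> + r = \<bar>s - q\<bar>" "\<bar>t\<bar> + r = \<bar>t - q\<bar>"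
      using 1 2 tdist_line_off[OF assms(2) r(1,2) c] tdist_line_off[OF assms(3) r(1,2) c] r by simp_all
    then have "r = 0" using 3 r(1) by argo
    then have "w = line u j k 0" using r by (simp add: line_simps pt_0[OF frame])
    then show ?thesis using on_line[of 0] by simp
  qed
qed

text \<open>Induction on the largest breakpoint: beyond the previous maximum the path is replaced by
  an affine run along a line through the two prescribed values.\<close>

lemma geodesic_interpolation:
  fixes D :: "real set"
  assumes "finite D" "\<And>d. d \<in> D \<Longrightarrow> 0 < d" "\<And>d. d \<in> insert 0 D \<Longrightarrow> w d \<in> triod"
  shows "\<exists>\<gamma>. interpolates u w (insert 0 D) \<gamma>"
  using assms
proof (induction D rule: finite_linorder_max_induct)
  case empty
  then show ?case by (intro exI[of _ "\<lambda>_. w 0"]) (auto simp: interpolates_def)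
next
  case (insert b A)
  have "\<exists>\<gamma>. interpolates u w (insert 0 A) \<gamma>"
    by (rule insert.IH) (use insert.prems in auto)
  then obtain \<gamma> where "interpolates u w (insert 0 A) \<gamma>" ..
  then have c: "continuous_on UNIV \<gamma>" and v: "\<And>d. d \<in> insert 0 A \<Longrightarrow> \<gamma> d = w d" 
    and tr: "\<And>r. 0 \<le> r \<Longrightarrow> \<gamma> r \<in> triod"
    and lin: "\<And>a b. a \<in> insert 0 A \<Longrightarrow> b \<in> insert 0 A \<Longrightarrow> a < b \<Longrightarrow> insert 0 A \<inter> {a<..<b} = {} \<Longrightarrow>
      (\<exists>j k \<alpha> \<beta>. j \<noteq> k \<and> (\<forall>r\<in>{a..b}. \<bar>\<alpha> + \<beta> * r\<bar> \<le> 1 \<and> \<gamma> r = line u j k (\<alpha> + \<beta> * r)))"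
    unfolding interpolates_def by blast+
  define m where "m = Max (insert 0 A)"
  have mA: "m \<in> insert 0 A" unfolding m_def by (rule Max_in) (use insert.hyps in auto)
  have mle: "d \<le> m" if "d \<in> insert 0 A" for d unfolding m_def by (rule Max_ge) (use insert.hyps that in auto)
  have b: "0 < b" using insert.prems by simp
  have mb: "m < b" using mA insert.hyps b by auto
  have m0: "0 \<le> m" using mle by simp
  have "w m \<in> triod" "w b \<in> triod" using insert.prems(2) mA by auto
  then obtain j k s t where st: "j \<noteq> k" "\<bar>s\<bar> \<le> 1" "\<bar>t\<bar> \<le> 1" "w m = line u j k s" "w b = line u j k t"
    using line_through by blast
  \<comment> \<open>Affine from s at m to t at b; the minimum freezes the parameter beyond
    b.\<close>
  define g where "g r = s + (t - s) * ((min r b - m) / (b - m))" for r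
  define \<delta> where "\<delta> r = (if r \<le> m then \<gamma> r else line u j k (g r))" for r
  have gm: "g m = s" "g b = t" using mb by (simp_all add: g_def)
  have g1: "\<bar>g r\<bar> \<le> 1" if "m \<le> r" for r
  proof -
    define \<theta> where "\<theta> = (min r b - m) / (b - m)"
    have \<theta>: "0 \<le> \<theta>" "\<theta> \<le> 1" using that mb by (simp_all add: \<theta>_def divide_simps)
    have "g r = (1 - \<theta>) * s + \<theta> * t" by (simp add: g_def \<theta>_def[symmetric] algebra_simps)
    also have "\<bar>\<dots>\<bar> \<le> (1 - \<theta>) * \<bar>s\<bar> + \<theta> * \<bar>t\<bar>" 
      using \<theta> by (metis (no_types, opaque_lifting) abs_mult abs_of_nonneg abs_triangle_ineq diff_ge_0_iff_ge)
    also have "\<dots> \<le> (1 - \<theta>) * 1 + \<theta> * 1" using \<theta> st by (intro add_mono mult_left_mono) auto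
    finally show ?thesis by simp
  qed
  have \<delta>m: "\<delta> r = line u j k (g r)" if "m \<le> r" for r
    using that v[OF mA] st gm by (cases "r = m") (auto simp: \<delta>_def)
  have "continuous_on ({..m} \<union> {m..}) (\<lambda>r. if r \<le> m then \<gamma> r else line u j k (g r))"
  proof (rule continuous_on_cases)
    show "continuous_on {..m} \<gamma>" using c continuous_on_subset by blast
    show "continuous_on {m..} (\<lambda>r. line u j k (g r))"
      unfolding g_def using mb by (intro continuous_intros) auto
    show "\<forall>r. r \<in> {..m} \<and> \<not> r \<le> m \<or> r \<in> {m..} \<and> r \<le> m \<longrightarrow> \<gamma> r = line u j k (g r)"
      using v[OF mA] st gm by auto
  qed auto
  moreover have "{..m} \<union> {m..} = UNIV" by auto
  ultimately have cd: "continuous_on UNIV \<delta>" by (simp add: \<delta>_def[abs_def])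
  have vd: "\<delta> d = w d" if "d \<in> insert 0 (insert b A)" for d
  proof (cases "d = b")
    case True
    then show ?thesis using \<delta>m[of b] mb gm st by simp
  next
    case False
    then have d: "d \<in> insert 0 A" using that by auto
    then show ?thesis using mle[OF d] v[OF d] by (simp add: \<delta>_def)
  qed
  have td: "\<delta> r \<in> triod" if "0 \<le> r" for r
    using tr[OF that] line_in_triod[OF g1] by (simp add: \<delta>_def)
  have ld: "\<exists>j k \<alpha> \<beta>. j \<noteq> k \<and> (\<forall>r\<in>{a..c}. \<bar>\<alpha> + \<beta> * r\<bar> \<le> 1 \<and> \<delta> r = line u j k (\<alpha> + \<beta> * r))"
    if ac: "a \<in> insert 0 (insert b A)" "c \<in> insert 0 (insert b A)" "a < c" 
      "insert 0 (insert b A) \<inter> {a<..<c} = {}" for a c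
  proof (cases "c = b")
    case True
    have a: "a \<in> insert 0 A" using ac True by auto
    have "\<not> a < m" using ac(4) mA mb True by auto
    then have am: "a = m" using mle[OF a] by simp
    define \<beta> where "\<beta> = (t - s) / (b - m)"
    have "g r = (s - \<beta> * m) + \<beta> * r" if "r \<in> {a..c}" for r
      using that True by (simp add: g_def \<beta>_def algebra_simps diff_divide_distrib)
    then have "\<forall>r\<in>{a..c}. \<bar>(s - \<beta> * m) + \<beta> * r\<bar> \<le> 1 \<and> \<delta> r = line u j k ((s - \<beta> * m) + \<beta> * r)"
      using g1 \<delta>m am by (metis atLeastAtMost_iff)
    then show ?thesis using st(1) by blast
  next
    case False
    then have c: "c \<in> insert 0 A" using ac by auto
    have "a \<noteq> b" using ac(3) mle[OF c] mb by auto
    then have a: "a \<in> insert 0 A" using ac by auto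
    have "\<delta> r = \<gamma> r" if "r \<in> {a..c}" for r using that mle[OF c] by (simp add: \<delta>_def)
    moreover have "insert 0 A \<inter> {a<..<c} = {}" using ac(4) by auto
    ultimately show ?thesis using lin[OF a c ac(3)] by (metis (no_types, lifting))
  qed
  have Mx: "Max (insert 0 (insert b A)) = b"
    by (rule Max_eqI) (use insert.hyps mle mb b in force)+
  have fd: "\<delta> r = \<delta> b" if "b \<le> r" for r
  proof -
    have "\<delta> r = line u j k (g r)" by (rule \<delta>m) (use that mb in simp)
    also have "g r = g b" using that by (simp add: g_def)
    also have "line u j k (g b) = \<delta> b" by (rule \<delta>m[symmetric]) (use mb in simp)
    finally show ?thesis .
  qed
  have "interpolates u w (insert 0 (insert b A)) \<delta>"
    unfolding interpolates_def Mx by (intro conjI ballI allI impI cd vd td ld fd)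
  then show ?case by blast
qed

end

section \<open>The linear map of a cycle\<close>

text \<open>Since every branch is occupied, the hull is again a triod, with three legs of positive
  length.\<close>

locale spread =
  fixes u :: "3 \<Rightarrow> complex" and P :: "complex set"
  assumes frame: "frame u" and finite_P: "finite P" and P_subset: "P \<subseteq> triod - {0}"
    and occupied: "\<exists>x\<in>P. idx u x = j"
begin

definition nodes :: "3 \<Rightarrow> real set" where
  "nodes i = insert 0 (cmod ` {x \<in> P. idx u x = i})"

definition tip :: "3 \<Rightarrow> real" where
  "tip i = Max (nodes i)"

definition tree :: "complex set" where
  "tree = (\<Union>i. pt u i ` {0..tip i})"

text \<open>The arcs between neighbouring points of P \<union> {0}, coded by branch and end radii.
  Their interiors correspond to the components on which the linear map has to be affine.\<close>

definition basic :: "(3 \<times> real \<times> real) set" where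
  "basic = {(i, a, b). a \<in> nodes i \<and> b \<in> nodes i \<and> a < b \<and> nodes i \<inter> {a<..<b} = {}}"

lemma finite_nodes: "finite (nodes i)" using finite_P by (simp add: nodes_def)

lemma nodes_0: "0 \<in> nodes i" by (simp add: nodes_def)

lemma nodes_bounds: "r \<in> nodes i \<Longrightarrow> 0 \<le> r \<and> r \<le> 1"
  using P_subset triod_norm_le by (auto simp: nodes_def)

lemma node_mem: "r \<in> nodes i \<Longrightarrow> r \<noteq> 0 \<Longrightarrow> pt u i r \<in> P"
  using P_subset pt_idx[OF frame] by (force simp: nodes_def)

lemma node_pt: "r \<in> nodes i \<Longrightarrow> pt u i r \<in> insert 0 P"
  using node_mem pt_0[OF frame] by (cases "r = 0") auto

lemma mem_node: "x \<in> P \<Longrightarrow> cmod x \<in> nodes (idx u x)"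
  by (simp add: nodes_def)

lemma pt_node: "0 \<le> r \<Longrightarrow> pt u i r \<in> insert 0 P \<Longrightarrow> r \<in> nodes i"
proof (cases "r = 0")
  case False
  assume a: "0 \<le> r" "pt u i r \<in> insert 0 P"
  then have P: "pt u i r \<in> P" using False pt_eq_0_iff[OF frame] by auto
  have "r \<le> 1" using P P_subset triod_norm_le norm_pt[OF frame a(1)] by (metis DiffD1 subsetD)
  then have "idx u (pt u i r) = i" using idx_pt[OF frame] a False by simp
  then show ?thesis using mem_node[OF P] norm_pt[OF frame a(1)] by simp
qed (simp add: nodes_0)

lemma tip_node: "tip i \<in> nodes i"
  unfolding tip_def using finite_nodes nodes_0 by (intro Max_in) auto

lemma node_le_tip: "r \<in> nodes i \<Longrightarrow> r \<le> tip i"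
  unfolding tip_def using finite_nodes by (intro Max_ge) auto

lemma tip_pos: "0 < tip i"
proof -
  obtain x where x: "x \<in> P" "idx u x = i" using occupied by blast
  then have "cmod x \<le> tip i" using mem_node node_le_tip by blast
  moreover have "x \<noteq> 0" using x P_subset by auto
  ultimately show ?thesis by (metis less_le_trans zero_less_norm_iff)
qed

lemma tip_le_1: "tip i \<le> 1" using nodes_bounds[OF tip_node] by simp

lemma tip_mem: "pt u i (tip i) \<in> P" using node_mem[OF tip_node] tip_pos[of i] by simp

lemma basicD:
  assumes "(i, a, b) \<in> basic"
  shows "a \<in> nodes i" "b \<in> nodes i" "a < b" "0 \<le> a" "b \<le> tip i" "b \<le> 1" "\<And>r. a < r \<Longrightarrow> r < b \<Longrightarrow> r \<notin> nodes i"
  using assms nodes_bounds node_le_tip by (auto simp: basic_def)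

lemma finite_basic: "finite basic"
proof -
  have "basic \<subseteq> UNIV \<times> (\<Union>i. nodes i) \<times> (\<Union>i. nodes i)" by (auto simp: basic_def)
  then show ?thesis using finite_nodes by (auto intro: finite_subset)
qed

lemma basic_above:
  assumes "0 \<le> r" "r < tip i"
  obtains a b where "(i, a, b) \<in> basic" "a \<le> r" "r < b"
proof -
  define A where "A = {n \<in> nodes i. n \<le> r}"
  define B where "B = {n \<in> nodes i. r < n}"
  have A: "finite A" "A \<noteq> {}" using finite_nodes nodes_0 assms by (auto simp: A_def)
  have B: "finite B" "B \<noteq> {}" using finite_nodes tip_node assms by (auto simp: B_def)
  have a: "Max A \<in> A" and b: "Min B \<in> B" using Max_in Min_in A B by auto
  have "n \<notin> {Max A<..<Min B}" if "n \<in> nodes i" for n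
  proof (cases "n \<le> r")
    case True
    then show ?thesis using Max_ge[OF A(1), of n] that by (simp add: A_def)
  next
    case False
    then show ?thesis using Min_le[OF B(1), of n] that by (simp add: B_def)
  qed
  then have "(i, Max A, Min B) \<in> basic" using a b by (auto simp: basic_def A_def B_def)
  then show thesis using that a b by (auto simp: A_def B_def)
qed

lemma basic_below:
  assumes "0 < r" "r \<le> tip i"
  obtains a b where "(i, a, b) \<in> basic" "a < r" "r \<le> b"
proof -
  define A where "A = {n \<in> nodes i. n < r}"
  define B where "B = {n \<in> nodes i. r \<le> n}"
  have A: "finite A" "A \<noteq> {}" using finite_nodes nodes_0 assms by (auto simp: A_def)
  have B: "finite B" "B \<noteq> {}" using finite_nodes tip_node assms by (auto simp: B_def)
  have a: "Max A \<in> A" and b: "Min B \<in> B" using Max_in Min_in A B by auto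
  have "n \<notin> {Max A<..<Min B}" if "n \<in> nodes i" for n
  proof (cases "n < r")
    case True
    then show ?thesis using Max_ge[OF A(1), of n] that by (simp add: A_def)
  next
    case False
    then show ?thesis using Min_le[OF B(1), of n] that by (simp add: B_def)
  qed
  then have "(i, Max A, Min B) \<in> basic" using a b by (auto simp: basic_def A_def B_def)
  then show thesis using that a b by (auto simp: A_def B_def)
qed

lemma tree_cases:
  assumes "x \<in> tree"
  obtains i r where "0 \<le> r" "r \<le> tip i" "x = pt u i r"
  using assms by (auto simp: tree_def)

lemma pt_in_tree: "0 \<le> r \<Longrightarrow> r \<le> tip i \<Longrightarrow> pt u i r \<in> tree"
  unfolding tree_def by (rule UN_I[of i]) auto

lemma pt_tree_le:
  assumes "0 \<le> r" "pt u i r \<in> tree"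
  shows "r \<le> tip i"
proof -
  obtain k s where s: "0 \<le> s" "s \<le> tip k" "pt u i r = pt u k s" using assms(2) by (rule tree_cases)
  then have "r = s \<and> (r = 0 \<or> i = k)" using pt_eq_iff[OF frame assms(1) s(1)] by blast
  then show ?thesis using s tip_pos[of i] by auto
qed

lemma tree_subset: "tree \<subseteq> triod"
  using tip_le_1 order_trans by (fastforce simp: tree_def intro: pt_in_triod[OF frame])

lemma zero_in_tree: "0 \<in> tree"
  using pt_in_tree[of 0 0] tip_pos[of 0] pt_0[OF frame] by simp

lemma P_tree: "P \<subseteq> tree"
proof
  fix x assume x: "x \<in> P"
  then have "pt u (idx u x) (cmod x) = x" using pt_idx[OF frame] P_subset by auto
  then show "x \<in> tree" using pt_in_tree[OF norm_ge_zero node_le_tip[OF mem_node[OF x]]] by simp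
qed

lemma connected_leg: "connected (pt u i ` {a..b})" "connected (pt u i ` {a<..<b})"
  by (intro connected_continuous_image continuous_on_pt[OF frame] continuous_intros connected_Icc connected_Ioo)+

lemma connected_tree: "connected tree"
  unfolding tree_def
proof (rule connected_Union)
  show "connected s" if "s \<in> range (\<lambda>i. pt u i ` {0..tip i})" for s using that connected_leg by auto
  have "0 \<in> pt u i ` {0..tip i}" for i
    using tip_pos[of i] pt_0[OF frame, of i] by (intro image_eqI[of _ _ 0]) auto
  then show "\<Inter> (range (\<lambda>i. pt u i ` {0..tip i})) \<noteq> {}" by blast
qed

lemma closed_tree: "closed tree"
proof -
  have "closed (pt u i ` {0..tip i})" for i
    by (rule compact_imp_closed, rule compact_continuous_image, rule continuous_on_pt[OF frame continuous_on_id])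
      (rule compact_Icc)
  then show ?thesis unfolding tree_def by (intro closed_UN) auto
qed

lemma zero_in_spanning:
  assumes "connected S" "S \<subseteq> triod" "P \<subseteq> S"
  shows "0 \<in> S"
proof -
  have "pt u 0 (tip 0) \<in> S" "pt u 1 (tip 1) \<in> S" using tip_mem assms by auto
  then show ?thesis
    using connected_contains_0[OF frame assms(1,2)] tip_pos tip_le_1 idx_pt[OF frame] pt_eq_0_iff[OF frame]
    by (metis less_irrefl zero_neq_one)
qed

lemma tree_least:
  assumes "connected S" "S \<subseteq> triod" "P \<subseteq> S"
  shows "tree \<subseteq> S"
proof
  fix x assume "x \<in> tree"
  then obtain i r where r: "0 \<le> r" "r \<le> tip i" "x = pt u i r" by (rule tree_cases)
  have "pt u i 0 \<in> S" using zero_in_spanning[OF assms] pt_0[OF frame] by simp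
  moreover have "pt u i (tip i) \<in> S" using tip_mem assms by auto
  ultimately show "x \<in> S" 
    unfolding r using connected_contains_between[OF frame assms(1,2), of i 0 "tip i" r] r by simp
qed

lemma thull_eq: "thull P = tree"
proof
  show "thull P \<subseteq> tree" unfolding thull_def
    using P_tree tree_subset closed_tree connected_tree by blast
  show "tree \<subseteq> thull P" unfolding thull_def using tree_least by blast
qed

section \<open>Existence and uniqueness of the linear map\<close>

lemma component_basic:
  assumes "C \<in> components (tree - (P \<union> {0}))"
  obtains i a b where "(i, a, b) \<in> basic" "C \<subseteq> pt u i ` {a<..<b}"
proof -
  have C: "connected C" "C \<subseteq> tree - (P \<union> {0})" "C \<noteq> {}"
    using assms in_components_connected in_components_subset in_components_nonempty by metis+
  have Ct: "C \<subseteq> triod - {0}" using C(2) tree_subset by auto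
  obtain x where x: "x \<in> C" using C by auto
  define i where "i = idx u x"
  have ray: "C \<subseteq> ray u i" unfolding i_def by (rule connected_in_ray[OF frame C(1) Ct x])
  have "x \<in> ray u i" using ray x by blast
  then obtain r where r: "0 < r" "r \<le> 1" "x = pt u i r" by (auto simp: ray_def)
  have notin: "s \<notin> nodes i" if "pt u i s \<in> C" for s
    using node_pt[of s i] that C(2) by auto
  have "r \<le> tip i" using pt_tree_le[of r i] x C r by auto
  with r(1) obtain a b where ab: "(i, a, b) \<in> basic" "a < r" "r \<le> b" by (rule basic_below)
  have "r \<noteq> b" using notin[of r] x r basicD(2)[OF ab(1)] by auto
  have "y \<in> pt u i ` {a<..<b}" if y: "y \<in> C" for y
  proof -
    have "y \<in> ray u i" using ray y by blast
    then obtain s where s: "0 < s" "s \<le> 1" "y = pt u i s" by (auto simp: ray_def)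
    have "a < s"
    proof (rule ccontr)
      assume "\<not> a < s"
      then have "pt u i a \<in> C" using connected_contains_between[OF frame C(1), of i s r a] Ct s y x r ab by auto
      then show False using notin basicD(1)[OF ab(1)] by auto
    qed
    moreover have "s < b"
    proof (rule ccontr)
      assume "\<not> s < b"
      then have "pt u i b \<in> C" using connected_contains_between[OF frame C(1), of i r s b] Ct s y x r ab by auto
      then show False using notin basicD(2)[OF ab(1)] by auto
    qed
    ultimately show ?thesis using s by auto
  qed
  then show thesis using that ab by blast
qed

lemma basic_component:
  assumes "(i, a, b) \<in> basic"
  obtains C where "C \<in> components (tree - (P \<union> {0}))" "pt u i ` {a<..<b} \<subseteq> C"
proof -
  note b = basicD[OF assms]
  have sub: "pt u i ` {a<..<b} \<subseteq> tree - (P \<union> {0})"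
  proof safe
    fix r assume r: "r \<in> {a<..<b}"
    show "pt u i r \<in> tree" using b r by (intro pt_in_tree) auto
    show False if "pt u i r \<in> P"
      using pt_node[of r i] that b(4) r b(7)[of r] by auto
    show False if "pt u i r = 0" using that pt_eq_0_iff[OF frame] r b by auto
  qed
  moreover have "pt u i ` {a<..<b} \<noteq> {}" using b(3) by auto
  ultimately have "tree - (P \<union> {0}) \<noteq> {}" by blast
  then show thesis using exists_component_superset[OF sub _ connected_leg(2)] that by blast
qed

lemma linear_map_exists:
  assumes "f 0 = 0" "\<And>x. x \<in> P \<Longrightarrow> f x \<in> triod"
  shows "\<exists>F. is_linear_map f P F \<and> 
    (\<forall>(i, a, b)\<in>basic. \<exists>j k \<alpha> \<beta>. j \<noteq> k \<and> (\<forall>r\<in>{a..b}. \<bar>\<alpha> + \<beta> * r\<bar> \<le> 1 \<and> F (pt u i r) = line u j k (\<alpha> + \<beta> * r)))"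
proof -
  have "\<exists>\<gamma>. interpolates u (\<lambda>r. f (pt u i r)) (nodes i) \<gamma>" for i
    unfolding nodes_def
  proof (rule geodesic_interpolation[OF frame])
    show "finite (cmod ` {x \<in> P. idx u x = i})" using finite_P by simp
    show "0 < d" if "d \<in> cmod ` {x \<in> P. idx u x = i}" for d using that P_subset by auto
    show "f (pt u i d) \<in> triod" if "d \<in> insert 0 (cmod ` {x \<in> P. idx u x = i})" for d
      using that node_pt[of d i] assms zero_in_triod[OF frame] by (auto simp: nodes_def)
  qed
  then obtain \<gamma> where "\<And>i. interpolates u (\<lambda>r. f (pt u i r)) (nodes i) (\<gamma> i)"
    by metis
  then have \<gamma>: "\<And>i. continuous_on UNIV (\<gamma> i)" "\<And>i d. d \<in> nodes i \<Longrightarrow> \<gamma> i d = f (pt u i d)" 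
    "\<And>i r. 0 \<le> r \<Longrightarrow> \<gamma> i r \<in> triod"
    "\<And>i a b. a \<in> nodes i \<Longrightarrow> b \<in> nodes i \<Longrightarrow> a < b \<Longrightarrow> nodes i \<inter> {a<..<b} = {} \<Longrightarrow>
      \<exists>j k \<alpha> \<beta>. j \<noteq> k \<and> (\<forall>r\<in>{a..b}. \<bar>\<alpha> + \<beta> * r\<bar> \<le> 1 \<and> \<gamma> i r = line u j k (\<alpha> + \<beta> * r))"
    "\<And>i r. tip i \<le> r \<Longrightarrow> \<gamma> i r = \<gamma> i (tip i)"
    unfolding interpolates_def tip_def by blast+
  have \<gamma>0: "\<gamma> i 0 = 0" for i using \<gamma>(2)[OF nodes_0] assms pt_0[OF frame] by simp
  \<comment> \<open>At most one coordinate of a point of the triod is nonzero and each \<gamma> i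
    vanishes at 0, so at most one term of the sum survives. The sum glues the three legs and is
    continuous without any case distinction.\<close>
  define F where "F = restrict (\<lambda>x. \<Sum>i\<in>UNIV. \<gamma> i (coord u i x)) triod"
  have F: "F (pt u i r) = \<gamma> i r" if "0 \<le> r" "r \<le> 1" for i r
  proof -
    have "F (pt u i r) = (\<Sum>j\<in>UNIV. \<gamma> j (coord u j (pt u i r)))"
      unfolding F_def using pt_in_triod[OF frame that] by simp
    also have "\<dots> = (\<Sum>j\<in>UNIV. if i = j then \<gamma> j r else 0)"
      by (intro sum.cong) (auto simp: coord_pt[OF frame that(1)] \<gamma>0)
    finally show ?thesis by simp
  qed
  have lin: "\<exists>j k \<alpha> \<beta>. j \<noteq> k \<and> (\<forall>r\<in>{a..b}. \<bar>\<alpha> + \<beta> * r\<bar> \<le> 1 \<and> F (pt u i r) = line u j k (\<alpha> + \<beta> * r))"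
    if "(i, a, b) \<in> basic" for i a b
  proof -
    note b = basicD[OF that]
    have "nodes i \<inter> {a<..<b} = {}" using b(7) by auto
    then obtain j k \<alpha> \<beta> where "j \<noteq> k" "\<forall>r\<in>{a..b}. \<bar>\<alpha> + \<beta> * r\<bar> \<le> 1 \<and> \<gamma> i r = line u j k (\<alpha> + \<beta> * r)"
      using \<gamma>(4)[OF b(1-3)] by blast
    moreover have "F (pt u i r) = \<gamma> i r" if "r \<in> {a..b}" for r using F that b by auto
    ultimately show ?thesis by metis
  qed
  have "is_linear_map f P F"
    unfolding is_linear_map_def
  proof (intro conjI ballI)
    show "F \<in> triod \<rightarrow>\<^sub>E triod"
    proof (rule PiE_I)
      fix x assume "x \<in> triod"
      then obtain i r where "0 \<le> r" "r \<le> 1" "x = pt u i r" by (rule triod_cases[OF frame])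
      then show "F x \<in> triod" using F \<gamma>(3) by simp
    qed (simp add: F_def)
    have "continuous_on triod (\<lambda>x. \<Sum>i\<in>UNIV. \<gamma> i (coord u i x))"
      by (intro continuous_intros continuous_on_compose2[OF \<gamma>(1)] continuous_on_coord[OF frame]) auto
    then show "continuous_on triod F" by (rule continuous_on_eq) (simp add: F_def)
    show "F 0 = 0" using F[of 0 0] \<gamma>0 pt_0[OF frame] by simp
    show "F x = f x" if x: "x \<in> P" for x
    proof -
      have xt: "x \<in> triod" "x \<noteq> 0" using x P_subset by auto
      have "F (pt u (idx u x) (cmod x)) = f (pt u (idx u x) (cmod x))"
        using F[OF norm_ge_zero triod_norm_le[OF xt(1)]] \<gamma>(2)[OF mem_node[OF x]] by simp
      then show ?thesis using pt_idx[OF frame xt] by simp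
    qed
  next
    fix C assume "C \<in> components (thull P - (P \<union> {0}))"
    then obtain i a b where ab: "(i, a, b) \<in> basic" "C \<subseteq> pt u i ` {a<..<b}"
      unfolding thull_eq by (rule component_basic)
    note b = basicD[OF ab(1)]
    obtain j k \<alpha> \<beta> where jk: "j \<noteq> k" and l: "\<And>r. r\<in>{a..b} \<Longrightarrow> \<bar>\<alpha> + \<beta> * r\<bar> \<le> 1 \<and> F (pt u i r) = line u j k (\<alpha> + \<beta> * r)"
      using lin[OF ab(1)] by blast
    have "tdist (F x) (F y) = \<bar>\<beta>\<bar> * tdist x y" if xy: "x \<in> C" "y \<in> C" for x y
    proof -
      obtain r where r: "r \<in> {a<..<b}" "x = pt u i r" using ab xy by auto
      obtain s where s: "s \<in> {a<..<b}" "y = pt u i s" using ab xy by auto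
      have "tdist (F x) (F y) = \<bar>(\<alpha> + \<beta> * r) - (\<alpha> + \<beta> * s)\<bar>"
        using l[of r] l[of s] r s tdist_line[OF frame _ _ jk] by simp
      also have "\<dots> = \<bar>\<beta>\<bar> * \<bar>r - s\<bar>" by (simp flip: abs_mult add: right_diff_distrib)
      also have "\<bar>r - s\<bar> = tdist x y" using r s b tdist_pt[OF frame, of r s i i] by simp
      finally show ?thesis .
    qed
    then show "affine_on C F" unfolding affine_on_def by (intro exI[of _ "\<bar>\<beta>\<bar>"]) simp
  next
    fix C assume "C \<in> components (triod - thull P)"
    then have C: "connected C" "C \<subseteq> triod - tree" "C \<noteq> {}"
      unfolding thull_eq using in_components_connected in_components_subset in_components_nonempty by metis+
    obtain x where x: "x \<in> C" using C by auto
    have "C \<subseteq> triod - {0}" using C(2) zero_in_tree by auto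
    from connected_in_ray[OF frame C(1) this x] have ray: "C \<subseteq> ray u (idx u x)" .
    have "F y = \<gamma> (idx u x) (tip (idx u x))" if y: "y \<in> C" for y
    proof -
      have "y \<in> ray u (idx u x)" using ray y by blast
      then obtain s where s: "0 < s" "s \<le> 1" "y = pt u (idx u x) s" by (auto simp: ray_def)
      have "\<not> s \<le> tip (idx u x)" using pt_in_tree[of s "idx u x"] s y C by auto
      then show ?thesis using F[of s "idx u x"] \<gamma>(5)[of "idx u x" s] s by simp
    qed
    then show "F constant_on C" unfolding constant_on_def by blast
  qed
  then show ?thesis using lin by blast
qed

text \<open>The affinity condition holds on open arcs; continuity extends it to their closures.\<close>

lemma linear_map_scale:
  assumes F: "is_linear_map f P F" and ab: "(i, a, b) \<in> basic" and rs: "r \<in> {a..b}" "s \<in> {a..b}"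
  shows "tdist (F (pt u i r)) (F (pt u i s)) = tdist (F (pt u i a)) (F (pt u i b)) / (b - a) * \<bar>r - s\<bar>"
proof -
  note b = basicD[OF ab]
  have F': "F \<in> triod \<rightarrow>\<^sub>E triod" "continuous_on triod F" 
      "\<And>C. C \<in> components (thull P - (P \<union> {0})) \<Longrightarrow> affine_on C F"
    using F by (auto simp: is_linear_map_def)
  obtain C where C: "C \<in> components (tree - (P \<union> {0}))" "pt u i ` {a<..<b} \<subseteq> C" using basic_component[OF ab] .
  obtain L where L: "\<And>x y. x \<in> C \<Longrightarrow> y \<in> C \<Longrightarrow> tdist (F x) (F y) = L * tdist x y"
    using F'(3)[of C] C(1) by (auto simp: affine_on_def thull_eq)
  have tr: "pt u i r \<in> triod" if "r \<in> {a..b}" for r using that b by (intro pt_in_triod[OF frame]) auto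
  have Ft: "F (pt u i r) \<in> triod" if "r \<in> {a..b}" for r using tr[OF that] F'(1) by auto
  have cF: "continuous_on {a..b} (\<lambda>r. F (pt u i r))"
    by (rule continuous_on_compose2[OF F'(2) continuous_on_pt[OF frame continuous_on_id]]) (use tr in auto)
  \<comment> \<open>The defect of scaling by L, written in coordinates so that it is continuous. It
    vanishes on the open square and therefore on the closed one.\<close>
  define \<phi> where "\<phi> z = (\<Sum>j\<in>UNIV. \<bar>coord u j (F (pt u i (fst z))) - coord u j (F (pt u i (snd z)))\<bar>) - L * \<bar>fst z - snd z\<bar>" for z
  have \<phi>: "\<phi> (r, s) = tdist (F (pt u i r)) (F (pt u i s)) - L * \<bar>r - s\<bar>" if "r \<in> {a..b}" "s \<in> {a..b}" for r s
    using tdist_coord[OF frame Ft[OF that(1)] Ft[OF that(2)]] by (simp add: \<phi>_def)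
  have cl: "closure ({a<..<b} \<times> {a<..<b}) = {a..b} \<times> {a..b}"
    using b(3) by (simp add: closure_Times)
  have "continuous_on ({a..b} \<times> {a..b}) \<phi>"
    unfolding \<phi>_def
    by (intro continuous_intros continuous_on_coord[OF frame] continuous_on_compose2[OF cF]) auto
  then have cont: "continuous_on (closure ({a<..<b} \<times> {a<..<b})) \<phi>" unfolding cl .
  have "\<phi> z = 0" if z: "z \<in> {a<..<b} \<times> {a<..<b}" for z
  proof -
    obtain r s where rs: "z = (r, s)" "r \<in> {a<..<b}" "s \<in> {a<..<b}" using z by auto
    have "pt u i r \<in> C" "pt u i s \<in> C" using C(2) rs by auto
    then show ?thesis using L[of "pt u i r" "pt u i s"] \<phi>[of r s] tdist_pt[OF frame, of r s i i] rs b by simp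
  qed
  then have "\<phi> z = 0" if "z \<in> {a..b} \<times> {a..b}" for z
    using continuous_constant_on_closure[OF cont, of 0 z] that unfolding cl by blast
  then have eq: "tdist (F (pt u i r)) (F (pt u i s)) = L * \<bar>r - s\<bar>" if "r \<in> {a..b}" "s \<in> {a..b}" for r s
    using \<phi>[OF that] that by simp
  show ?thesis using eq[OF rs] eq[of a b] b(3) by simp
qed

lemma linear_map_node:
  assumes F: "is_linear_map f P F" and "f 0 = 0" "r \<in> nodes i"
  shows "F (pt u i r) = f (pt u i r)"
  using assms node_pt[of r i] by (auto simp: is_linear_map_def)

text \<open>Both maps agree at the ends of a basic arc, and these values determine the scaling
  factor. The image of an intermediate point under \<open>G\<close> then has the same distances to
  the images of the ends as its image under \<open>F\<close>, and by \<open>between_unique\<close>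
  only one point has these distances.\<close>

lemma linear_map_unique:
  assumes F: "is_linear_map f P F" and G: "is_linear_map f P G" and f0: "f 0 = 0"
    and lin: "\<forall>(i, a, b)\<in>basic. \<exists>j k \<alpha> \<beta>. j \<noteq> k \<and> (\<forall>r\<in>{a..b}. \<bar>\<alpha> + \<beta> * r\<bar> \<le> 1 \<and> F (pt u i r) = line u j k (\<alpha> + \<beta> * r))"
  shows "G = F"
proof
  fix x
  have Gt: "G \<in> triod \<rightarrow>\<^sub>E triod" "continuous_on triod G" and Ft: "F \<in> triod \<rightarrow>\<^sub>E triod" "continuous_on triod F" 
    using F G by (auto simp: is_linear_map_def)
  have in_tree: "G (pt u i r) = F (pt u i r)" if r: "0 \<le> r" "r \<le> tip i" for i r
  proof (cases "r = 0")
    case True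
    then show ?thesis using linear_map_node[OF F f0 nodes_0] linear_map_node[OF G f0 nodes_0] by simp
  next
    case False
    then have "0 < r" using r by simp
    from basic_below[OF this r(2)] obtain a b where ab: "(i, a, b) \<in> basic" "a < r" "r \<le> b" .
    note b = basicD[OF ab(1)]
    obtain j k \<alpha> \<beta> where jk: "j \<noteq> k" and l: "\<And>r. r\<in>{a..b} \<Longrightarrow> \<bar>\<alpha> + \<beta> * r\<bar> \<le> 1 \<and> F (pt u i r) = line u j k (\<alpha> + \<beta> * r)"
      using lin ab(1) by blast
    have rab: "r \<in> {a..b}" "a \<in> {a..b}" "b \<in> {a..b}" using ab b by auto
    have Ga: "G (pt u i a) = F (pt u i a)" "G (pt u i b) = F (pt u i b)"
      using linear_map_node[OF F f0] linear_map_node[OF G f0] b(1,2) by simp_all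
    have la: "\<bar>\<alpha> + \<beta> * a\<bar> \<le> 1" "F (pt u i a) = line u j k (\<alpha> + \<beta> * a)" using l[OF rab(2)] by simp_all
    have lb: "\<bar>\<alpha> + \<beta> * b\<bar> \<le> 1" "F (pt u i b) = line u j k (\<alpha> + \<beta> * b)" using l[OF rab(3)] by simp_all
    have lr: "\<bar>\<alpha> + \<beta> * r\<bar> \<le> 1" "F (pt u i r) = line u j k (\<alpha> + \<beta> * r)" using l[OF rab(1)] by simp_all
    have "tdist (F (pt u i a)) (F (pt u i b)) = \<bar>\<beta>\<bar> * \<bar>a - b\<bar>"
      unfolding la lb using tdist_line[OF frame la(1) lb(1) jk] by (simp flip: abs_mult add: right_diff_distrib)
    then have L: "tdist (F (pt u i a)) (F (pt u i b)) / (b - a) = \<bar>\<beta>\<bar>" using b(3) by simp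
    have "G (pt u i r) = line u j k (\<alpha> + \<beta> * r)"
    proof (rule between_unique[OF frame jk la(1) lb(1) lr(1)])
      show "G (pt u i r) \<in> triod" using Gt(1) pt_in_triod[OF frame r(1)] r(2) tip_le_1[of i] by force
      have "tdist (G (pt u i a)) (G (pt u i r)) = \<bar>\<beta>\<bar> * \<bar>a - r\<bar>"
        using linear_map_scale[OF G ab(1) rab(2,1)] L unfolding Ga by simp
      then show "tdist (line u j k (\<alpha> + \<beta> * a)) (G (pt u i r)) = \<bar>\<alpha> + \<beta> * a - (\<alpha> + \<beta> * r)\<bar>"
        unfolding Ga la by (simp flip: abs_mult add: right_diff_distrib)
      have "tdist (G (pt u i b)) (G (pt u i r)) = \<bar>\<beta>\<bar> * \<bar>b - r\<bar>"
        using linear_map_scale[OF G ab(1) rab(3,1)] L unfolding Ga by simp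
      then show "tdist (line u j k (\<alpha> + \<beta> * b)) (G (pt u i r)) = \<bar>\<alpha> + \<beta> * b - (\<alpha> + \<beta> * r)\<bar>"
        unfolding Ga lb by (simp flip: abs_mult add: right_diff_distrib)
      have "\<bar>\<beta>\<bar> * \<bar>a - r\<bar> + \<bar>\<beta>\<bar> * \<bar>b - r\<bar> = \<bar>\<beta>\<bar> * \<bar>a - b\<bar>"
        using rab by (simp flip: distrib_left)
      then show "\<bar>\<alpha> + \<beta> * a - (\<alpha> + \<beta> * r)\<bar> + \<bar>\<alpha> + \<beta> * b - (\<alpha> + \<beta> * r)\<bar> = \<bar>\<alpha> + \<beta> * a - (\<alpha> + \<beta> * b)\<bar>"
        by (simp flip: abs_mult add: right_diff_distrib)
    qed
    then show ?thesis using lr by simp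
  qed
  \<comment> \<open>The component outside the hull does not contain the tip, so its constant value
    is carried to the tip by continuity.\<close>
  have const: "H (pt u i r) = H (pt u i (tip i))" if H: "is_linear_map f P H" and r: "tip i < r" "r \<le> 1" for H i r
  proof -
    have Ht: "continuous_on triod H" and Hc: "\<And>C. C \<in> components (triod - thull P) \<Longrightarrow> H constant_on C"
      using H by (auto simp: is_linear_map_def)
    have sub: "pt u i ` {tip i<..1} \<subseteq> triod - tree"
    proof safe
      fix s assume "s \<in> {tip i<..1}"
      then have s: "0 \<le> s" "tip i < s" "s \<le> 1" using tip_pos[of i] by auto
      show "pt u i s \<in> triod" using s by (intro pt_in_triod[OF frame])
      show False if "pt u i s \<in> tree" using pt_tree_le[OF s(1) that] s by simp
    qed
    have "connected (pt u i ` {tip i<..1})"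
      by (intro connected_continuous_image continuous_on_pt[OF frame] continuous_on_id connected_Ioc)
    moreover have "triod - tree \<noteq> {}" using sub r by (metis Diff_empty atLeastAtMost_iff empty_iff greaterThanAtMost_iff image_subset_iff)
    ultimately obtain C where C: "C \<in> components (triod - tree)" "pt u i ` {tip i<..1} \<subseteq> C"
      using exists_component_superset[OF sub] by blast
    then have "H constant_on C" using Hc[of C] by (simp add: thull_eq)
    then obtain c where c: "\<And>x. x \<in> C \<Longrightarrow> H x = c" unfolding constant_on_def by blast
    have cl: "closure {tip i<..1} = {tip i..1}" using r by (intro closure_greaterThanAtMost) auto
    have "continuous_on {tip i..1} (\<lambda>s. H (pt u i s))"
      by (rule continuous_on_compose2[OF Ht continuous_on_pt[OF frame continuous_on_id]])
        (use tip_pos[of i] in \<open>auto intro!: pt_in_triod[OF frame]\<close>)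
    then have "continuous_on (closure {tip i<..1}) (\<lambda>s. H (pt u i s))" unfolding cl .
    moreover have "\<And>s. s \<in> {tip i<..1} \<Longrightarrow> H (pt u i s) = c" using c C(2) by blast
    moreover have "tip i \<in> closure {tip i<..1}" unfolding cl using r by simp
    ultimately have "H (pt u i (tip i)) = c" by (rule continuous_constant_on_closure)
    moreover have "pt u i r \<in> C" using C(2) r by (meson greaterThanAtMost_iff image_eqI subsetD)
    then have "H (pt u i r) = c" by (rule c)
    ultimately show ?thesis by simp
  qed
  show "G x = F x"
  proof (cases "x \<in> triod")
    case True
    then obtain i r where r: "0 \<le> r" "r \<le> 1" "x = pt u i r" by (rule triod_cases[OF frame])
    show ?thesis
    proof (cases "r \<le> tip i")
      case True
      then show ?thesis using in_tree r by simp
    next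
      case False
      then have "G x = G (pt u i (tip i))" "F x = F (pt u i (tip i))" using const[OF G] const[OF F] r by simp_all
      then show ?thesis using in_tree[of "tip i" i] tip_pos[of i] by simp
    qed
  next
    case False
    then show ?thesis using Gt(1) Ft(1) by (metis PiE_arb)
  qed
qed

lemma linear_map_props:
  assumes "f 0 = 0" "\<And>x. x \<in> P \<Longrightarrow> f x \<in> triod"
  shows "is_linear_map f P (linear_map f P)"
    and "(i, a, b) \<in> basic \<Longrightarrow> \<exists>j k \<alpha> \<beta>. j \<noteq> k \<and> 
      (\<forall>r\<in>{a..b}. \<bar>\<alpha> + \<beta> * r\<bar> \<le> 1 \<and> linear_map f P (pt u i r) = line u j k (\<alpha> + \<beta> * r))"
proof -
  obtain F where F: "is_linear_map f P F" 
    and lin: "\<forall>(i, a, b)\<in>basic. \<exists>j k \<alpha> \<beta>. j \<noteq> k \<and> (\<forall>r\<in>{a..b}. \<bar>\<alpha> + \<beta> * r\<bar> \<le> 1 \<and> F (pt u i r) = line u j k (\<alpha> + \<beta> * r))"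
    using linear_map_exists[of f, OF assms] by blast
  have eq: "linear_map f P = F"
    unfolding linear_map_def using F linear_map_unique[OF F _ assms(1) lin] by (rule the_equality)
  show "is_linear_map f P (linear_map f P)" unfolding eq by (rule F)
  show "\<exists>j k \<alpha> \<beta>. j \<noteq> k \<and> (\<forall>r\<in>{a..b}. \<bar>\<alpha> + \<beta> * r\<bar> \<le> 1 \<and> linear_map f P (pt u i r) = line u j k (\<alpha> + \<beta> * r))"
    if "(i, a, b) \<in> basic" unfolding eq using lin that by blast
qed

end

section \<open>Topological exactness\<close>

lemma line_eq_pt:
  assumes "frame u" "j \<noteq> k" "0 \<le> c" "line u j k s = pt u j c"
  shows "s = c"
proof (cases "0 \<le> s")
  case True
  then show ?thesis using assms pt_eq_iff[OF assms(1) True assms(3)] line_simps(1)[OF assms(1) True] by simp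
next
  case False
  then have "pt u k (- s) = pt u j c" using assms line_simps(2)[OF assms(1), of s j k] by simp
  then show ?thesis using pt_eq_iff[OF assms(1), of "- s" c k j] False assms by simp
qed

locale markov = spread +
  fixes f F :: "complex \<Rightarrow> complex"
  assumes f_inj: "inj_on f P" and f_mem: "x \<in> P \<Longrightarrow> f x \<in> P"
    and F_0: "F 0 = 0" and F_P: "x \<in> P \<Longrightarrow> F x = f x" and F_cont: "continuous_on triod F"
    and F_lin: "(i, a, b) \<in> basic \<Longrightarrow> \<exists>j k \<alpha> \<beta>. j \<noteq> k \<and> 
      (\<forall>r\<in>{a..b}. \<bar>\<alpha> + \<beta> * r\<bar> \<le> 1 \<and> F (pt u i r) = line u j k (\<alpha> + \<beta> * r))"
begin

lemma F_node: "x \<in> insert 0 P \<Longrightarrow> F x \<in> insert 0 P"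
  using F_0 F_P f_mem by auto

lemma F_funpow_node: "x \<in> insert 0 P \<Longrightarrow> (F ^^ n) x \<in> insert 0 P"
  by (induction n) (auto simp: F_0 F_P f_mem)

lemma F_inj_node: "x \<in> insert 0 P \<Longrightarrow> y \<in> insert 0 P \<Longrightarrow> F x = F y \<Longrightarrow> x = y"
  using F_0 F_P f_mem inj_onD[OF f_inj] P_subset by (metis Diff_iff insert_iff subsetD)

text \<open>The slope \<beta> is nonzero because \<open>F\<close> is injective on P \<union> {0}, so
  that no basic arc collapses.\<close>

lemma basic_line:
  assumes "(i, a, b) \<in> basic"
  obtains j k \<alpha> \<beta> where "j \<noteq> k" "\<beta> \<noteq> 0" "\<And>r. r\<in>{a..b} \<Longrightarrow> \<bar>\<alpha> + \<beta> * r\<bar> \<le> 1"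
    "\<And>r. r\<in>{a..b} \<Longrightarrow> F (pt u i r) = line u j k (\<alpha> + \<beta> * r)"
    "line u j k (\<alpha> + \<beta> * a) \<in> insert 0 P" "line u j k (\<alpha> + \<beta> * b) \<in> insert 0 P"
proof -
  note b = basicD[OF assms]
  obtain j k \<alpha> \<beta> where jk: "j \<noteq> k" 
    and l: "\<And>r. r\<in>{a..b} \<Longrightarrow> \<bar>\<alpha> + \<beta> * r\<bar> \<le> 1" "\<And>r. r\<in>{a..b} \<Longrightarrow> F (pt u i r) = line u j k (\<alpha> + \<beta> * r)"
    using F_lin[OF assms] by blast
  have ab: "a \<in> {a..b}" "b \<in> {a..b}" using b by auto
  have n: "pt u i a \<in> insert 0 P" "pt u i b \<in> insert 0 P" using node_pt b by auto
  have "\<beta> \<noteq> 0"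
  proof
    assume "\<beta> = 0"
    then have "F (pt u i a) = F (pt u i b)" using l(2)[OF ab(1)] l(2)[OF ab(2)] by simp
    then have "pt u i a = pt u i b" by (rule F_inj_node[OF n])
    then show False using pt_eq_iff[OF frame, of a b i i] b by simp
  qed
  then show thesis using that[OF jk _ l] F_node[OF n(1)] F_node[OF n(2)] l(2)[OF ab(1)] l(2)[OF ab(2)] by simp
qed

lemma F_tree: "x \<in> tree \<Longrightarrow> F x \<in> tree"
proof -
  assume "x \<in> tree"
  then obtain i r where r: "0 \<le> r" "r \<le> tip i" "x = pt u i r" by (rule tree_cases)
  have node_tree: "y \<in> insert 0 P \<Longrightarrow> y \<in> tree" for y using P_tree zero_in_tree by auto
  show "F x \<in> tree"
  proof (cases "r = 0")
    case True
    then show ?thesis using r F_0 zero_in_tree pt_0[OF frame] by simp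
  next
    case False
    then have "0 < r" using r by simp
    from basic_below[OF this r(2)] obtain a b where ab: "(i, a, b) \<in> basic" "a < r" "r \<le> b" .
    obtain j k \<alpha> \<beta> where l: "j \<noteq> k" "\<beta> \<noteq> 0" "\<And>r. r\<in>{a..b} \<Longrightarrow> \<bar>\<alpha> + \<beta> * r\<bar> \<le> 1"
    "\<And>r. r\<in>{a..b} \<Longrightarrow> F (pt u i r) = line u j k (\<alpha> + \<beta> * r)"
    "line u j k (\<alpha> + \<beta> * a) \<in> insert 0 P" "line u j k (\<alpha> + \<beta> * b) \<in> insert 0 P" 
      by (rule basic_line[OF ab(1)]) (rule that)
    define q where "q = \<alpha> + \<beta> * r"
    \<comment> \<open>An affine function on an interval stays between its values at the ends,
      whatever the sign of \<beta>.\<close>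
    have q: "q \<le> \<alpha> + \<beta> * a \<or> q \<le> \<alpha> + \<beta> * b" "\<alpha> + \<beta> * a \<le> q \<or> \<alpha> + \<beta> * b \<le> q"
      using mult_left_mono[of r b \<beta>] mult_left_mono[of a r \<beta>] mult_left_mono_neg[of r b \<beta>] 
        mult_left_mono_neg[of a r \<beta>] ab(2,3) unfolding q_def by argo+
    have up: "line u j k q \<in> tree" if "line u j k s \<in> tree" "0 \<le> q" "q \<le> s" for s
    proof -
      have "s \<le> tip j" using that pt_tree_le[of s j] line_simps(1)[OF frame, of s] by simp
      then show ?thesis using that pt_in_tree[of q j] line_simps(1)[OF frame, of q] by simp
    qed
    have down: "line u j k q \<in> tree" if "line u j k s \<in> tree" "q \<le> 0" "s \<le> q" for s
    proof -
      have "- s \<le> tip k" using that pt_tree_le[of "- s" k] line_simps(2)[OF frame, of s] by simp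
      then show ?thesis using that pt_in_tree[of "- q" k] line_simps(2)[OF frame, of q] by simp
    qed
    have "line u j k q \<in> tree"
      using up down q node_tree l(5,6) by (cases "0 \<le> q") (auto intro: less_imp_le)
    then show ?thesis using l(4)[of r] ab r by (simp add: q_def)
  qed
qed

lemma funpow_image:
  assumes "connected S" "S \<subseteq> tree"
  shows "connected ((F ^^ n) ` S) \<and> (F ^^ n) ` S \<subseteq> tree"
proof (induction n)
  case 0
  then show ?case using assms by simp
next
  case (Suc n)
  have "(F ^^ Suc n) ` S = F ` (F ^^ n) ` S" by (simp add: image_comp)
  moreover have "continuous_on ((F ^^ n) ` S) F" using F_cont Suc tree_subset continuous_on_subset by blast
  ultimately show ?case using Suc F_tree connected_continuous_image[of "(F ^^ n) ` S" F] by auto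
qed

definition slope :: "3 \<Rightarrow> real \<Rightarrow> real \<Rightarrow> real" where
  "slope i a b = tdist (F (pt u i a)) (F (pt u i b)) / (b - a)"

text \<open>The image of a basic arc is a geodesic between points of P \<union> {0}. As it contains
  two points of another basic arc, which has no such points in its interior, it covers that arc
  completely. If moreover the lengths agree, it covers nothing else.\<close>

lemma basic_stretch:
  assumes ab: "(i, a, b) \<in> basic" and ab': "(i', a', b') \<in> basic"
    and cd: "c \<in> {a..b}" "d \<in> {a..b}" "c \<noteq> d" and cd': "c' \<in> {a'..b'}" "d' \<in> {a'..b'}"
    and Fc: "F (pt u i c) = pt u i' c'" and Fd: "F (pt u i d) = pt u i' d'"
  shows "0 < slope i a b" "\<bar>c' - d'\<bar> = slope i a b * \<bar>c - d\<bar>" "b' - a' \<le> slope i a b * (b - a)"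
    "b' - a' = slope i a b * (b - a) \<Longrightarrow> r \<in> {a..b} \<Longrightarrow> F (pt u i r) \<in> pt u i' ` {a'..b'}"
proof -
  note b = basicD[OF ab] and b' = basicD[OF ab']
  obtain j0 k0 \<alpha>0 \<beta>0 where l0: "j0 \<noteq> k0" "\<beta>0 \<noteq> 0" "\<And>r. r\<in>{a..b} \<Longrightarrow> \<bar>\<alpha>0 + \<beta>0 * r\<bar> \<le> 1"
    "\<And>r. r\<in>{a..b} \<Longrightarrow> F (pt u i r) = line u j0 k0 (\<alpha>0 + \<beta>0 * r)"
    "line u j0 k0 (\<alpha>0 + \<beta>0 * a) \<in> insert 0 P" "line u j0 k0 (\<alpha>0 + \<beta>0 * b) \<in> insert 0 P" 
    by (rule basic_line[OF ab]) (rule that)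
  have c0: "0 \<le> c'" "0 \<le> d'" using cd' b' by auto
  have ne: "c' > 0 \<or> d' > 0"
  proof (rule ccontr)
    assume "\<not> ?thesis"
    then have "line u j0 k0 (\<alpha>0 + \<beta>0 * c) = pt u j0 0" "line u j0 k0 (\<alpha>0 + \<beta>0 * d) = pt u j0 0"
      using c0 Fc Fd l0(4) cd pt_0[OF frame] by auto
    then have "\<alpha>0 + \<beta>0 * c = 0" "\<alpha>0 + \<beta>0 * d = 0" using line_eq_pt[OF frame l0(1)] by blast+
    then have "\<beta>0 * (c - d) = 0" unfolding right_diff_distrib by linarith
    then show False using l0 cd by simp
  qed
  have leg: "i' = j0 \<or> i' = k0" if "line u j0 k0 q = pt u i' e" "0 < e" for q e
    using that pt_eq_iff[OF frame, of q e j0 i'] pt_eq_iff[OF frame, of "- q" e k0 i'] line_simps[OF frame, of q j0 k0]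
    by (cases "0 \<le> q") auto
  have "i' = j0 \<or> i' = k0" using ne leg l0(4) cd Fc Fd by metis
  \<comment> \<open>The line carrying the image is reversed if necessary, so that its nonnegative
    parameters run along branch i'.\<close>
  then obtain k \<alpha> \<beta> where l: "i' \<noteq> k" "\<beta> \<noteq> 0" "\<And>r. r\<in>{a..b} \<Longrightarrow> \<bar>\<alpha> + \<beta> * r\<bar> \<le> 1"
    "\<And>r. r\<in>{a..b} \<Longrightarrow> F (pt u i r) = line u i' k (\<alpha> + \<beta> * r)"
    "line u i' k (\<alpha> + \<beta> * a) \<in> insert 0 P" "line u i' k (\<alpha> + \<beta> * b) \<in> insert 0 P"
  proof
    assume "i' = j0"
    then show thesis using that[of k0 \<beta>0 \<alpha>0] l0 by simp
  next
    assume i': "i' = k0"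
    have neg: "- \<alpha>0 + - \<beta>0 * r = - (\<alpha>0 + \<beta>0 * r)" for r by simp
    show thesis
    proof (rule that[of j0 "- \<beta>0" "- \<alpha>0"])
      show "\<bar>- \<alpha>0 + - \<beta>0 * r\<bar> \<le> 1" if "r \<in> {a..b}" for r unfolding neg abs_minus_cancel by (rule l0(3)[OF that])
      show "F (pt u i r) = line u i' j0 (- \<alpha>0 + - \<beta>0 * r)" if "r \<in> {a..b}" for r 
        unfolding neg i' line_swap[OF frame] by (rule l0(4)[OF that])
      show "line u i' j0 (- \<alpha>0 + - \<beta>0 * a) \<in> insert 0 P" "line u i' j0 (- \<alpha>0 + - \<beta>0 * b) \<in> insert 0 P"
        unfolding neg i' line_swap[OF frame] by (rule l0)+
    qed (use l0(1,2) i' in auto)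
  qed
  have ends: "a \<in> {a..b}" "b \<in> {a..b}" using b by auto
  have "tdist (F (pt u i a)) (F (pt u i b)) = \<bar>(\<alpha> + \<beta> * a) - (\<alpha> + \<beta> * b)\<bar>"
    unfolding l(4)[OF ends(1)] l(4)[OF ends(2)] by (rule tdist_line[OF frame l(3)[OF ends(1)] l(3)[OF ends(2)] l(1)])
  also have "\<dots> = \<bar>\<beta>\<bar> * (b - a)"
    using b(3) abs_mult[of \<beta> "a - b"] by (simp add: algebra_simps)
  finally have sl: "slope i a b = \<bar>\<beta>\<bar>" unfolding slope_def using b(3) by simp
  have c': "\<alpha> + \<beta> * c = c'" "\<alpha> + \<beta> * d = d'"
    using line_eq_pt[OF frame l(1) c0(1)] line_eq_pt[OF frame l(1) c0(2)] l(4)[OF cd(1)] l(4)[OF cd(2)] Fc Fd by simp_all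
  show "0 < slope i a b" using sl l by simp
  have "c' - d' = \<beta> * (c - d)" using c' by (simp add: algebra_simps)
  then show eq: "\<bar>c' - d'\<bar> = slope i a b * \<bar>c - d\<bar>" unfolding sl by (simp add: abs_mult)
  then have c'd': "c' \<noteq> d'" using sl l cd by auto
  define lo where "lo = min (\<alpha> + \<beta> * a) (\<alpha> + \<beta> * b)"
  define hi where "hi = max (\<alpha> + \<beta> * a) (\<alpha> + \<beta> * b)"
  have range: "lo \<le> \<alpha> + \<beta> * r \<and> \<alpha> + \<beta> * r \<le> hi" if "r \<in> {a..b}" for r
    using mult_left_mono[of r b \<beta>] mult_left_mono[of a r \<beta>] mult_left_mono_neg[of r b \<beta>] 
      mult_left_mono_neg[of a r \<beta>] that unfolding lo_def hi_def atLeastAtMost_iff by argo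
  have len: "hi - lo = slope i a b * (b - a)"
  proof (cases "0 \<le> \<beta>")
    case True
    then have "\<beta> * a \<le> \<beta> * b" using b(3) by (intro mult_left_mono) auto
    then show ?thesis unfolding sl using True by (simp add: lo_def hi_def algebra_simps)
  next
    case False
    then have "\<beta> * b \<le> \<beta> * a" using b(3) by (intro mult_left_mono_neg) auto
    then show ?thesis unfolding sl using False by (simp add: lo_def hi_def algebra_simps)
  qed
  have node: "s \<in> nodes i'" if "0 \<le> s" "line u i' k s \<in> insert 0 P" for s
    using pt_node[OF that(1)] that(2) line_simps(1)[OF frame that(1)] by metis
  have hi_mem: "line u i' k hi \<in> insert 0 P" and lo_mem: "line u i' k lo \<in> insert 0 P"
    using l(5,6) by (simp_all add: hi_def lo_def max_def min_def)
  \<comment> \<open>The upper end of the image is a node of branch i' beyond a', and there is none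
    strictly between a' and b'. The lower end is either such a node below b' or has a negative
    parameter, on the other branch.\<close>
  have "a' < hi" using range[OF cd(1)] range[OF cd(2)] c' cd' c'd' by auto
  then have hi: "b' \<le> hi" using node[OF _ hi_mem] b'(4,7) by (meson leD leI less_imp_le order_trans)
  have "lo < b'" using range[OF cd(1)] range[OF cd(2)] c' cd' c'd' by auto
  then have lo: "lo \<le> a'" using node[OF _ lo_mem] b'(4,7) by (meson leD leI less_imp_le order_trans)
  show "b' - a' \<le> slope i a b * (b - a)" using lo hi len by linarith
  show "F (pt u i r) \<in> pt u i' ` {a'..b'}" if "b' - a' = slope i a b * (b - a)" and r: "r \<in> {a..b}"
  proof -
    have "lo = a'" "hi = b'" using that(1) lo hi len by linarith+
    then have "\<alpha> + \<beta> * r \<in> {a'..b'}" using range[OF r] by simp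
    then show ?thesis using l(4)[OF r] line_simps(1)[OF frame, of "\<alpha> + \<beta> * r" i' k] b'(4) by auto
  qed
qed

section \<open>From stretching to exactness\<close>

definition common :: "complex \<Rightarrow> complex \<Rightarrow> bool" where
  "common x y \<longleftrightarrow> (\<exists>i a b r s. (i, a, b) \<in> basic \<and> r \<in> {a..b} \<and> s \<in> {a..b} \<and> x = pt u i r \<and> y = pt u i s)"

text \<open>The combinatorial half of exactness, for connected sets that already contain two points
  of P \<union> {0}. The metric half, that every nondegenerate connected subset of the hull comes to
  contain two such points, is the content of \<open>exactI\<close>.\<close>

definition spreading :: bool where
  "spreading \<longleftrightarrow> (\<forall>S. connected S \<and> S \<subseteq> tree \<and> (\<exists>x\<in>S. \<exists>y\<in>S. x \<in> insert 0 P \<and> y \<in> insert 0 P \<and> x \<noteq> y) \<longrightarrow>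
    (\<exists>n. (F ^^ n) ` S = tree))"

lemma spreadingD:
  assumes spreading "connected S" "S \<subseteq> tree" "x \<in> S" "y \<in> S" "x \<in> insert 0 P" "y \<in> insert 0 P" "x \<noteq> y"
  shows "\<exists>n. (F ^^ n) ` S = tree"
  using assms unfolding spreading_def by blast

text \<open>As long as two points share basic intervals, the fraction of the interval that they span does not
  decrease, and it grows by one of finitely many factors whenever a basic interval is mapped onto more than
  one. Hence from some time on the basic intervals are mapped onto each other, which \<open>spreading\<close> excludes.\<close>

lemma escape:
  assumes spreading
    and ne0: "x \<noteq> y"
  shows "\<exists>n. \<not> common ((F ^^ n) x) ((F ^^ n) y)"
proof (rule ccontr)
  assume "\<not> ?thesis"
  then have "\<forall>n. \<exists>i a b r s. (i, a, b) \<in> basic \<and> r \<in> {a..b} \<and> s \<in> {a..b} \<and> (F ^^ n) x = pt u i r \<and> (F ^^ n) y = pt u i s"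
    unfolding common_def by blast
  then obtain i a b r s where B: "\<And>n. (i n, a n, b n) \<in> basic" "\<And>n. r n \<in> {a n..b n}" "\<And>n. s n \<in> {a n..b n}"
    and xy: "\<And>n. (F ^^ n) x = pt u (i n) (r n)" "\<And>n. (F ^^ n) y = pt u (i n) (s n)"
    by metis
  have Fr: "F (pt u (i n) (r n)) = pt u (i (Suc n)) (r (Suc n))" for n using xy(1)[of n] xy(1)[of "Suc n"] by simp
  have Fs: "F (pt u (i n) (s n)) = pt u (i (Suc n)) (s (Suc n))" for n using xy(2)[of n] xy(2)[of "Suc n"] by simp
  note st = basic_stretch[OF B(1) B(1) B(2) B(3) _ B(2) B(3) Fr Fs]
  have ne: "r n \<noteq> s n" for n
  proof (induction n)
    case 0
    then show ?case using xy(1)[of 0] xy(2)[of 0] ne0 by auto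
  next
    case (Suc n)
    have "0 < slope (i n) (a n) (b n) * \<bar>r n - s n\<bar>" using st(1)[OF Suc] Suc by simp
    then show ?case using st(2)[OF Suc] by auto
  qed
  note st = st[OF ne]
  define len where "len n = b n - a n" for n
  define sl where "sl n = slope (i n) (a n) (b n)" for n
  define \<rho> where "\<rho> n = sl n * len n / len (Suc n)" for n
  define lam where "lam n = \<bar>r n - s n\<bar> / len n" for n
  have len: "0 < len n" for n using basicD(3)[OF B(1), of n] by (simp add: len_def)
  have \<rho>1: "1 \<le> \<rho> n" for n using st(3)[of n] len[of "Suc n"] by (simp add: \<rho>_def len_def sl_def)
  have lam_step: "lam (Suc n) = lam n * \<rho> n" for n
    using st(2)[of n] len[of n] by (simp add: lam_def \<rho>_def sl_def)
  have lam_pos: "0 < lam n" for n using ne[of n] len[of n] by (simp add: lam_def)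
  have lam_le: "lam n \<le> 1" for n using B(2,3)[of n] len[of n] by (auto simp: lam_def len_def)
  have "lam n \<le> lam (Suc n)" for n
    unfolding lam_step using mult_left_mono[OF \<rho>1[of n], of "lam n"] lam_pos[of n] by simp
  then have "incseq lam" by (rule incseq_SucI)
  then obtain l where l: "lam \<longlonglongrightarrow> l" "\<forall>n. lam n \<le> l" using incseq_convergent lam_le by metis
  have l0: "0 < l" using l(2) lam_pos[of 0] by (meson less_le_trans)
  \<comment> \<open>The spanned fractions increase to a positive limit, so their quotients \<rho>
    tend to 1. Since \<rho> takes values in the finite set R, it must equal 1 from some time
    on.\<close>
  have "(\<lambda>n. lam (Suc n) / lam n) \<longlonglongrightarrow> l / l"
    by (intro tendsto_divide LIMSEQ_Suc l) (use l0 in simp)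
  moreover have "(\<lambda>n. lam (Suc n) / lam n) = \<rho>" using lam_step lam_pos by (auto simp: fun_eq_iff) (metis less_irrefl)
  ultimately have \<rho>: "\<rho> \<longlonglongrightarrow> 1" using l0 by simp
  define R where "R = (\<lambda>((i, a, b), (i', a', b')). slope i a b * (b - a) / (b' - a')) ` (basic \<times> basic)"
  have "finite R" unfolding R_def using finite_basic by simp
  have \<rho>R: "\<rho> n \<in> R" for n
    unfolding R_def by (rule image_eqI[of _ _ "((i n, a n, b n), (i (Suc n), a (Suc n), b (Suc n)))"])
      (use B(1) in \<open>auto simp: \<rho>_def sl_def len_def\<close>)
  have "open (- (R - {1}))" using \<open>finite R\<close> by (intro open_Compl finite_imp_closed) simp
  then have "\<forall>\<^sub>F n in sequentially. \<rho> n \<in> - (R - {1})" by (rule topological_tendstoD[OF \<rho>]) simp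
  then obtain N where "\<forall>n\<ge>N. \<rho> n \<in> - (R - {1})" by (auto simp: eventually_sequentially)
  then have \<rho>N: "\<rho> n = 1" if "N \<le> n" for n using \<rho>R[of n] that by auto
  define seg where "seg n = pt u (i n) ` {a n..b n}" for n
  have step: "F ` seg n \<subseteq> seg (Suc n)" if "N \<le> n" for n
  proof -
    have "sl n * len n = len (Suc n)" using \<rho>N[OF that] len[of "Suc n"] by (simp add: \<rho>_def)
    then have "b (Suc n) - a (Suc n) = slope (i n) (a n) (b n) * (b n - a n)" by (simp add: sl_def len_def)
    from st(4)[OF this] show ?thesis unfolding seg_def by blast
  qed
  have it: "(F ^^ t) ` seg N \<subseteq> seg (N + t)" for t
  proof (induction t)
    case 0
    then show ?case by simp
  next
    case (Suc t)
    have "(F ^^ Suc t) ` seg N = F ` (F ^^ t) ` seg N" by (simp add: image_comp)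
    also have "\<dots> \<subseteq> F ` seg (N + t)" using Suc by (rule image_mono)
    also have "\<dots> \<subseteq> seg (Suc (N + t))" by (rule step) simp
    finally show ?case by simp
  qed
  note bN = basicD[OF B(1)[of N]]
  have "seg N \<subseteq> tree" unfolding seg_def using bN pt_in_tree by auto
  moreover have "connected (seg N)" unfolding seg_def by (rule connected_leg)
  moreover have "pt u (i N) (a N) \<in> seg N" "pt u (i N) (b N) \<in> seg N" unfolding seg_def using bN(3) by auto
  moreover have "pt u (i N) (a N) \<noteq> pt u (i N) (b N)" using bN(3,4) pt_eq_iff[OF frame, of "a N" "b N" "i N" "i N"] by simp
  ultimately obtain n where "(F ^^ n) ` seg N = tree" using spreadingD[OF assms(1)] node_pt[OF bN(1)] node_pt[OF bN(2)] by meson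
  then have sub: "tree \<subseteq> seg (N + n)" using it[of n] by simp
  define j where "j = i (N + n) + 1"
  have "pt u j (tip j) \<in> seg (N + n)" using sub pt_in_tree[of "tip j" j] tip_pos[of j] by auto
  then obtain q where q: "q \<in> {a (N + n)..b (N + n)}" "pt u j (tip j) = pt u (i (N + n)) q" unfolding seg_def by blast
  have "0 \<le> q" using q basicD(4)[OF B(1), of "N + n"] by auto
  then have "j = i (N + n)" using pt_eq_iff[OF frame, of "tip j" q j "i (N + n)"] q tip_pos[of j] by auto
  then show False using neq_add_1_3[of "i (N + n)"] by (simp add: j_def)
qed

lemma common_refl: "x \<in> tree \<Longrightarrow> common x x"
proof -
  assume "x \<in> tree"
  then obtain i r where r: "0 \<le> r" "r \<le> tip i" "x = pt u i r" by (rule tree_cases)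
  obtain a b where "(i, a, b) \<in> basic" "a \<le> r" "r \<le> b"
  proof (cases "r = 0")
    case True
    then show thesis using basic_above[of r i] r tip_pos[of i] that by (metis less_imp_le)
  next
    case False
    then have "0 < r" using r by simp
    then show thesis using basic_below[of r i] r that by (metis less_imp_le)
  qed
  then have "(i, a, b) \<in> basic \<and> r \<in> {a..b} \<and> r \<in> {a..b} \<and> x = pt u i r \<and> x = pt u i r" using r by simp
  then show "common x x" unfolding common_def by blast
qed

text \<open>On one leg, the node is the first one met strictly beyond x in the direction of y, which
  keeps it different from x even if x is itself a node. On different legs the branching point
  serves.\<close>

lemma not_common_node:
  assumes S: "connected S" "S \<subseteq> tree" "x \<in> S" "y \<in> S" and nc: "\<not> common x y"
  shows "\<exists>v\<in>S. v \<in> insert 0 P \<and> v \<noteq> x"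
proof -
  have St: "S \<subseteq> triod" using S(2) tree_subset by blast
  have ne: "x \<noteq> y" using nc common_refl S by blast
  have leg: ?thesis if r: "0 \<le> r" "r \<le> tip i" "x = pt u i r" and s: "0 \<le> s" "s \<le> tip i" "y = pt u i s" for i r s
  proof (cases "r < s")
    case True
    then have "r < tip i" using s by simp
    from basic_above[OF r(1) this] obtain a b where ab: "(i, a, b) \<in> basic" "a \<le> r" "r < b" .
    have "b < s"
    proof (rule ccontr)
      assume "\<not> b < s"
      then have "(i, a, b) \<in> basic \<and> r \<in> {a..b} \<and> s \<in> {a..b} \<and> x = pt u i r \<and> y = pt u i s" using ab True r s by simp
      then show False using nc unfolding common_def by blast
    qed
    then have "pt u i b \<in> S" using connected_contains_between[OF frame S(1) St, of i r s b] S(3,4) r s ab by simp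
    moreover have "pt u i b \<noteq> x" using pt_eq_iff[OF frame, of b r i i] r ab by simp
    ultimately show ?thesis using node_pt[OF basicD(2)[OF ab(1)]] by blast
  next
    case False
    moreover have "r \<noteq> s" using ne r(3) s(3) by metis
    ultimately have "s < r" by simp
    then have "0 < r" using s by simp
    from basic_below[OF this r(2)] obtain a b where ab: "(i, a, b) \<in> basic" "a < r" "r \<le> b" .
    have "s < a"
    proof (rule ccontr)
      assume "\<not> s < a"
      then have "(i, a, b) \<in> basic \<and> r \<in> {a..b} \<and> s \<in> {a..b} \<and> x = pt u i r \<and> y = pt u i s" using ab \<open>s < r\<close> r s by simp
      then show False using nc unfolding common_def by blast
    qed
    then have "pt u i a \<in> S" using connected_contains_between[OF frame S(1) St, of i s r a] S(3,4) r s ab by simp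
    moreover have "pt u i a \<noteq> x" using pt_eq_iff[OF frame, of a r i i] r ab basicD(4)[OF ab(1)] by simp
    ultimately show ?thesis using node_pt[OF basicD(1)[OF ab(1)]] by blast
  qed
  obtain i r where r: "0 \<le> r" "r \<le> tip i" "x = pt u i r" using tree_cases S by blast
  obtain k s where s: "0 \<le> s" "s \<le> tip k" "y = pt u k s" using tree_cases S by blast
  consider "i = k" | "r = 0" | "s = 0" | "i \<noteq> k" "0 < r" "0 < s" using r s by fastforce
  then show ?thesis
  proof cases
    case 1
    then show ?thesis using leg r s by simp
  next
    case 2
    then show ?thesis using leg[of 0 k s] r s pt_0[OF frame] tip_pos[of k] by simp
  next
    case 3
    then show ?thesis using leg[of r i 0] r s pt_0[OF frame] tip_pos[of i] by simp
  next
    case 4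
    have "idx u x = i" "idx u y = k" using r s 4 idx_pt[OF frame] tip_le_1 order_trans by metis+
    moreover have "x \<noteq> 0" "y \<noteq> 0" using r s 4 pt_eq_0_iff[OF frame] by auto
    ultimately have "0 \<in> S" using connected_contains_0[OF frame S(1) St S(3,4)] 4 by simp
    then show ?thesis using \<open>x \<noteq> 0\<close> by auto
  qed
qed

lemma funpow_image_add: "(F ^^ n) ` ((F ^^ m) ` S) = (F ^^ (n + m)) ` S"
  by (simp add: funpow_add image_comp)

text \<open>\<open>escape\<close> is applied twice. First two points of the set are separated, which
  puts a node v into an image. Then v and the image of x are separated, which yields a second node,
  different from the image of v; that image is again a node.\<close>

lemma exactI:
  assumes spr: spreading
  shows "topologically_exact_on tree F"
proof -
  have main: "\<exists>n. (F ^^ n) ` S = tree" if S: "connected S" "S \<subseteq> tree" "x \<in> S" "y \<in> S" "x \<noteq> y" for S x y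
  proof -
    obtain m where m: "\<not> common ((F ^^ m) x) ((F ^^ m) y)" using escape[OF spr S(5)] by blast
    define T where "T = (F ^^ m) ` S"
    have T: "connected T" "T \<subseteq> tree" using funpow_image[OF S(1,2)] by (simp_all add: T_def)
    have xT: "(F ^^ m) x \<in> T" "(F ^^ m) y \<in> T" using S by (simp_all add: T_def)
    obtain v where v: "v \<in> T" "v \<in> insert 0 P" "v \<noteq> (F ^^ m) x"
      using not_common_node[OF T xT m] by blast
    obtain k where k: "\<not> common ((F ^^ k) v) ((F ^^ k) ((F ^^ m) x))" using escape[OF spr v(3)] by blast
    define R where "R = (F ^^ k) ` T"
    have R: "connected R" "R \<subseteq> tree" using funpow_image[OF T] by (simp_all add: R_def)
    have vR: "(F ^^ k) v \<in> R" "(F ^^ k) ((F ^^ m) x) \<in> R" using v xT by (simp_all add: R_def)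
    obtain w where w: "w \<in> R" "w \<in> insert 0 P" "w \<noteq> (F ^^ k) v"
      using not_common_node[OF R vR k] by blast
    obtain n where "(F ^^ n) ` R = tree"
      using spreadingD[OF spr R w(1) vR(1) w(2) F_funpow_node[OF v(2)] w(3)] by blast
    then have "(F ^^ (n + (k + m))) ` S = tree" unfolding R_def T_def funpow_image_add .
    then show ?thesis by blast
  qed
  show ?thesis unfolding topologically_exact_on_def
  proof (intro allI impI)
    fix U assume U: "openin (top_of_set tree) U \<and> U \<noteq> {}"
    then obtain T where T: "open T" "U = tree \<inter> T" by (auto simp: openin_open)
    obtain x where x: "x \<in> U" using U by auto
    then obtain i r where r: "0 \<le> r" "r \<le> tip i" "x = pt u i r" using T tree_cases by blast
    obtain e where e: "0 < e" "ball x e \<subseteq> T" using T x open_contains_ball by (metis IntD2)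
    \<comment> \<open>A second point of the same leg near x, taken towards the tip if there is room
      and towards the branching point otherwise.\<close>
    define s where "s = (if r < tip i then min (tip i) (r + e / 2) else max 0 (r - e / 2))"
    have s: "0 \<le> s" "s \<le> tip i" "s \<noteq> r" "\<bar>s - r\<bar> < e"
      using r e tip_pos[of i] by (auto simp: s_def min_def max_def)
    define S where "S = pt u i ` {min r s..max r s}"
    have "connected S" unfolding S_def by (rule connected_leg)
    have "S \<subseteq> U"
    proof
      fix z assume "z \<in> S"
      then obtain q where q: "min r s \<le> q" "q \<le> max r s" "z = pt u i q" by (auto simp: S_def)
      have "z \<in> tree" using q r s by (auto intro!: pt_in_tree)
      moreover have "dist x z = \<bar>r - q\<bar>"
        using r(3) q(3) by (simp add: dist_norm pt_def flip: left_diff_distrib of_real_diff add: norm_mult frame_norm[OF frame])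
      then have "z \<in> ball x e" using q s by (auto simp: min_def max_def split: if_splits)
      ultimately show "z \<in> U" using T e by auto
    qed
    then have "S \<subseteq> tree" using T by auto
    have xs: "x \<in> S" "pt u i s \<in> S" using r(3) by (auto simp: S_def)
    have "x \<noteq> pt u i s" using pt_eq_iff[OF frame r(1) s(1), of i i] s r by auto
    from main[OF \<open>connected S\<close> \<open>S \<subseteq> tree\<close> xs this] obtain n where n: "(F ^^ n) ` S = tree" ..
    have "(F ^^ n) ` U \<subseteq> tree" using funpow_image[OF connected_tree order_refl, of n] T by blast
    then have "(F ^^ n) ` U = tree" using n image_mono[OF \<open>S \<subseteq> U\<close>, of "F ^^ n"] by auto
    then show "\<exists>n. (F ^^ n) ` U = tree" by blast
  qed
qed

end

lemma of_nat_3_mult: "of_nat (3 * n) = (0 :: 3)"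
proof -
  have "of_nat (3 * n) = (3 :: 3) * of_nat n" by (simp only: of_nat_mult of_nat_numeral)
  also have "(3 :: 3) = 0" by simp
  finally show ?thesis by simp
qed

lemma ex_of_nat_3: "\<exists>k. l + of_nat k = (0 :: 3)"
proof (cases l rule: cases_3)
  case 1
  then show ?thesis by (intro exI[of _ 0]) simp
next
  case 2
  then show ?thesis by (intro exI[of _ 2]) simp
next
  case 3
  then show ?thesis by (intro exI[of _ 1]) simp
qed

section \<open>Exactness of oriented cycles\<close>

sublocale oriented_cycle \<subseteq> spread u P
proof
  show "P \<subseteq> triod - {0}" using cyc by (simp add: cycle_def)
  show "\<exists>x\<in>P. idx u x = j" for j using p_mem p_idx by blast
qed (rule frame finite_P)+

context oriented_cycle
begin

lemma f_inj: "inj_on f P"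
proof (rule eq_card_imp_inj_on[OF finite_P])
  have "f ` P = P"
  proof
    show "f ` P \<subseteq> P" using memD(3) by auto
    show "P \<subseteq> f ` P"
    proof
      fix x assume x: "x \<in> P"
      have "(f ^^ Suc (card P - 1)) x = x" using cyclic_on_period(1,2)[OF cyclic x] by simp
      then have "x = f ((f ^^ (card P - 1)) x)" by simp
      then show "x \<in> f ` P" using funpow_mem[OF x] by blast
    qed
  qed
  then show "card (f ` P) = card P" by simp
qed

lemma f_0: "f 0 = 0" using triod_mapsD(3)[OF reg_triod_map[OF frame reg]] .

lemma f_triod: "x \<in> P \<Longrightarrow> f x \<in> triod" using memD(1) memD(3) by blast

lemma markov: "markov u P f (linear_map f P)"
proof -
  note lm = linear_map_props[of f, OF f_0 f_triod]
  show ?thesis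
  proof
    show "linear_map f P 0 = 0" "continuous_on triod (linear_map f P)" 
      using lm(1) by (simp_all add: is_linear_map_def)
    show "linear_map f P x = f x" if "x \<in> P" for x using lm(1) that by (simp add: is_linear_map_def)
  qed (use lm(2) f_inj memD(3) in auto)
qed

end

sublocale oriented_cycle \<subseteq> markov u P f "linear_map f P"
  by (rule markov)

context oriented_cycle
begin

abbreviation F :: "complex \<Rightarrow> complex" where "F \<equiv> linear_map f P"

lemma F_funpow: "x \<in> P \<Longrightarrow> (F ^^ t) x = (f ^^ t) x"
  by (induction t) (simp_all add: F_P funpow_mem)

lemma contains_nearest:
  assumes "connected S" "S \<subseteq> tree" "0 \<in> S" "x \<in> S" "x \<in> P"
  shows "p (idx u x) \<in> S"
proof -
  have St: "S \<subseteq> triod" using assms tree_subset by blast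
  have "pt u (idx u x) (cmod (p (idx u x))) \<in> S"
    using connected_contains_between[OF frame assms(1) St, of "idx u x" 0 "cmod x" "cmod (p (idx u x))"]
      assms pt_0[OF frame] pt_idx[OF frame memD(1,2)[OF assms(5)]] p_nearest[OF assms(5)] by simp
  then show ?thesis using pt_idx[OF frame memD(1,2)[OF p_mem]] p_idx by metis
qed

text \<open>A connected set containing 0 and a point of the cycle contains the nearest point on that
  branch. Nearest points are passed on by rotation, so what counts is the branch relative to a frame
  rotating by one branch per step. An orbit that deviates from rotation shifts this relative branch
  by some \<epsilon> \<noteq> 0, and since \<epsilon> generates the residues mod 3, all nearest
  points are eventually present.\<close>

lemma spreading_zero:
  assumes nontriv: "\<exists>x\<in>P. rot x \<noteq> 1" and S: "connected S" "S \<subseteq> tree" "0 \<in> S" and x: "x \<in> S" "x \<in> P"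
  shows "\<exists>n. (F ^^ n) ` S = tree"
proof -
  define has where "has n j \<longleftrightarrow> p j \<in> (F ^^ n) ` S" for n j
  note Sn = funpow_image[OF S(1,2)]
  have Sn0: "0 \<in> (F ^^ n) ` S" for n
  proof -
    have "(F ^^ n) 0 = 0" by (induction n) (simp_all add: F_0)
    then show ?thesis using S(3) by (metis image_eqI)
  qed
  have shift: "(f ^^ t) y \<in> (F ^^ (n + t)) ` S" if "y \<in> P" "y \<in> (F ^^ n) ` S" for y n t
  proof -
    have "(F ^^ t) y \<in> (F ^^ t) ` (F ^^ n) ` S" using that by blast
    then show ?thesis using funpow_image_add F_funpow[OF that(1)] by (metis add.commute)
  qed
  have has_orbit: "has (n + t) (idx u ((f ^^ t) (p j)))" if "has n j" for n t j
    using shift[OF p_mem, of j n t] that contains_nearest[OF _ _ Sn0 _ funpow_mem[OF p_mem]] Sn unfolding has_def by blast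
  have has_Suc: "has (Suc n) (j + 1)" if "has n j" for n j
    using has_orbit[OF that, of 1] by (simp add: p_image)
  have has_add: "has (n + t) (j + of_nat t)" if "has n j" for n t j
  proof (induction t)
    case (Suc t)
    have "has (Suc (n + t)) (j + of_nat t + 1)" by (rule has_Suc[OF Suc])
    moreover have "j + of_nat t + 1 = j + of_nat (Suc t)" by simp
    ultimately show ?case by (metis add_Suc_right)
  qed (use that in simp)
  \<comment> \<open>The relative branch l is occupied at some time; by rotation it is then occupied
    at all later times.\<close>
  define T where "T l \<longleftrightarrow> (\<exists>n. has n (l + of_nat n))" for l
  have T_ev: "\<exists>N. \<forall>n\<ge>N. has n (l + of_nat n)" if Tl: "T l" for l
  proof -
    obtain N where N: "has N (l + of_nat N)" using Tl unfolding T_def by blast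
    have "has n (l + of_nat n)" if "N \<le> n" for n
      using has_add[OF N, of "n - N"] that by (simp add: add.assoc flip: of_nat_add)
    then show ?thesis by blast
  qed
  obtain t where t: "idx u ((f ^^ t) (p 0)) \<noteq> of_nat t"
  proof (rule ccontr)
    assume "\<not> thesis"
    then have all: "idx u ((f ^^ t) (p 0)) = of_nat t" for t using that by blast
    obtain y where y: "y \<in> P" "rot y \<noteq> 1" using nontriv by blast
    then obtain t where "y = (f ^^ t) (p 0)"
      using cyclic_on_period(3)[OF cyclic p_mem[of 0]] by (auto simp: bij_betw_def)
    then have "rot y = 1" using all[of t] all[of "Suc t"] by (simp add: turn_def)
    then show False using y by simp
  qed
  define \<epsilon> where "\<epsilon> = idx u ((f ^^ t) (p 0)) - of_nat t"
  have T_step: "T (l + \<epsilon>)" if Tl: "T l" for l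
  proof -
    obtain N where N: "\<And>n. N \<le> n \<Longrightarrow> has n (l + of_nat n)" using T_ev[OF Tl] by blast
    obtain k where k: "l + of_nat k = 0" using ex_of_nat_3 by blast
    \<comment> \<open>A time beyond N at which the relative branch l coincides with branch 0, where
      the deviation \<epsilon> was measured.\<close>
    define n where "n = 3 * N + k"
    have ln: "l + of_nat n = 0" using k of_nat_3_mult[of N] by (simp only: n_def of_nat_add) simp
    have "has n 0" using N[of n] ln by (simp add: n_def)
    then have "has (n + t) (idx u ((f ^^ t) (p 0)))" by (rule has_orbit)
    moreover have "idx u ((f ^^ t) (p 0)) = (l + \<epsilon>) + of_nat (n + t)"
    proof -
      have "(l + \<epsilon>) + of_nat (n + t) = (l + of_nat n) + (\<epsilon> + of_nat t)" by (simp add: algebra_simps)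
      also have "\<dots> = idx u ((f ^^ t) (p 0))" unfolding ln \<epsilon>_def by simp
      finally show ?thesis ..
    qed
    ultimately show ?thesis unfolding T_def by metis
  qed
  have "has 0 (idx u x)" unfolding has_def using contains_nearest[OF S x] by simp
  then have T0: "T (idx u x)" unfolding T_def by (intro exI[of _ 0]) simp
  have "\<epsilon> \<noteq> 0" using t by (simp add: \<epsilon>_def)
  then have "card {idx u x, idx u x + \<epsilon>, idx u x + \<epsilon> + \<epsilon>} = CARD(3)"
    by (cases \<epsilon> rule: cases_3; cases "idx u x" rule: cases_3) simp_all
  then have all: "{idx u x, idx u x + \<epsilon>, idx u x + \<epsilon> + \<epsilon>} = UNIV" by (intro card_subset_eq) auto
  have "T l" for l
  proof -
    have "l \<in> {idx u x, idx u x + \<epsilon>, idx u x + \<epsilon> + \<epsilon>}" unfolding all by simp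
    moreover have "T (idx u x + \<epsilon>)" "T (idx u x + \<epsilon> + \<epsilon>)" using T_step T0 by blast+
    ultimately show ?thesis using T0 by (metis empty_iff insert_iff)
  qed
  then have "\<forall>l. \<exists>N. \<forall>n\<ge>N. has n (l + of_nat n)" using T_ev by blast
  then obtain N where N: "\<And>l n. N l \<le> n \<Longrightarrow> has n (l + of_nat n)" by metis
  define M where "M = N 0 + N 1 + N 2"
  have NM: "N l \<le> M" for l by (cases l rule: cases_3) (simp_all add: M_def)
  have hasM: "has n j" if "M \<le> n" for n j
  proof -
    have "N (j - of_nat n) \<le> n" using NM that order_trans by blast
    from N[OF this] show ?thesis by simp
  qed
  \<comment> \<open>A point reached from \<open>p 0\<close> in t < card P steps is present at time M
    + card P, because \<open>p 0\<close> is present t steps earlier, which is still after M.\<close>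
  have "P \<subseteq> (F ^^ (M + card P)) ` S"
  proof
    fix y assume "y \<in> P"
    then obtain t where t: "t < card P" "y = (f ^^ t) (p 0)"
      using cyclic_on_period(3)[OF cyclic p_mem[of 0]] by (auto simp: bij_betw_def)
    have "p 0 \<in> (F ^^ (M + card P - t)) ` S" using hasM[of "M + card P - t" 0] t by (simp add: has_def)
    from shift[OF p_mem this, of t] show "y \<in> (F ^^ (M + card P)) ` S" using t by simp
  qed
  then have "tree \<subseteq> (F ^^ (M + card P)) ` S" using tree_least Sn tree_subset by (meson order_trans)
  then show ?thesis using Sn by blast
qed

text \<open>Two points of the cycle with different itineraries are at some time on different
  branches, so the image of a connected set containing both then contains 0 and
  \<open>spreading_zero\<close> applies.\<close>

lemma exactness:
  assumes nontriv: "\<exists>x\<in>P. rot x \<noteq> 1"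
    and separated: "\<And>x y. x \<in> P \<Longrightarrow> y \<in> P \<Longrightarrow> x \<noteq> y \<Longrightarrow> \<exists>t. idx u ((f ^^ t) x) \<noteq> idx u ((f ^^ t) y)"
  shows "exact_cycle f P"
proof -
  have "topologically_exact_on tree F"
  proof (rule exactI, unfold spreading_def, intro allI impI, elim conjE bexE)
    fix S x y
    assume S: "connected S" "S \<subseteq> tree" "x \<in> S" "y \<in> S" "x \<in> insert 0 P" "y \<in> insert 0 P" "x \<noteq> y"
    show "\<exists>n. (F ^^ n) ` S = tree"
    proof (cases "x = 0 \<or> y = 0")
      case True
      then show ?thesis using spreading_zero[OF nontriv S(1,2)] S by blast
    next
      case False
      then have xy: "x \<in> P" "y \<in> P" using S by auto
      obtain t where t: "idx u ((f ^^ t) x) \<noteq> idx u ((f ^^ t) y)" using separated[OF xy S(7)] by blast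
      define T where "T = (F ^^ t) ` S"
      have T: "connected T" "T \<subseteq> tree" using funpow_image[OF S(1,2)] by (simp_all add: T_def)
      have m: "(f ^^ t) x \<in> T" "(f ^^ t) y \<in> T" using S F_funpow xy unfolding T_def by (metis image_eqI)+
      have "T \<subseteq> triod" using T tree_subset by blast
      then have "0 \<in> T" 
        using connected_contains_0[OF frame T(1) _ m memD(2)[OF funpow_mem[OF xy(1)]] memD(2)[OF funpow_mem[OF xy(2)]] t] by blast
      then obtain n where "(F ^^ n) ` T = tree" using spreading_zero[OF nontriv T _ m(1) funpow_mem[OF xy(1)]] by blast
      then have "(F ^^ (n + t)) ` S = tree" unfolding T_def funpow_image_add .
      then show ?thesis by blast
    qed
  qed
  then show ?thesis unfolding exact_cycle_def thull_eq using cyc by simp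
qed

text \<open>If every point of the cycle rotates by one branch, then so does its linear map, and the images of a
  set in a single branch stay in single branches.\<close>

lemma exact_nontrivial:
  assumes "exact_cycle f P"
  shows "\<exists>x\<in>P. rot x \<noteq> 1"
proof (rule ccontr)
  assume "\<not> ?thesis"
  then have triv: "idx u (f x) = idx u x + 1" if "x \<in> P" for x using that by (auto simp: turn_def algebra_simps)
  define leg where "leg i = pt u i ` {0..tip i}" for i
  have leg_image: "F x \<in> leg (i + 1)" if x: "x \<in> leg i" for x i
  proof -
    obtain r where r: "0 \<le> r" "r \<le> tip i" "x = pt u i r" using x by (auto simp: leg_def)
    have node: "\<exists>s. 0 \<le> s \<and> F (pt u i r) = pt u (i + 1) s \<and> (0 < r \<longrightarrow> 0 < s)" if rn: "r \<in> nodes i" for r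
    proof (cases "r = 0")
      case True
      then show ?thesis using F_0 pt_0[OF frame] by (intro exI[of _ 0]) simp
    next
      case False
      then have m: "pt u i r \<in> P" using node_mem[OF rn] by simp
      have "0 < r" "r \<le> 1" using nodes_bounds[OF rn] False by auto
      then have "idx u (f (pt u i r)) = i + 1" using triv[OF m] idx_pt[OF frame] by simp
      then have "F (pt u i r) = pt u (i + 1) (cmod (f (pt u i r)))"
        using pt_idx[OF frame memD(1,2)[OF memD(3)[OF m]]] F_P[OF m] by simp
      then show ?thesis using memD(4)[OF m] by (intro exI[of _ "cmod (f (pt u i r))"]) simp
    qed
    have "\<exists>q\<ge>0. F x = pt u (i + 1) q"
    proof (cases "r = 0")
      case True
      then show ?thesis using node[OF nodes_0] r by blast
    next
      case False
      then have "0 < r" using r by simp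
      from basic_below[OF this r(2)] obtain a b where ab: "(i, a, b) \<in> basic" "a < r" "r \<le> b" .
      note b = basicD[OF ab(1)]
      obtain j k \<alpha> \<beta> where jk: "j \<noteq> k" and l: "\<And>r. r\<in>{a..b} \<Longrightarrow> F (pt u i r) = line u j k (\<alpha> + \<beta> * r)"
        using F_lin[OF ab(1)] by blast
      obtain sa where sa: "0 \<le> sa" "F (pt u i a) = pt u (i + 1) sa" using node[OF b(1)] by blast
      \<comment> \<open>The value at the outer end b is nonzero, so it decides which half of the
        line is the branch i + 1.\<close>
      obtain sb where sb: "0 < sb" "F (pt u i b) = pt u (i + 1) sb" using node[OF b(2)] b(3,4) by auto
      have la: "line u j k (\<alpha> + \<beta> * a) = pt u (i + 1) sa" and lb: "line u j k (\<alpha> + \<beta> * b) = pt u (i + 1) sb"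
        using l[of a] l[of b] sa sb b(3) by simp_all
      have between: "\<alpha> + \<beta> * a \<le> \<alpha> + \<beta> * r \<or> \<alpha> + \<beta> * b \<le> \<alpha> + \<beta> * r" "\<alpha> + \<beta> * r \<le> \<alpha> + \<beta> * a \<or> \<alpha> + \<beta> * r \<le> \<alpha> + \<beta> * b"
        using mult_left_mono[of r b \<beta>] mult_left_mono[of a r \<beta>] mult_left_mono_neg[of r b \<beta>] 
          mult_left_mono_neg[of a r \<beta>] ab(2,3) by argo+
      consider "j = i + 1" | "k = i + 1"
        using lb sb(1) pt_eq_iff[OF frame, of "\<alpha> + \<beta> * b" sb j "i + 1"] pt_eq_iff[OF frame, of "- (\<alpha> + \<beta> * b)" sb k "i + 1"]
          line_simps[OF frame, of "\<alpha> + \<beta> * b" j k] by (cases "0 \<le> \<alpha> + \<beta> * b") auto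
      then show ?thesis
      proof cases
        case 1
        then have "\<alpha> + \<beta> * a = sa" "\<alpha> + \<beta> * b = sb" 
          using line_eq_pt[OF frame jk sa(1)] line_eq_pt[OF frame jk, of sb] sb la lb by simp_all
        then have "0 \<le> \<alpha> + \<beta> * r" using between sa sb by auto
        then show ?thesis using l[of r] ab r(3) line_simps(1)[OF frame, of "\<alpha> + \<beta> * r" j k] 1 by auto
      next
        case 2
        have "line u k j (- (\<alpha> + \<beta> * a)) = pt u k sa" "line u k j (- (\<alpha> + \<beta> * b)) = pt u k sb"
          unfolding line_swap[OF frame] using la lb 2 by simp_all
        then have "- (\<alpha> + \<beta> * a) = sa" "- (\<alpha> + \<beta> * b) = sb"
          using line_eq_pt[OF frame jk[symmetric]] sa(1) less_imp_le[OF sb(1)] by blast+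
        then have "\<alpha> + \<beta> * r \<le> 0" using between sa sb by auto
        then have "F x = pt u (i + 1) (- (\<alpha> + \<beta> * r))"
          using l[of r] ab r(3) line_simps(2)[OF frame, of "\<alpha> + \<beta> * r" j k] 2 by simp
        then show ?thesis using \<open>\<alpha> + \<beta> * r \<le> 0\<close> by (intro exI[of _ "- (\<alpha> + \<beta> * r)"]) simp
      qed
    qed
    then obtain q where q: "0 \<le> q" "F x = pt u (i + 1) q" by blast
    have "x \<in> tree" unfolding r by (rule pt_in_tree[OF r(1,2)])
    then have "q \<le> tip (i + 1)" using pt_tree_le[OF q(1)] F_tree q by metis
    then show ?thesis using q by (auto simp: leg_def)
  qed
  have leg_funpow: "(F ^^ n) ` leg 0 \<subseteq> leg (of_nat n)" for n
  proof (induction n)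
    case (Suc n)
    have "(F ^^ Suc n) ` leg 0 = F ` (F ^^ n) ` leg 0" by (simp add: image_comp)
    also have "\<dots> \<subseteq> leg (of_nat n + 1)" using Suc leg_image by blast
    finally show ?case by (simp add: add.commute)
  qed simp
  \<comment> \<open>The points of the hull on branch 0 form a relatively open set, because they are
    singled out by positivity of a continuous function. Its images stay within single legs and never
    fill the hull.\<close>
  define U where "U = tree \<inter> {z. 0 < Re (z * cnj (u 0))}"
  have "open {z. 0 < Re (z * cnj (u 0))}" by (intro open_Collect_less continuous_intros)
  then have "openin (top_of_set tree) U" unfolding U_def by blast
  moreover have co: "z \<in> U \<longleftrightarrow> z \<in> tree \<and> 0 < coord u 0 z" for z by (auto simp: U_def coord_def less_max_iff_disj)
  have "pt u 0 (tip 0) \<in> U"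
    unfolding co using tip_pos[of 0] coord_pt[OF frame, of "tip 0"] pt_in_tree[of "tip 0" 0] by simp
  ultimately obtain n where n: "(F ^^ n) ` U = tree"
    using assms unfolding exact_cycle_def thull_eq topologically_exact_on_def by blast
  have "U \<subseteq> leg 0"
  proof
    fix z assume "z \<in> U"
    then have z: "z \<in> tree" "0 < coord u 0 z" using co by auto
    then obtain i r where r: "0 \<le> r" "r \<le> tip i" "z = pt u i r" using tree_cases by blast
    then have "i = 0" using z(2) coord_pt[OF frame r(1), of 0 i] by (auto split: if_splits)
    then show "z \<in> leg 0" using r by (auto simp: leg_def)
  qed
  then have sub: "tree \<subseteq> leg (of_nat n)" using n leg_funpow[of n] by blast
  define j :: 3 where "j = of_nat n + 1"
  have "pt u j (tip j) \<in> leg (of_nat n)" using sub pt_in_tree[of "tip j" j] tip_pos[of j] by auto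
  then obtain q where "0 \<le> q" "pt u j (tip j) = pt u (of_nat n) q" by (auto simp: leg_def)
  then have "j = of_nat n" using pt_eq_iff[OF frame, of "tip j" q j "of_nat n"] tip_pos[of j] by auto
  then show False using neq_add_1_3[of "of_nat n"] by (simp add: j_def)
qed

end

section \<open>Itineraries\<close>

lemma of_nat_eq_0_iff_3: "of_nat n = (0 :: 3) \<longleftrightarrow> 3 dvd n"
proof -
  have "n = 3 * (n div 3) + n mod 3" by simp
  then have "of_nat n = of_nat (3 * (n div 3)) + (of_nat (n mod 3) :: 3)" by (metis of_nat_add)
  then have eq: "of_nat n = (of_nat (n mod 3) :: 3)" using of_nat_3_mult by simp
  have "n mod 3 = 0 \<or> n mod 3 = 1 \<or> n mod 3 = 2" by linarith
  then show ?thesis unfolding eq by (auto simp: dvd_eq_mod_eq_0)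
qed

definition res :: "3 \<Rightarrow> nat" where
  "res j = (if j = 0 then 0 else if j = 1 then 1 else 2)"

lemma exc_0_iff: "exc j = 0 \<longleftrightarrow> j = 0" by (simp add: exc_def)

lemma of_int_exc: "of_int (exc j) = j"
  by (cases j rule: cases_3) (simp_all add: exc_def)

text \<open>Here \<open>res\<close> is the numerator of the displacement. The identity turns
  rotation number 1/3, that is, average numerator 1, into vanishing total deviation.\<close>

lemma res_exc: "int (res j) = exc (j - 1) + 1"
  by (cases j rule: cases_3) (simp_all add: exc_def res_def)

lemma of_nat_res: "of_nat (res j) = j"
  by (cases j rule: cases_3) (simp_all add: res_def)

lemma res_less: "res j < 3" by (simp add: res_def)

lemma periodic_mult:
  fixes w :: "nat \<Rightarrow> 'a"
  assumes "\<And>t. w (t + k) = w t"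
  shows "w (t + k * x) = w t"
proof (induction x)
  case (Suc x)
  have "w (t + k * Suc x) = w ((t + k * x) + k)" by (simp add: algebra_simps)
  then show ?case using assms Suc by simp
qed simp

lemma sum_periodic:
  fixes h :: "nat \<Rightarrow> int"
  assumes "\<And>t. h (t + d) = h t"
  shows "(\<Sum>t<d * q. h t) = int q * (\<Sum>t<d. h t)"
proof (induction q)
  case (Suc q)
  have "(\<Sum>t<a + b. h t) = (\<Sum>t<a. h t) + (\<Sum>t<b. h (t + a))" for a b
    by (induction b) (simp_all add: add.commute)
  from this[of "d * q" d] show ?case 
    using Suc periodic_mult[of h d, OF assms] by (simp add: algebra_simps)
qed simp

lemma periodic_gcd:
  fixes w :: "nat \<Rightarrow> 'a"
  assumes m: "\<And>t. w (t + m) = w t" and a: "\<And>t. w (t + a) = w t" "0 < a"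
  shows "w (t + gcd a m) = w t"
proof -
  obtain x y where xy: "a * x = m * y + gcd a m" using bezout_nat[of a m] a(2) by auto
  have "w (t + gcd a m) = w (t + gcd a m + m * y)" using periodic_mult[of w m "t + gcd a m" y, OF m] by simp
  also have "\<dots> = w (t + a * x)" unfolding xy by (simp add: ac_simps)
  also have "\<dots> = w t" using periodic_mult[of w a, OF a(1)] .
  finally show ?thesis .
qed

text \<open>Here \<open>\<beta>\<close> is the sequence of branches visited by a cycle, and \<open>\<beta> (Suc t) - \<beta> t - 1\<close> is the deviation from
  rotation by one branch. The itinerary \<open>w\<close> follows \<open>\<beta>\<close> up to the first time \<open>c\<close> at which the deviations have
  cancelled nontrivially, and then rotates by one branch until time \<open>m\<close>. Minimality of \<open>c\<close> makes \<open>w\<close> aperiodic.\<close>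

locale itinerary =
  fixes \<beta> :: "nat \<Rightarrow> 3" and n m :: nat
  assumes n_pos: "0 < n" and \<beta>_n: "\<beta> (t + n) = \<beta> t" and \<beta>_0: "\<beta> 0 = 0"
    and balanced: "(\<Sum>t<n. exc (\<beta> (Suc t) - \<beta> t - 1)) = 0" and nontrivial: "\<exists>t<n. \<beta> (Suc t) - \<beta> t \<noteq> 1"
    and m: "3 dvd m" "n < m"
begin

definition dev :: "nat \<Rightarrow> int" where
  "dev t = exc (\<beta> (Suc t) - \<beta> t - 1)"

lemma \<beta>_dev: "\<beta> t = of_nat t + of_int (\<Sum>s<t. dev s)"
proof (induction t)
  case 0
  then show ?case by (simp add: \<beta>_0)
next
  case (Suc t)
  have "\<beta> (Suc t) = \<beta> t + 1 + of_int (dev t)" unfolding dev_def of_int_exc by simp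
  then show ?case using Suc by (simp add: algebra_simps)
qed

text \<open>Once the deviations sum to 0, the branch at time t is t mod 3. Being at branch 0 then
  means that 3 divides t, so that a rotation starting there is in phase with time.\<close>

definition returns :: "nat \<Rightarrow> bool" where
  "returns t \<longleftrightarrow> 0 < t \<and> \<beta> t = 0 \<and> (\<Sum>s<t. dev s) = 0 \<and> (\<exists>s<t. dev s \<noteq> 0)"

definition c :: nat where "c = (LEAST t. returns t)"

lemma returns_n: "returns n"
  using n_pos \<beta>_n[of 0] \<beta>_0 balanced nontrivial by (auto simp: returns_def dev_def exc_0_iff)

lemma returns_c: "returns c" unfolding c_def by (rule LeastI[of returns, OF returns_n])

lemma c_le_n: "c \<le> n" unfolding c_def by (rule Least_le[of returns, OF returns_n])

lemma c_least: "returns t \<Longrightarrow> c \<le> t" unfolding c_def by (rule Least_le)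

lemma c_pos: "0 < c" and \<beta>_c: "\<beta> c = 0" and dev_sum: "(\<Sum>s<c. dev s) = 0" and dev_nonzero: "\<exists>s<c. dev s \<noteq> 0"
  using returns_c by (simp_all add: returns_def)

lemma of_nat_c: "of_nat c = (0 :: 3)"
  using \<beta>_dev[of c] \<beta>_c dev_sum by simp

lemma c_less_m: "c < m" using c_le_n m by simp

lemma m_pos: "0 < m" using m by simp

text \<open>The pieces fit at both joints: at time c both clauses give branch 0, and at time m the
  rotation closes up because 3 divides m.\<close>

definition w :: "nat \<Rightarrow> 3" where
  "w t = (if t mod m < c then \<beta> (t mod m) else of_nat (t mod m))"

lemma w_m: "w (t + m) = w t" by (simp add: w_def)

lemma w_less: "t < c \<Longrightarrow> w t = \<beta> t" using c_less_m by (simp add: w_def)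

lemma w_ge: "c \<le> t \<Longrightarrow> t \<le> m \<Longrightarrow> w t = of_nat t"
  using c_pos \<beta>_0 m of_nat_eq_0_iff_3[of m] by (cases "t = m") (simp_all add: w_def)

lemma w_le: "t \<le> c \<Longrightarrow> w t = \<beta> t"
  using w_less[of t] w_ge[of t] c_less_m \<beta>_c of_nat_c by (cases "t = c") simp_all

definition step :: "nat \<Rightarrow> 3" where "step t = w (Suc t) - w t"

lemma step_less: "t < c \<Longrightarrow> step t = \<beta> (Suc t) - \<beta> t"
  by (simp add: step_def w_le)

lemma step_ge: "c \<le> t \<Longrightarrow> t < m \<Longrightarrow> step t = 1"
  using w_ge[of t] w_ge[of "Suc t"] by (simp add: step_def)

lemma exc_step_less: "t < c \<Longrightarrow> exc (step t - 1) = dev t"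
  by (simp add: step_less dev_def)

lemma sum_step: 
  fixes h :: "3 \<Rightarrow> int"
  shows "(\<Sum>t<m. h (step t)) = (\<Sum>t<c. h (\<beta> (Suc t) - \<beta> t)) + int (m - c) * h 1"
proof -
  have "{..<m} = {..<c} \<union> {c..<m}" using c_less_m by auto
  then have "(\<Sum>t<m. h (step t)) = (\<Sum>t<c. h (step t)) + (\<Sum>t\<in>{c..<m}. h (step t))"
    by (simp add: sum.union_disjoint ivl_disj_int)
  also have "(\<Sum>t\<in>{c..<m}. h (step t)) = (\<Sum>t\<in>{c..<m}. h 1)" by (intro sum.cong) (simp_all add: step_ge)
  finally show ?thesis by (simp add: step_less)
qed

lemma sum_exc_step: "(\<Sum>t<m. exc (step t - 1)) = 0"
  using sum_step[of "\<lambda>j. exc (j - 1)"] dev_sum by (simp add: dev_def exc_0_iff)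

text \<open>A smaller period gives a period d properly dividing m. If d < c, then the deviations
  already cancel nontrivially over the first d steps, so that d is an earlier return than c. If d
  \<ge> c, then a deviating step before c is repeated d steps later, within the tail, where every
  step is 1.\<close>

lemma w_aperiodic: "\<forall>a. 0 < a \<and> a < m \<longrightarrow> (\<exists>t. w (t + a) \<noteq> w t)"
proof (intro allI impI, rule ccontr)
  fix a assume assms: "0 < a \<and> a < m" and "\<nexists>t. w (t + a) \<noteq> w t"
  then have a: "w (t + a) = w t" for t by blast
  define d where "d = gcd a m"
  have wd: "w (t + d) = w t" for t unfolding d_def by (rule periodic_gcd[OF w_m a conjunct1[OF assms]])
  have d: "0 < d" "d dvd m" "d \<le> a" using assms by (simp_all add: d_def gcd_le1_nat)
  have step_d: "step (t + d) = step t" for t using wd[of t] wd[of "Suc t"] by (simp add: step_def)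
  obtain q where q: "m = d * q" using d(2) by (auto simp: dvd_def)
  have q2: "2 \<le> q"
  proof (rule ccontr)
    assume "\<not> 2 \<le> q"
    then have "q = 0 \<or> q = 1" by linarith
    then show False using q d assms m_pos by auto
  qed
  obtain s where s: "s < c" "dev s \<noteq> 0" using dev_nonzero by blast
  have s1: "step s \<noteq> 1" using s by (auto simp: step_less dev_def exc_0_iff)
  show False
  proof (cases "d < c")
    case True
    have "int q * (\<Sum>t<d. exc (step t - 1)) = 0"
      using sum_periodic[of "\<lambda>t. exc (step t - 1)" d q] step_d sum_exc_step q by simp
    then have "(\<Sum>t<d. exc (step t - 1)) = 0" using q2 by simp
    moreover have "(\<Sum>t<d. exc (step t - 1)) = (\<Sum>t<d. dev t)" using True by (intro sum.cong) (simp_all add: exc_step_less)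
    moreover have "\<beta> d = 0" using wd[of 0] w_less[of d] w_less[of 0] True c_pos \<beta>_0 by simp
    moreover have "\<exists>t<d. dev t \<noteq> 0"
    proof -
      have "step (s mod d) = step s" using periodic_mult[of step d "s mod d" "s div d", OF step_d] by simp
      then have "step (s mod d) \<noteq> 1" using s1 by simp
      moreover have "s mod d < d" using d by simp
      ultimately show ?thesis using True exc_step_less[of "s mod d"] exc_0_iff[of "step (s mod d) - 1"] 
        by (intro exI[of _ "s mod d"]) auto
    qed
    ultimately have "returns d" using d by (simp add: returns_def)
    then show False using c_least[of d] True by simp
  next
    case False
    have "d * 2 \<le> m" unfolding q using q2 by simp
    then have "step (s + d) = 1" using step_ge[of "s + d"] False s by simp
    then show False using step_d[of s] s1 by simp
  qed
qed

end

section \<open>Orbits with prescribed itinerary\<close>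

text \<open>The branch coordinate after t steps as long as the orbit follows w; once the orbit
  leaves w the value is 0 and remains 0.\<close>

primrec route :: "(3 \<Rightarrow> complex) \<Rightarrow> (complex \<Rightarrow> complex) \<Rightarrow> (nat \<Rightarrow> 3) \<Rightarrow> nat \<Rightarrow> real \<Rightarrow> real" where
  "route u g w 0 r = r"
| "route u g w (Suc t) r = lift u g (w t) (w (Suc t)) (route u g w t r)"

lemma tdist_le_map_dist:
  assumes "f \<in> regular_maps" "g \<in> regular_maps" "x \<in> triod"
  shows "tdist (f x) (g x) \<le> map_dist f g"
proof -
  have "bdd_above ((\<lambda>x. tdist (f x) (g x)) ` triod)"
  proof (rule bdd_aboveI2)
    fix x assume "x \<in> triod"
    then have "f x \<in> triod" "g x \<in> triod" 
      using assms triod_mapsD(1) by (auto simp: regular_maps_def)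
    then show "tdist (f x) (g x) \<le> 2"
      using triod_norm_le[of "f x"] triod_norm_le[of "g x"] norm_ge_zero[of "f x"] norm_ge_zero[of "g x"]
      unfolding tdist_def by argo
  qed
  from cSUP_upper[OF assms(3) this] show ?thesis using assms by (simp add: map_dist_def)
qed

context
  fixes u :: "3 \<Rightarrow> complex"
  assumes frame: "frame u"
begin

lemma route_bounds:
  assumes "g \<in> regular_maps" "0 \<le> r" "r \<le> 1"
  shows "0 \<le> route u g w t r \<and> route u g w t r \<le> 1"
  by (induction t) (use assms lift_bounds[OF frame reg_triod_map[OF frame]] in auto)

lemma route_continuous:
  assumes "g \<in> regular_maps"
  shows "continuous_on {0..1} (route u g w t)"
proof (induction t)
  case 0
  then show ?case by (simp add: continuous_on_id)
next
  case (Suc t)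
  have "continuous_on {0..1} (\<lambda>r. lift u g (w t) (w (Suc t)) (route u g w t r))"
    by (rule continuous_on_compose2[OF lift_continuous[OF frame reg_triod_map[OF frame assms]] Suc])
      (use route_bounds[OF assms] in auto)
  then show ?case by simp
qed

lemma route_0: "g \<in> regular_maps \<Longrightarrow> route u g w t r = 0 \<Longrightarrow> route u g w (t + k) r = 0"
  by (induction k) (simp_all add: lift_0[OF frame reg_triod_map[OF frame]])

lemma route_orbit:
  assumes g: "g \<in> regular_maps" and r: "0 < r" "r \<le> 1" and "0 < route u g w t r"
  shows "(g ^^ t) (pt u (w 0) r) = pt u (w t) (route u g w t r)"
  using assms(4)
proof (induction t)
  case 0
  then show ?case by simp
next
  case (Suc t)
  have b: "0 \<le> route u g w t r" "route u g w t r \<le> 1" using route_bounds[OF g] r by auto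
  have "0 < lift u g (w t) (w (Suc t)) (route u g w t r)" using Suc.prems by simp
  from lift_pos[OF frame reg_triod_map[OF frame g] b this] show ?case using Suc.IH by simp
qed

text \<open>The error of one more step splits into the effect of \<open>f\<close> on two nearby
  points, controlled by continuity, and the difference of \<open>f\<close> and \<open>g\<close> at
  one point, controlled by \<open>map_dist\<close>. Each is given half of e.\<close>

lemma route_perturb:
  assumes f: "f \<in> regular_maps" and r: "0 \<le> r" "r \<le> 1" and "0 < e"
  shows "\<exists>d>0. \<forall>g\<in>regular_maps. map_dist f g < d \<longrightarrow> \<bar>route u g w t r - route u f w t r\<bar> < e"
  using \<open>0 < e\<close>
proof (induction t arbitrary: e)
  case 0
  then show ?case by (intro exI[of _ 1]) simp
next
  case (Suc t)
  let ?l = "\<lambda>g. lift u g (w t) (w (Suc t))"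
  have b: "0 \<le> route u g w t r \<and> route u g w t r \<le> 1" if "g \<in> regular_maps" for g
    using route_bounds[OF that r] .
  have "continuous_on {0..1} (?l f)" by (rule lift_continuous[OF frame reg_triod_map[OF frame f]])
  then obtain e' where e': "0 < e'" "\<And>s. s \<in> {0..1} \<Longrightarrow> dist s (route u f w t r) < e' \<Longrightarrow> 
      dist (?l f s) (?l f (route u f w t r)) < e / 2"
    unfolding continuous_on_iff using b[OF f] Suc.prems 
    by (metis atLeastAtMost_iff half_gt_zero)
  obtain d where d: "0 < d" "\<And>g. g\<in>regular_maps \<Longrightarrow> map_dist f g < d \<Longrightarrow> \<bar>route u g w t r - route u f w t r\<bar> < e'"
    using Suc.IH[OF e'(1)] by blast
  have "\<bar>route u g w (Suc t) r - route u f w (Suc t) r\<bar> < e" 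
    if g: "g \<in> regular_maps" and dist: "map_dist f g < min d (e / 2)" for g
  proof -
    define s where "s = route u g w t r"
    have s: "0 \<le> s" "s \<le> 1" using b[OF g] by (simp_all add: s_def)
    have tr: "pt u (w t) s \<in> triod" using s by (rule pt_in_triod[OF frame])
    have "\<bar>?l f s - ?l g s\<bar> \<le> tdist (f (pt u (w t) s)) (g (pt u (w t) s))"
      unfolding lift_def
      by (rule coord_le_tdist[OF frame]) (use triod_mapsD(1)[OF reg_triod_map[OF frame]] f g tr in auto)
    also have "\<dots> \<le> map_dist f g" by (rule tdist_le_map_dist[OF f g tr])
    finally have 1: "\<bar>?l f s - ?l g s\<bar> < e / 2" using dist by simp
    have "dist s (route u f w t r) < e'" using d(2)[OF g] dist by (simp add: s_def dist_real_def)
    then have "\<bar>?l f s - ?l f (route u f w t r)\<bar> < e / 2" using e'(2)[of s] s by (simp add: dist_real_def)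
    then show ?thesis using 1 unfolding route.simps s_def[symmetric] by linarith
  qed
  then show ?case using d(1) Suc.prems by (intro exI[of _ "min d (e / 2)"]) simp
qed

text \<open>Each lift vanishes at 0 and reaches at least \<open>y (Suc t)\<close> at
  \<open>y t\<close>. By the intermediate value theorem a positive target below \<open>y m\<close>
  can be pulled back step by step, staying below \<open>y t\<close>.\<close>

lemma pullback:
  assumes f: "f \<in> regular_maps" 
    and "\<And>t. t < m \<Longrightarrow> 0 \<le> y t \<and> y t \<le> 1 \<and> y (Suc t) \<le> lift u f (w t) (w (Suc t)) (y t)"
    and "0 < r" "r \<le> y m"
  shows "\<exists>z>0. z \<le> y 0 \<and> route u f w m z = r"
  using assms(2-)
proof (induction m arbitrary: r)
  case 0
  then show ?case by auto
next
  case (Suc m)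
  have y: "0 \<le> y m" "y m \<le> 1" "r \<le> lift u f (w m) (w (Suc m)) (y m)" 
    using Suc.prems(1)[of m] Suc.prems(3) by auto
  obtain z' where z': "0 < z'" "z' \<le> y m" "lift u f (w m) (w (Suc m)) z' = r"
    by (rule lift_hits[OF frame f y(1,2) Suc.prems(2) y(3)])
  obtain z where "0 < z" "z \<le> y 0" "route u f w m z = z'"
    using Suc.IH[of z'] Suc.prems(1) z' by (metis less_Suc_eq)
  then show ?case using z' by auto
qed

text \<open>Since 0 is absorbing, a positive value at time m forces positive values before, so the
  orbit visits the prescribed branches. A return before time m would be a smaller period of
  w.\<close>

lemma route_cycle:
  assumes g: "g \<in> regular_maps" and w: "\<And>t. w (t + m) = w t" and "0 < m"
    and aperiodic: "\<forall>a. 0 < a \<and> a < m \<longrightarrow> (\<exists>t. w (t + a) \<noteq> w t)"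
    and q: "0 < q" "q \<le> 1" "route u g w m q = q"
  defines "x \<equiv> pt u (w 0) q"
  shows "cycle g ((\<lambda>t. (g ^^ t) x) ` {..<m})" "inj_on (\<lambda>t. (g ^^ t) x) {..<m}"
    "idx u ((g ^^ t) x) = w t" "(g ^^ m) x = x"
proof -
  have pos: "0 < route u g w t q" if "t \<le> m" for t
  proof (rule ccontr)
    assume "\<not> ?thesis"
    then have "route u g w t q = 0" using route_bounds[OF g, of q w t] q by simp
    then have "route u g w (t + (m - t)) q = 0" by (rule route_0[OF g])
    then show False using that q by simp
  qed
  have orb: "(g ^^ t) x = pt u (w t) (route u g w t q)" if "t \<le> m" for t
    unfolding x_def by (rule route_orbit[OF g q(1,2) pos[OF that]])
  have "w m = w 0" using w[of 0] by simp
  then show per: "(g ^^ m) x = x" using orb[of m] q by (simp add: x_def)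
  have idx_le: "idx u ((g ^^ t) x) = w t" if "t \<le> m" for t
    unfolding orb[OF that] by (rule idx_pt[OF frame pos[OF that]]) (use route_bounds[OF g] q in simp)
  have idx: "idx u ((g ^^ t) x) = w t" for t
  proof -
    have "w t = w (t mod m)" using periodic_mult[of w m "t mod m" "t div m", OF w] by simp
    moreover have "idx u ((g ^^ (t mod m)) x) = w (t mod m)" using idx_le[of "t mod m"] \<open>0 < m\<close> by (simp add: less_imp_le)
    ultimately show ?thesis using funpow_eq_mod[OF per, of t] by simp
  qed
  then show "idx u ((g ^^ t) x) = w t" .
  have least: "(g ^^ a) x \<noteq> x" if "0 < a" "a < m" for a
  proof
    assume eq: "(g ^^ a) x = x"
    have "\<exists>t. w (t + a) \<noteq> w t" using aperiodic that by simp
    then obtain t where t: "w (t + a) \<noteq> w t" ..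
    have "(g ^^ (t + a)) x = (g ^^ t) x" using eq by (simp add: funpow_add)
    then show False using idx[of "t + a"] idx[of t] t by simp
  qed
  note cyc = cyclic_onI_funpow[OF \<open>0 < m\<close> per least]
  show "inj_on (\<lambda>t. (g ^^ t) x) {..<m}" by (rule cyc(2))
  have "(g ^^ t) x \<in> triod - {0}" if "t < m" for t
  proof -
    have t: "t \<le> m" using that by simp
    have b: "0 \<le> route u g w t q" "route u g w t q \<le> 1" using route_bounds[OF g, of q w t] q by simp_all
    have "pt u (w t) (route u g w t q) \<noteq> 0" using pt_eq_0_iff[OF frame] pos[OF t] by simp
    then show ?thesis unfolding orb[OF t] using pt_in_triod[OF frame b] by blast
  qed
  then have "(\<lambda>t. (g ^^ t) x) ` {..<m} \<subseteq> triod - {0}" by (intro image_subsetI) simp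
  then show "cycle g ((\<lambda>t. (g ^^ t) x) ` {..<m})" unfolding cycle_def by (intro conjI cyc(1))
qed

end

section \<open>Canonical orderings and frames\<close>

lemma of_nat_mod_3: "of_nat (n mod 3) = (of_nat n :: 3)"
proof -
  have "n = 3 * (n div 3) + n mod 3" by simp
  then have "of_nat n = of_nat (3 * (n div 3)) + (of_nat (n mod 3) :: 3)" by (metis of_nat_add)
  then show ?thesis using of_nat_3_mult by simp
qed

lemma res_of_nat: "k < 3 \<Longrightarrow> res (of_nat k) = k"
proof -
  assume "k < 3"
  then have "k = 0 \<or> k = 1 \<or> k = 2" by linarith
  then show ?thesis by (auto simp: res_def)
qed

lemma of_nat_3_inj: "i < 3 \<Longrightarrow> k < 3 \<Longrightarrow> (of_nat i :: 3) = of_nat k \<longleftrightarrow> i = k"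
  using res_of_nat by metis

lemma frame_change:
  assumes "frame u" "frame v"
  obtains s where "bij s" "\<And>j. v j = u (s j)"
proof -
  have ru: "range u = range v" using range_frame[OF assms(1)] range_frame[OF assms(2)] by simp
  have iu: "inj u" "inj v" using assms by (auto simp: frame_def)
  define s where "s j = inv u (v j)" for j
  have s: "v j = u (s j)" for j unfolding s_def using ru by (metis f_inv_into_f rangeI)
  have "inj s" using s iu(2) by (metis injD injI)
  then have "bij s" by (simp add: bij_def finite_UNIV_inj_surj)
  then show thesis using that s by blast
qed

lemma frame_compose: "frame u \<Longrightarrow> bij s \<Longrightarrow> frame (\<lambda>j. u (s j))"
  unfolding frame_def by (auto simp: bij_def intro!: injI dest: injD)

lemma ray_compose: "ray (\<lambda>j. u (s j)) j = ray u (s j)"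
  by (simp add: ray_def pt_def[abs_def])

lemma idx_compose:
  assumes "frame u" "bij s" "x \<in> triod" "x \<noteq> 0"
  shows "idx u x = s (idx (\<lambda>j. u (s j)) x)"
  using idx_ray[OF assms(1), of x] in_ray_idx[OF frame_compose[OF assms(1,2)] assms(3,4)] ray_compose by metis

text \<open>Every permutation of the residues mod 3 is a translation or a translation of j \<mapsto>
  - j. Hence frames fall into just two orientations, and changing the frame affects turns at most by
  a sign.\<close>

lemma bij_3_cases:
  fixes s :: "3 \<Rightarrow> 3"
  assumes "bij s"
  shows "(\<forall>a b. s a - s b = a - b) \<or> (\<forall>a b. s a - s b = b - a)"
proof -
  have inj: "s a = s b \<longleftrightarrow> a = b" for a b using assms by (metis bij_pointE)
  have ne: "s 0 \<noteq> s 1" "s 1 \<noteq> s 2" "s 2 \<noteq> s 0" unfolding inj by simp_all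
  have all: "(\<forall>a::3. Q a) \<longleftrightarrow> Q 0 \<and> Q 1 \<and> Q 2" for Q using cases_3 by metis
  show ?thesis unfolding all using ne
    by (cases "s 0" rule: cases_3; cases "s 1" rule: cases_3; cases "s 2" rule: cases_3) simp_all
qed

lemma turn_frame_change:
  assumes "frame u" "frame v"
  shows "(\<forall>x\<in>triod - {0}. g x \<in> triod - {0} \<longrightarrow> turn u g x = turn v g x) \<or>
    (\<forall>x\<in>triod - {0}. g x \<in> triod - {0} \<longrightarrow> turn u g x = - turn v g x)"
proof -
  obtain s where s: "bij s" "\<And>j. v j = u (s j)" 
    by (rule frame_change[OF assms]) (rule that)
  have v: "v = (\<lambda>j. u (s j))" using s(2) by auto
  have idx: "idx u x = s (idx v x)" if "x \<in> triod - {0}" for x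
    unfolding v using idx_compose[OF assms(1) s(1)] that by blast
  from bij_3_cases[OF s(1)] show ?thesis
  proof
    assume "\<forall>a b. s a - s b = a - b"
    then show ?thesis by (simp add: turn_def idx)
  next
    assume "\<forall>a b. s a - s b = b - a"
    then show ?thesis by (simp add: turn_def idx)
  qed
qed

lemma oriented_cycle_canonical:
  assumes "oriented_cycle u f P p"
  shows "canonical_ordering f P (\<lambda>i. ray u (of_nat i))"
proof -
  interpret oriented_cycle u f P p by (rule assms)
  have inj: "inj_on (\<lambda>i. ray u (of_nat i)) {..<3}"
  proof (rule inj_onI)
    fix i k :: nat assume ik: "i \<in> {..<3}" "k \<in> {..<3}" "ray u (of_nat i) = ray u (of_nat k)"
    have "pt u (of_nat i) 1 \<in> ray u (of_nat i)" by (auto simp: ray_def)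
    then have "(of_nat i :: 3) = of_nat k" using ik(3) ray_disjoint[OF frame] by metis
    then show "i = k" using ik of_nat_3_inj by simp
  qed
  have "(\<lambda>i. ray u (of_nat i)) ` {..<3} = branches"
    unfolding branches_eq[OF frame]
  proof (intro equalityI subsetI)
    fix b assume "b \<in> range (ray u)"
    then obtain j where "b = ray u j" by blast
    then show "b \<in> (\<lambda>i. ray u (of_nat i)) ` {..<3}"
      by (intro image_eqI[of _ _ "res j"]) (simp_all add: of_nat_res res_less)
  qed auto
  moreover have "\<exists>p\<in>P \<inter> ray u (of_nat i). (\<forall>q\<in>P \<inter> ray u (of_nat i). cmod p \<le> cmod q) \<and> f p \<in> ray u (of_nat ((i + 1) mod 3))" for i
  proof (intro bexI conjI ballI)
    show "p (of_nat i) \<in> P \<inter> ray u (of_nat i)" 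
      using p_mem in_ray_idx[OF frame memD(1,2)[OF p_mem]] p_idx by (metis IntI)
    show "cmod (p (of_nat i)) \<le> cmod q" if "q \<in> P \<inter> ray u (of_nat i)" for q
      using that p_nearest idx_ray[OF frame] by blast
    have "of_nat ((i + 1) mod 3) = (of_nat i + 1 :: 3)" unfolding of_nat_mod_3 by simp
    then show "f (p (of_nat i)) \<in> ray u (of_nat ((i + 1) mod 3))"
      using in_ray_idx[OF frame memD(1,2)[OF memD(3)[OF p_mem]]] p_image by metis
  qed
  ultimately show ?thesis unfolding canonical_ordering_def bij_betw_def using inj by blast
qed

text \<open>The ordering inside \<open>rotation_number\<close> is selected by \<open>SOME\<close>,
  so only its defining property is available. This lemma converts whichever ordering is selected
  into a frame.\<close>

lemma canonical_oriented_cycle: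
  assumes f: "f \<in> regular_maps" and P: "cycle f P" and b: "canonical_ordering f P b"
  obtains v p where "oriented_cycle v f P p" "\<And>i. i < 3 \<Longrightarrow> b i = ray v (of_nat i)"
proof -
  obtain u where u: "frame u" using frame_exists by blast
  have bij: "bij_betw b {..<3} branches" using b by (simp add: canonical_ordering_def)
  have "\<exists>j. b i = ray u j" if "i < 3" for i 
    using bij_betwE[OF bij] that branches_eq[OF u] by blast
  then obtain s0 where s0: "\<And>i. i < 3 \<Longrightarrow> b i = ray u (s0 i)" by metis
  define s where "s j = s0 (res j)" for j
  have sb: "b i = ray u (s (of_nat i))" if "i < 3" for i using s0[OF that] that by (simp add: s_def res_of_nat)
  have "inj s"
  proof (rule injI)
    fix j k assume "s j = s k"
    then have "b (res j) = b (res k)" using s0 res_less by (simp add: s_def)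
    then have "res j = res k" using bij_betw_imp_inj_on[OF bij] res_less by (metis inj_onD lessThan_iff)
    then show "j = k" by (metis of_nat_res)
  qed
  then have s: "bij s" by (simp add: bij_def finite_UNIV_inj_surj)
  define v where "v j = u (s j)" for j
  have v: "frame v" unfolding v_def by (rule frame_compose[OF u s])
  have bv: "b i = ray v (of_nat i)" if "i < 3" for i using sb[OF that] unfolding v_def ray_compose .
  interpret regular_orbit v f P by unfold_locales (rule v f P)+
  have "\<exists>p. p \<in> P \<and> idx v p = j \<and> (\<forall>q\<in>P. idx v q = j \<longrightarrow> cmod p \<le> cmod q) \<and> idx v (f p) = j + 1" for j
  proof -
    have r: "res j < 3" by (rule res_less)
    obtain p where p: "p \<in> P \<inter> b (res j)" "\<forall>q\<in>P \<inter> b (res j). cmod p \<le> cmod q" "f p \<in> b ((res j + 1) mod 3)"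
      using b r by (auto simp: canonical_ordering_def)
    have bj: "b (res j) = ray v j" using bv[OF r] by (simp add: of_nat_res)
    have "b ((res j + 1) mod 3) = ray v (j + 1)" using bv[of "(res j + 1) mod 3"] by (simp add: of_nat_mod_3 of_nat_res add.commute)
    then have "idx v (f p) = j + 1" "idx v p = j" using p idx_ray[OF v] bj by auto
    moreover have "cmod p \<le> cmod q" if "q \<in> P" "idx v q = j" for q
      using p(2) that in_ray_idx[OF v memD(1,2)[OF that(1)]] bj by auto
    ultimately show ?thesis using p by blast
  qed
  then obtain p where p: "\<And>j. p j \<in> P \<and> idx v (p j) = j \<and> (\<forall>q\<in>P. idx v q = j \<longrightarrow> cmod (p j) \<le> cmod q) \<and> idx v (f (p j)) = j + 1"
    by metis
  have "oriented_cycle v f P p" by unfold_locales (use p in auto)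
  then show thesis using that bv by blast
qed

lemma oriented_cycle_exists:
  assumes f: "f \<in> regular_maps" and P: "cycle f P"
  shows "\<exists>v p. oriented_cycle v f P p"
proof -
  obtain u where u: "frame u" using frame_exists by blast
  interpret regular_orbit u f P by unfold_locales (rule u f P)+
  obtain s :: "3 \<Rightarrow> 3" where s: "bij s" 
    and ex: "\<And>j. \<exists>p\<in>P. idx u p = s j \<and> (\<forall>q\<in>P. idx u q = s j \<longrightarrow> cmod p \<le> cmod q) \<and> idx u (f p) = s (j + 1)"
    using orientation_exists by (elim exE conjE) blast
  define v where "v j = u (s j)" for j
  have v: "frame v" unfolding v_def by (rule frame_compose[OF u s])
  interpret v: regular_orbit v f P by unfold_locales (rule v f P)+
  have idx: "idx u x = s j \<longleftrightarrow> idx v x = j" if "x \<in> P" for x j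
    using idx_compose[OF u s memD(1,2)[OF that]] s unfolding v_def by (metis bij_pointE)
  obtain p where p: "\<And>j. p j \<in> P \<and> idx u (p j) = s j \<and> (\<forall>q\<in>P. idx u q = s j \<longrightarrow> cmod (p j) \<le> cmod q) \<and> idx u (f (p j)) = s (j + 1)"
    using ex by metis
  have "oriented_cycle v f P p"
  proof
    show "p j \<in> P" for j using p by blast
    then show "idx v (p j) = j" "idx v (f (p j)) = j + 1" for j using p idx memD(3) by blast+
    show "cmod (p j) \<le> cmod q" if "q \<in> P" "idx v q = j" for q j using p idx that by blast
  qed
  then show ?thesis by blast
qed

text \<open>The frame is obtained and not prescribed: it comes from the selected ordering. Distinct
  k < 3 give distinct residues, so the description of the displacement has a unique
  solution.\<close>

lemma rotation_number_oriented:
  assumes f: "f \<in> regular_maps" and P: "cycle f P"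
  obtains v p where "oriented_cycle v f P p" 
    "rotation_number f P = (\<Sum>x\<in>P. real (res (turn v f x))) / 3 / real (card P)"
proof -
  define b where "b = (SOME b. canonical_ordering f P b)"
  have "\<exists>b. canonical_ordering f P b" using oriented_cycle_exists[OF f P] oriented_cycle_canonical by blast
  then have "canonical_ordering f P b" unfolding b_def by (rule someI_ex)
  then obtain v p where o: "oriented_cycle v f P p" and b: "\<And>i. i < 3 \<Longrightarrow> b i = ray v (of_nat i)"
    using canonical_oriented_cycle[OF f P] by blast
  interpret oriented_cycle v f P p by (rule o)
  have "displacement b f x = real (res (turn v f x)) / 3" if x: "x \<in> P" for x
  proof -
    have mem: "x \<in> b i \<longleftrightarrow> idx v x = of_nat i" "f x \<in> b i \<longleftrightarrow> idx v (f x) = of_nat i" if "i < 3" for i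
      using mem_ray_iff[OF frame memD(1,2)[OF x]] mem_ray_iff[OF frame memD(1,2)[OF memD(3)[OF x]]] b[OF that] by auto
    have iff: "(k < 3 \<and> (\<exists>i<3. x \<in> b i \<and> f x \<in> b ((i + k) mod 3))) \<longleftrightarrow> k = res (turn v f x)" for k
    proof
      assume "k < 3 \<and> (\<exists>i<3. x \<in> b i \<and> f x \<in> b ((i + k) mod 3))"
      then obtain i where i: "k < 3" "i < 3" "idx v x = of_nat i" "idx v (f x) = of_nat i + of_nat k"
        using mem by (auto simp: of_nat_mod_3)
      then have "turn v f x = of_nat k" by (simp add: turn_def)
      then show "k = res (turn v f x)" using i res_of_nat by simp
    next
      assume k: "k = res (turn v f x)"
      have "x \<in> b (res (idx v x))" using mem(1)[OF res_less] by (simp add: of_nat_res)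
      moreover have "f x \<in> b ((res (idx v x) + k) mod 3)"
        using mem(2)[of "(res (idx v x) + k) mod 3"] k by (simp add: of_nat_mod_3 of_nat_res turn_def)
      ultimately show "k < 3 \<and> (\<exists>i<3. x \<in> b i \<and> f x \<in> b ((i + k) mod 3))" using k res_less by blast
    qed
    show ?thesis unfolding displacement_def iff by simp
  qed
  then have "(\<Sum>x\<in>P. displacement b f x) = (\<Sum>x\<in>P. real (res (turn v f x)) / 3)"
    by (rule sum.cong[OF refl])
  also have "\<dots> = (\<Sum>x\<in>P. real (res (turn v f x))) / 3" by (rule sum_divide_distrib[symmetric])
  finally have "rotation_number f P = (\<Sum>x\<in>P. real (res (turn v f x))) / 3 / real (card P)"
    unfolding rotation_number_def b_def[symmetric] Let_def by (rule arg_cong)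
  then show thesis using that o by blast
qed

lemma exc_uminus: "exc (- j) = - exc j"
  by (cases j rule: cases_3) (simp_all add: exc_def)

section \<open>New exact ternary cycles\<close>

context oriented_cycle
begin

lemma sum_res_balanced:
  assumes "(\<Sum>x\<in>P. int (res (rot x))) = int (card P)"
  shows "(\<Sum>x\<in>P. exc (rot x - 1)) = 0"
proof -
  have "(\<Sum>x\<in>P. int (res (rot x))) = (\<Sum>x\<in>P. exc (rot x - 1)) + int (card P)"
    by (simp add: res_exc sum.distrib)
  then show ?thesis using assms by simp
qed

lemma idx_funpow_Suc: "idx u ((f ^^ Suc t) x) - idx u ((f ^^ t) x) = rot ((f ^^ t) x)"
  by (simp add: turn_def)

lemma ternary_itinerary:
  assumes bal: "(\<Sum>x\<in>P. int (res (rot x))) = int (card P)" and nontriv: "\<exists>x\<in>P. rot x \<noteq> 1"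
    and m: "3 dvd m" "card P < m"
  shows "itinerary (\<lambda>t. idx u ((f ^^ t) (p 0))) (card P) m"
proof
  note per = cyclic_on_period[OF cyclic p_mem[of 0]]
  show "0 < card P" by (rule per(1))
  show "idx u ((f ^^ (t + card P)) (p 0)) = idx u ((f ^^ t) (p 0))" for t
    using per(2) by (simp add: funpow_add)
  show "idx u ((f ^^ 0) (p 0)) = 0" by (simp add: p_idx)
  show "(\<Sum>t<card P. exc (idx u ((f ^^ Suc t) (p 0)) - idx u ((f ^^ t) (p 0)) - 1)) = 0"
    unfolding idx_funpow_Suc sum_over_orbit[OF p_mem, of "\<lambda>x. exc (rot x - 1)"] by (rule sum_res_balanced[OF bal])
  obtain y where y: "y \<in> P" "rot y \<noteq> 1" using nontriv by blast
  obtain t where "t < card P" "y = (f ^^ t) (p 0)" using per(3) y(1) by (auto simp: bij_betw_def)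
  then show "\<exists>t<card P. idx u ((f ^^ Suc t) (p 0)) - idx u ((f ^^ t) (p 0)) \<noteq> 1"
    unfolding idx_funpow_Suc using y by blast
qed (use m in auto)

lemma exact_ternary_of_itinerary:
  assumes "itinerary (\<lambda>t. idx u ((f ^^ t) (p 0))) (card P) m" and g: "g \<in> regular_maps"
    and q: "0 < q" "q \<le> 1" "route u g (itinerary.w (\<lambda>t. idx u ((f ^^ t) (p 0))) m) m q = q"
  shows "m \<in> P_t g"
proof -
  interpret I: itinerary "\<lambda>t. idx u ((f ^^ t) (p 0))" "card P" m by (rule assms(1))
  define x where "x = pt u (I.w 0) q"
  define Q where "Q = (\<lambda>t. (g ^^ t) x) ` {..<m}"
  note rc = route_cycle[OF frame g I.w_m I.m_pos I.w_aperiodic q, folded x_def, folded Q_def]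
  have card: "card Q = m" unfolding Q_def using card_image[OF rc(2)] by simp
  have sum_Q: "sum h Q = (\<Sum>t<m. h ((g ^^ t) x))" for h :: "complex \<Rightarrow> int"
    unfolding Q_def using sum.reindex[OF rc(2), of h] by simp
  have turn_Q: "turn u g ((g ^^ t) x) = I.step t" for t
    using rc(3)[of t] rc(3)[of "Suc t"] by (simp add: turn_def I.step_def)
  obtain v p' where v: "oriented_cycle v g Q p'"
    and rot: "rotation_number g Q = (\<Sum>x\<in>Q. real (res (turn v g x))) / 3 / real (card Q)"
    by (rule rotation_number_oriented[OF g rc(1)]) (rule that)
  interpret Q: oriented_cycle v g Q p' by (rule v)
  have "(\<Sum>x\<in>Q. exc (turn u g x)) = (\<Sum>t<m. exc (I.step t))" by (simp add: sum_Q turn_Q)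
  also have "\<dots> = (\<Sum>t<I.c. drift ((f ^^ t) (p 0))) + int (m - I.c)"
    unfolding I.sum_step idx_funpow_Suc by (simp add: exc_def)
  finally have pos: "0 < (\<Sum>x\<in>Q. exc (turn u g x))"
    using drift_prefix_nonneg[of 0 I.c] I.c_less_m by simp
  \<comment> \<open>With respect to \<open>u\<close> the total drift is positive: nonnegative on the
    prefix copied from P, and 1 for each of the m - c > 0 tail steps. If \<open>v\<close> had the
    opposite orientation, the drift with respect to \<open>v\<close> would be negative,
    contradicting \<open>Q.drift_nonneg\<close>.\<close>
  have same: "turn v g x = turn u g x" if "x \<in> Q" for x
    using turn_frame_change[OF frame Q.frame, of g]
  proof
    assume "\<forall>x\<in>triod - {0}. g x \<in> triod - {0} \<longrightarrow> turn u g x = turn v g x"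
    then show ?thesis using that Q.memD(1,2,3) by (metis Diff_iff singletonD)
  next
    assume *: "\<forall>x\<in>triod - {0}. g x \<in> triod - {0} \<longrightarrow> turn u g x = - turn v g x"
    have "turn u g x = - turn v g x" if "x \<in> Q" for x
      using * that Q.memD(1,2,3) by (metis Diff_iff singletonD)
    then have "(\<Sum>x\<in>Q. exc (turn u g x)) = - (\<Sum>x\<in>Q. exc (turn v g x))"
      by (simp add: exc_uminus sum_negf)
    then show ?thesis using pos Q.drift_nonneg by linarith
  qed
  have "(\<Sum>x\<in>Q. int (res (turn v g x))) = (\<Sum>t<m. int (res (I.step t)))"
    using sum_Q[of "\<lambda>x. int (res (turn u g x))"] same by (simp add: turn_Q)
  also have "\<dots> = int m" using I.sum_exc_step by (simp add: res_exc sum.distrib)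
  finally have "(\<Sum>x\<in>Q. real (res (turn v g x))) = real m" 
    by (metis (mono_tags, lifting) of_int_of_nat_eq of_int_sum sum.cong)
  then have "rotation_number g Q = 1 / 3" unfolding rot card using I.m_pos by simp
  moreover have "regular_cycle g Q" using g rc(1) by (simp add: regular_maps_def)
  ultimately have tern: "ternary_cycle g Q" by (simp add: ternary_cycle_def)
  have "exact_cycle g Q"
  proof (rule Q.exactness)
    obtain s where s: "s < I.c" "I.dev s \<noteq> 0" using I.dev_nonzero by blast
    have "turn u g ((g ^^ s) x) \<noteq> 1" unfolding turn_Q I.step_less[OF s(1)] using s(2) by (auto simp: I.dev_def exc_0_iff)
    moreover have "(g ^^ s) x \<in> Q" unfolding Q_def using s I.c_less_m by auto
    ultimately show "\<exists>x\<in>Q. turn v g x \<noteq> 1" using same by metis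
    have sep: "\<exists>t. idx v ((g ^^ t) ((g ^^ a) x)) \<noteq> idx v ((g ^^ t) ((g ^^ b) x))" if ab: "a < b" "b < m" for a b
    proof -
      obtain t where t: "I.w (t + (b - a)) \<noteq> I.w t" using I.w_aperiodic ab by (metis less_imp_diff_less zero_less_diff)
      \<comment> \<open>After m - a steps the first point is back at x; t further steps bring the
        two points to times t and t + (b - a) of the itinerary, modulo m.\<close>
      define k where "k = t + (m - a)"
      have ka: "(g ^^ k) ((g ^^ a) x) = (g ^^ (k + a)) x" and kb: "(g ^^ k) ((g ^^ b) x) = (g ^^ (k + b)) x" 
        by (simp_all add: funpow_add)
      have "k + a = t + m" "k + b = t + (b - a) + m" using ab by (simp_all add: k_def)
      then have "I.w (k + a) \<noteq> I.w (k + b)" using t I.w_m by metis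
      then have ne: "idx u ((g ^^ (k + a)) x) \<noteq> idx u ((g ^^ (k + b)) x)" using rc(3) by metis
      have aQ: "(g ^^ a) x \<in> Q" "(g ^^ b) x \<in> Q" using ab by (auto simp: Q_def)
      have Q: "(g ^^ (k + a)) x \<in> Q" "(g ^^ (k + b)) x \<in> Q" 
        using Q.funpow_mem[OF aQ(1), of k] Q.funpow_mem[OF aQ(2), of k] unfolding ka kb .
      obtain s where s: "bij s" "\<And>j. v j = u (s j)" by (rule frame_change[OF frame Q.frame]) (rule that)
      then have "v = (\<lambda>j. u (s j))" by auto
      then have "idx u z = s (idx v z)" if "z \<in> Q" for z
        using idx_compose[OF frame s(1) Q.memD(1,2)[OF that]] by simp
      then have "idx v ((g ^^ (k + a)) x) \<noteq> idx v ((g ^^ (k + b)) x)" using Q ne by metis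
      then show ?thesis unfolding ka[symmetric] kb[symmetric] by blast
    qed
    fix y z assume "y \<in> Q" "z \<in> Q" "y \<noteq> z"
    then obtain a b where ab: "a < m" "y = (g ^^ a) x" "b < m" "z = (g ^^ b) x" unfolding Q_def by auto
    then have "a < b \<or> b < a" using \<open>y \<noteq> z\<close> by (metis linorder_neqE_nat)
    then show "\<exists>t. idx v ((g ^^ t) y) \<noteq> idx v ((g ^^ t) z)"
      using sep[of a b] sep[of b a] ab by metis
  qed
  then show ?thesis unfolding P_t_def using tern card by blast
qed

lemma forces_exact_ternary:
  assumes bal: "(\<Sum>x\<in>P. int (res (rot x))) = int (card P)" and nontriv: "\<exists>x\<in>P. rot x \<noteq> 1"
    and m: "3 dvd m" "card P < m"
  shows "\<exists>d>0. \<forall>g\<in>regular_maps. map_dist f g < d \<longrightarrow> m \<in> P_t g"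
proof -
  define \<beta> where "\<beta> t = idx u ((f ^^ t) (p 0))" for t
  have it: "itinerary \<beta> (card P) m" using ternary_itinerary[OF assms] by (simp add: \<beta>_def[abs_def])
  interpret I: itinerary \<beta> "card P" m by (rule it)
  \<comment> \<open>Guide radii: the orbit of \<open>p 0\<close> before time c, and afterwards the
    nearest points in rotation. Each guide point is mapped at least as far out as the next one, as
    required by \<open>pullback\<close>.\<close>
  define y where "y t = (if t < I.c then cmod ((f ^^ t) (p 0)) else cmod (p (of_nat t)))" for t
  define r where "r = cmod (p 0)"
  have r: "0 < r" "r \<le> 1" using memD(1,2)[OF p_mem[of 0]] triod_norm_le by (simp_all add: r_def)
  have y_step: "0 \<le> y t \<and> y t \<le> 1 \<and> y (Suc t) \<le> lift u f (I.w t) (I.w (Suc t)) (y t)" if t: "t < m" for t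
  proof (cases "t < I.c")
    case True
    define x where "x = (f ^^ t) (p 0)"
    have x: "x \<in> P" unfolding x_def by (rule funpow_mem[OF p_mem])
    have "I.w t = idx u x" "I.w (Suc t) = idx u (f x)"
      using I.w_le[of t] I.w_le[of "Suc t"] True by (simp_all add: \<beta>_def x_def)
    then have l: "lift u f (I.w t) (I.w (Suc t)) (cmod x) = cmod (f x)"
      using lift_idx[OF frame reg_triod_map[OF frame reg] memD(1,2,4)[OF x]] by simp
    have "y (Suc t) \<le> cmod (f x)"
    proof (cases "Suc t < I.c")
      case True
      then show ?thesis by (simp add: y_def x_def)
    next
      case False
      then have c: "Suc t = I.c" using True by simp
      have "idx u (f x) = 0" using I.\<beta>_c unfolding c[symmetric] by (simp add: \<beta>_def x_def)
      \<comment> \<open>At time c the orbit is back on branch 0, where no point is nearer than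
        \<open>p 0\<close>; exchanging it for \<open>p 0\<close> only decreases the guide
        radius.\<close>
      then have "cmod (p 0) \<le> cmod (f x)" by (rule p_nearest[OF memD(3)[OF x]])
      moreover have "y (Suc t) = cmod (p 0)" unfolding y_def c I.of_nat_c by simp
      ultimately show ?thesis by simp
    qed
    moreover have "y t = cmod x" using True by (simp add: y_def x_def)
    ultimately show ?thesis using l triod_norm_le[OF memD(1)[OF x]] by simp
  next
    case False
    define j :: 3 where "j = of_nat t"
    have w: "I.w t = j" "I.w (Suc t) = j + 1" 
      using I.w_ge[of t] I.w_ge[of "Suc t"] False t by (simp_all add: j_def)
    have "lift u f j (j + 1) (cmod (p j)) = cmod (f (p j))"
      using lift_idx[OF frame reg_triod_map[OF frame reg] memD(1,2,4)[OF p_mem[of j]]] by (simp add: p_idx p_image)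
    moreover have "cmod (p (j + 1)) \<le> cmod (f (p j))" by (rule p_nearest[OF memD(3)[OF p_mem] p_image])
    moreover have "y t = cmod (p j)" "y (Suc t) = cmod (p (j + 1))" using False by (simp_all add: y_def j_def add.commute)
    ultimately show ?thesis unfolding w using triod_norm_le[OF memD(1)[OF p_mem]] by simp
  qed
  have "y m = r" using I.c_less_m m(1) by (simp add: y_def r_def flip: of_nat_eq_0_iff_3)
  moreover have y0: "y 0 = r" using I.c_pos by (simp add: y_def r_def)
  ultimately obtain z where z: "0 < z" "z \<le> r" "route u f I.w m z = r"
    using pullback[OF frame reg, of m y I.w r] y_step r by auto
  \<comment> \<open>If z = r, then \<open>p 0\<close> itself follows the itinerary, which thereby
    inherits the period card P < m.\<close>
  have "z \<noteq> r"
  proof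
    assume "z = r"
    have w0: "I.w 0 = 0" using I.w_less[OF I.c_pos] I.\<beta>_0 by simp
    have p0: "pt u (I.w 0) r = p 0"
      unfolding w0 r_def using pt_idx[OF frame memD(1,2)[OF p_mem[of 0]]] p_idx[of 0] by simp
    note rc = route_cycle[OF frame reg I.w_m I.m_pos I.w_aperiodic r z(3)[unfolded \<open>z = r\<close>], unfolded p0]
    have "I.w (t + card P) = I.w t" for t
      using rc(3)[of t] rc(3)[of "t + card P"] cyclic_on_period(2)[OF cyclic p_mem[of 0]] by (simp add: funpow_add)
    then show False using I.w_aperiodic I.n_pos m(2) by blast
  qed
  then have "0 < r - z" using z by simp
  from route_perturb[OF frame reg less_imp_le[OF z(1)] order_trans[OF z(2) r(2)] this, of I.w m]
  obtain d where d: "0 < d" "\<And>g. g\<in>regular_maps \<Longrightarrow> map_dist f g < d \<Longrightarrow> \<bar>route u g I.w m z - r\<bar> < r - z"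
    unfolding z(3) by blast
  have "m \<in> P_t g" if g: "g \<in> regular_maps" "map_dist f g < d" for g
  proof -
    \<comment> \<open>The composed map lifts z to r. A perturbation by less than the gap r - z
      leaves the image of z above z, and the fixed point found above z is positive.\<close>
    have le: "z \<le> route u g I.w m z" using d(2)[OF g] by linarith
    obtain q where q: "z \<le> q" "q \<le> 1" "route u g I.w m q = q"
      by (rule fixed_point_above[OF route_continuous[OF frame g(1), of I.w m], of z])
        (use route_bounds[OF frame g(1)] z r le that in auto)
    show ?thesis
      by (rule exact_ternary_of_itinerary[OF _ g(1), of m q, folded \<beta>_def[abs_def]]) (use it q z in auto)
  qed
  then show ?thesis using d(1) by blast
qed

text \<open>Modulo 3 the branch reached after one round is the starting branch plus the sum of all
  turns, which is card P, and the orbit has returned.\<close>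

lemma ternary_card_dvd:
  assumes "(\<Sum>x\<in>P. int (res (rot x))) = int (card P)"
  shows "3 dvd card P"
proof -
  have "idx u ((f ^^ t) (p 0)) = of_int (\<Sum>s<t. int (res (rot ((f ^^ s) (p 0)))))" for t
  proof (induction t)
    case 0
    then show ?case by (simp add: p_idx)
  next
    case (Suc t)
    have "idx u ((f ^^ Suc t) (p 0)) = idx u ((f ^^ t) (p 0)) + rot ((f ^^ t) (p 0))"
      using idx_funpow_Suc[of t "p 0"] by (simp add: algebra_simps)
    then show ?case using Suc by (simp add: of_nat_res)
  qed
  from this[of "card P"] have "idx u (p 0) = of_int (int (card P))"
    using cyclic_on_period(2)[OF cyclic p_mem[of 0]] sum_over_orbit[OF p_mem[of 0], of "\<lambda>x. int (res (rot x))"] assms by simp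
  then show ?thesis using of_nat_eq_0_iff_3 by (simp add: p_idx)
qed

text \<open>The three nearest points all turn by 1, so a point with another turn is a fourth
  one.\<close>

lemma nontrivial_card:
  assumes "\<exists>x\<in>P. rot x \<noteq> 1"
  shows "3 < card P"
proof -
  obtain x where x: "x \<in> P" "rot x \<noteq> 1" using assms by blast
  have "inj p" using p_idx by (metis injI)
  then have "card (range p) = 3" by (simp add: card_image)
  moreover have "range p \<subset> P" using x rot_p p_mem by auto
  ultimately show ?thesis using psubset_card_mono[OF finite_P] by metis
qed

end

section \<open>Periods of exact ternary cycles and their stability\<close>

lemma P_t_oriented_cycle:
  assumes f: "f \<in> regular_maps" and n: "n \<in> P_t f"
  obtains u P p where "oriented_cycle u f P p" "card P = n" 
    "(\<Sum>x\<in>P. int (res (turn u f x))) = int (card P)" "\<exists>x\<in>P. turn u f x \<noteq> 1"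
proof -
  obtain P where P: "n = card P" "exact_cycle f P" "ternary_cycle f P" using n by (auto simp: P_t_def)
  have cyc: "cycle f P" and rot: "rotation_number f P = 1 / 3"
    using P by (auto simp: exact_cycle_def ternary_cycle_def)
  obtain u p where o: "oriented_cycle u f P p" 
    and eq: "rotation_number f P = (\<Sum>x\<in>P. real (res (turn u f x))) / 3 / real (card P)"
    by (rule rotation_number_oriented[OF f cyc]) (rule that)
  interpret oriented_cycle u f P p by (rule o)
  have "0 < card P" using cyclic_on_period(1)[OF cyclic p_mem[of 0]] .
  then have "(\<Sum>x\<in>P. real (res (turn u f x))) = real (card P)" using eq rot by (simp add: field_simps)
  then have "real_of_int (\<Sum>x\<in>P. int (res (turn u f x))) = real_of_int (int (card P))" by simp
  then have "(\<Sum>x\<in>P. int (res (turn u f x))) = int (card P)" by (simp only: of_int_eq_iff)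
  then show thesis using that[OF o] P exact_nontrivial by blast
qed

lemma P_t_subset_N3: "f \<in> regular_maps \<Longrightarrow> P_t f \<subseteq> N3"
proof
  fix n assume "f \<in> regular_maps" "n \<in> P_t f"
  then obtain u P p where o: "oriented_cycle u f P p" "card P = n" 
    "(\<Sum>x\<in>P. int (res (turn u f x))) = int (card P)" "\<exists>x\<in>P. turn u f x \<noteq> 1"
    by (rule P_t_oriented_cycle)
  interpret oriented_cycle u f P p by (rule o)
  show "n \<in> N3" using ternary_card_dvd[OF o(3)] nontrivial_card[OF o(4)] o(2) by (simp add: N3_def)
qed

lemma P_t_stable:
  assumes f: "f \<in> regular_maps" and "n \<in> P_t f" "m \<in> N3" "n < m"
  shows "\<exists>N. openin regular_maps_topology N \<and> f \<in> N \<and> (\<forall>g\<in>N. m \<in> P_t g)"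
proof -
  interpret M: Metric_space regular_maps map_dist by (rule Metric_space_map_dist)
  obtain u P p where o: "oriented_cycle u f P p" "card P = n" 
    "(\<Sum>x\<in>P. int (res (turn u f x))) = int (card P)" "\<exists>x\<in>P. turn u f x \<noteq> 1"
    by (rule P_t_oriented_cycle[OF assms(1,2)])
  interpret oriented_cycle u f P p by (rule o)
  obtain d where d: "0 < d" "\<And>g. g\<in>regular_maps \<Longrightarrow> map_dist f g < d \<Longrightarrow> m \<in> P_t g"
    using forces_exact_ternary[OF o(3,4), of m] assms(3,4) o(2) by (auto simp: N3_def)
  have "openin regular_maps_topology (M.mball f d)" 
    unfolding regular_maps_topology_def by (rule M.openin_mball)
  moreover have "f \<in> M.mball f d" using f d(1) by simp
  moreover have "\<forall>g\<in>M.mball f d. m \<in> P_t g" using d(2) by simp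
  ultimately show ?thesis by blast
qed

theorem theorem5p7:
  fixes f :: "complex \<Rightarrow> complex"
  assumes "f \<in> regular_maps"
  shows "(\<forall>m\<in>N3. \<forall>n\<in>N3. m > n \<and> n \<in> P_t f \<longrightarrow>
            (\<exists>N. openin regular_maps_topology N \<and> f \<in> N \<and> (\<forall>g\<in>N. m \<in> P_t g))) \<and>
         (P_t f \<noteq> {} \<longrightarrow>
            (\<exists>m\<in>N3. P_t f = M_t m \<and>
               (\<forall>\<^sub>F g in nhdsin regular_maps_topology f. M_t m - {m} \<subseteq> P_t g)))"
proof (intro conjI impI ballI)
  fix m n assume "m \<in> N3" "m > n \<and> n \<in> P_t f"
  then show "\<exists>N. openin regular_maps_topology N \<and> f \<in> N \<and> (\<forall>g\<in>N. m \<in> P_t g)"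
    using P_t_stable[OF assms] by blast
next
  assume ne: "P_t f \<noteq> {}"
  \<comment> \<open>Stability is applied at the centre of the neighbourhood: each regular map has an
    upward closed set of periods within \<open>N3\<close>.\<close>
  have up: "k \<in> P_t g" if "g \<in> regular_maps" "n \<in> P_t g" "k \<in> N3" "n < k" for g n k
    using P_t_stable[OF that] by blast
  define m where "m = (LEAST n. n \<in> P_t f)"
  have m: "m \<in> P_t f" unfolding m_def using ne by (metis LeastI ex_in_conv)
  have least: "m \<le> n" if "n \<in> P_t f" for n unfolding m_def using that by (rule Least_le)
  have mN: "m \<in> N3" using P_t_subset_N3[OF assms] m by blast
  have eq: "P_t f = M_t m"
  proof
    show "P_t f \<subseteq> M_t m" using P_t_subset_N3[OF assms] least by (fastforce simp: M_t_def)
    show "M_t m \<subseteq> P_t f" using up[OF assms m] m by (auto simp: M_t_def)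
  qed
  \<comment> \<open>One neighbourhood has to serve infinitely many periods. It is chosen for m + 3,
    the successor of m in \<open>N3\<close>; for each \<open>g\<close> in it the larger periods then
    follow from \<open>up\<close> applied to \<open>g\<close> itself.\<close>
  have next_N: "m + 3 \<in> N3" using mN by (simp add: N3_def)
  obtain N where N: "openin regular_maps_topology N" "f \<in> N" "\<forall>g\<in>N. m + 3 \<in> P_t g"
    using P_t_stable[OF assms m next_N] by auto
  have "M_t m - {m} \<subseteq> P_t g" if "g \<in> N" for g
  proof
    fix k assume "k \<in> M_t m - {m}"
    then have k: "k \<in> N3" "m < k" by (auto simp: M_t_def)
    then have "m + 3 \<le> k" using mN by (auto simp: N3_def dvd_def)
    have g: "g \<in> regular_maps" 
      using openin_subset[OF N(1)] that topspace_regular_maps_topology by blast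
    show "k \<in> P_t g"
    proof (cases "k = m + 3")
      case True
      then show ?thesis using N(3) that by blast
    next
      case False
      then show ?thesis using up[OF g _ k(1), of "m + 3"] N(3) that \<open>m + 3 \<le> k\<close> by simp
    qed
  qed
  then have "\<forall>\<^sub>F g in nhdsin regular_maps_topology f. M_t m - {m} \<subseteq> P_t g"
    unfolding eventually_nhdsin using N by blast
  then show "\<exists>m\<in>N3. P_t f = M_t m \<and> (\<forall>\<^sub>F g in nhdsin regular_maps_topology f. M_t m - {m} \<subseteq> P_t g)"
    using mN eq by blast
qed

end
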